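(* Let $(Q,c)$ be a gentle string algebra with coloring $c$, $\beta\in\mathbb N^{Q_0}$ a dimension vector, $r$ a maximal rank map for $\beta$, and $\epsilon$ a sign function on $(Q,c)$. Let $\Gamma=\Gamma_{Q,c}(\beta,r,\epsilon)$, let $B(\Gamma)$ be its set of bands, let $\Theta$ be a choice function, and let $M_\lambda=M_{Q,c}(\beta,r,\epsilon,\Theta)_\lambda$ for $\lambda\in(\Bbbk^* )^{B(\Gamma)}$. Then $$\bigcup_{\lambda\in(\Bbbk^* )^{B(\Gamma)}}\mathcal O_{M_\lambda}$$ is dense in $\operatorname{Rep}_{Q,c}(\beta,r)$, where $\mathcal O_{M_\lambda}$ is the $\operatorname{GL}(\beta)$-orbit of $M_\lambda$.
   Context: $\Bbbk$ is an algebraically closed field. $Q=(Q_0,Q_1)$ is a finite quiver, not assumed acyclic; $ta$, $ha$ denote tail and head of an arrow $a$. A path is a sequence of arrows $a_s\cdots a_1$ with $ha_i=ta_{i+1}$. Gentle string algebra: a finite-dimensional algebra of the form $\Bbbk Q/I$ such that (i) each vertex is the head of at most two arrows and the tail of at most two arrows; (ii) for each arrow $b$ there is at most one arrow $a$ with $ta=hb$ and $ab\notin I$, and at most one arrow $d$ with $hd=tb$ and $bd\notin I$; (iii) for each arrow $b$ there is at most one arrow $a$ with $ta=hb$ and $ab\in I$, and at most one arrow $d$ with $hd=tb$ and $bd\in I$; (iv) $I$ is generated by paths of length 2. Coloring: a map $c:Q_1\to S$, $S$ a finite set (of colors), such that $c^{-1}(s)$ is a directed path for each $s\in S$. Put $I_c=\langle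 ba \mid ha=tb,\ c(a)=c(b)\rangle$. "$(Q,c)$ is a gentle string algebra" means that $\Bbbk Q/I_c$ is one. Rank map for $\beta$: a map $r:Q_1\to\mathbb N$ with $r(a)\le\min(\beta_{ta},\beta_{ha})$ for all $a$, and $r(a_1)+r(a_2)\le\beta_{ha_1}$ for each path $a_2a_1$ with $c(a_1)=c(a_2)$. It is maximal if it is maximal among rank maps for $\beta$ for the pointwise order. $\operatorname{Rep}_{Q,c}(\beta,r)$ is the set of tuples $(V_a)_a\in\prod_{a\in Q_1}\operatorname{Hom}_{\Bbbk}(\Bbbk^{\beta_{ta}},\Bbbk^{\beta_{ha}})$ satisfying the relations in $I_c$ and $\operatorname{rank}V_a\le r(a)$ for all $a$ (each irreducible component of the variety of $\beta$-dimensional representations of $\Bbbk Q/I_c$ is of this form with $r$ maximal). $\operatorname{GL}(\beta)=\prod_{x\in Q_0}\operatorname{GL}(\beta_x)$ acts by base change. Sign function: let $\mathfrak X\subset Q_0\times S$ be the set of pairs $(x,s)$ such that some arrow of color $s$ is incident to $x$. A sign function is a map $\epsilon:\mathfrak X\to\{\pm1\}$ with $\epsilon(x,s_1)=-\epsilon(x,s_2)$ whenever $(x,s_1)\ne(x,s_2)$ are in $\mathfrak X$. Up-and-down graph $\Gamma=\Gamma_{Q,c}(\beta,r,\epsilon)$: the graph with vertices $v_i^x$, $x\in Q_0$, $1\le i\le\beta_x$, and, for each arrow $a$ and each $i=1,\dots,r(a)$, one edge, labeled $a$: $v_i^{ta} - v_i^{ha}$ if $\epsilon(ta,c(a))=1,\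 \epsilon(ha,c(a))=-1$; $v_i^{ta} - v_{\beta_{ha}-i+1}^{ha}$ if $\epsilon(ta,c(a))=\epsilon(ha,c(a))=1$; $v_{\beta_{ta}-i+1}^{ta} - v_i^{ha}$ if $\epsilon(ta,c(a))=\epsilon(ha,c(a))=-1$; $v_{\beta_{ta}-i+1}^{ta} - v_{\beta_{ha}-i+1}^{ha}$ if $\epsilon(ta,c(a))=-1,\ \epsilon(ha,c(a))=1$. Every vertex lies in at most two edges, so each connected component is a string (a path graph, possibly a single vertex) or a band (a cycle). $B(\Gamma)$ is the set of bands. A vertex $v_j^x$ is a target if every edge containing it has a label $a$ with $ha=x$. Up-and-down modules: a choice function $\Theta$ assigns to each $b\in B(\Gamma)$ a target $\Theta(b)$ contained in $b$. For $\lambda\in(\Bbbk^* )^{B(\Gamma)}$, $M_{Q,c}(\beta,r,\epsilon,\Theta)_\lambda$ is the representation $M_\lambda$ in which $(M_\lambda)_x$ has basis $e_1^x,\dots,e_{\beta_x}^x$, and for each arrow $a$: if $v_j^{ta}$ and $v_k^{ha}$ are joined by an edge labeled $a$, then $(M_\lambda)_a(e_j^{ta})=\lambda_b e_k^{ha}$ if $\Theta(b)=v_k^{ha}$ for some band $b$ and $\epsilon(ha,c(a))=1$, and $(M_\lambda)_a(e_j^{ta})=e_k^{ha}$ otherwise; if there is no such edge, then $(M_\lambda)_a(e_j^{ta})=0$. (If $B(\Gamma)=\emptyset$ there is exactly one such module.)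
   Formalization: For loop arrows, each edge of the up-and-down graph is taken to run from a tail end to a head end: the module maps only tail end to head end, and a target must be the head end of every edge containing it; read literally, the claim fails for quivers with loops. *)

theory Defs
  imports
    "HOL-Library.Poly_Mapping"
    "HOL-Analysis.Abstract_Topology"
    "HOL-Computational_Algebra.Polynomial"
    "HOL-Algebra.QuotRing"
    "Graph_Theory.Digraph_Component"
    "Jordan_Normal_Form.DL_Rank"
begin

text \<open>
  A quiver is a finite multidigraph, i.e. a \<open>pre_digraph\<close> satisfying \<open>fin_digraph\<close>
  (loops and parallel arrows are allowed).  A path is a pair \<open>(u, p)\<close> of a start vertex and the
  list of its arrows \<^emph>\<open>in the order in which they are traversed\<close>; thus the path written \<open>b a\<close>
  (first \<open>a\<close>, then \<open>b\<close>) is \<open>(tail Q a, [a, b])\<close>, and \<open>(x, [])\<close> is the trivial path at \<open>x\<close>.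
\<close>

section \<open>Path algebras\<close>

type_synonym ('v, 'a) path = "'v \<times> 'a list"

definition paths :: "('v, 'a) pre_digraph \<Rightarrow> ('v, 'a) path set" where
  "paths Q = {(u, p). \<exists>v. pre_digraph.awalk Q u p v}"

text \<open>The product \<open>P P'\<close> of two basis paths is \<open>P\<close> after \<open>P'\<close>, or zero.\<close>

definition path_prod ::
    "('v, 'a) pre_digraph \<Rightarrow> ('v, 'a) path \<Rightarrow> ('v, 'a) path \<Rightarrow> 'k::field \<Rightarrow> ('v, 'a) path \<Rightarrow>\<^sub>0 'k" where
  "path_prod Q P P' k =
     (if pre_digraph.cas Q (fst P') (snd P') (fst P)
      then Poly_Mapping.single (fst P', snd P' @ snd P) k else 0)"

definition path_mult ::
    "('v, 'a) pre_digraph \<Rightarrow> (('v, 'a) path \<Rightarrow>\<^sub>0 'k::field) \<Rightarrow> (('v, 'a) path \<Rightarrow>\<^sub>0 'k)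
       \<Rightarrow> ('v, 'a) path \<Rightarrow>\<^sub>0 'k" where
  "path_mult Q f g =
     (\<Sum>P\<in>Poly_Mapping.keys f. \<Sum>P'\<in>Poly_Mapping.keys g.
        path_prod Q P P' (Poly_Mapping.lookup f P * Poly_Mapping.lookup g P'))"

definition path_algebra :: "('v, 'a) pre_digraph \<Rightarrow> (('v, 'a) path \<Rightarrow>\<^sub>0 'k::field) ring" where
  "path_algebra Q =
     \<lparr> carrier = {f. Poly_Mapping.keys f \<subseteq> paths Q},
       monoid.mult = path_mult Q,
       one = (\<Sum>x\<in>verts Q. Poly_Mapping.single (x, []) 1),
       zero = 0,
       add = (+) \<rparr>"

definition path_elem :: "('v, 'a) pre_digraph \<Rightarrow> 'a list \<Rightarrow> ('v, 'a) path \<Rightarrow>\<^sub>0 'k::field" where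
  "path_elem Q p = Poly_Mapping.single (tail Q (hd p), p) 1"

text \<open>The path algebra is a ring, so that the library's ideals, generated ideals and quotients
  have their usual meaning for it.\<close>

lemma path_prod_add:
  "path_prod Q P P' (k + l) = path_prod Q P P' k + path_prod Q P P' l"
  by (simp add: path_prod_def single_add)

lemma path_prod_zero [simp]: "path_prod Q P P' 0 = 0"
  by (simp add: path_prod_def)

lemma path_mult_eq:
  assumes "finite A" "Poly_Mapping.keys f \<subseteq> A" "finite B" "Poly_Mapping.keys g \<subseteq> B"
  shows "path_mult Q f g =
    (\<Sum>P\<in>A. \<Sum>P'\<in>B. path_prod Q P P' (Poly_Mapping.lookup f P * Poly_Mapping.lookup g P'))"
proof -
  have "(\<Sum>P'\<in>Poly_Mapping.keys g. path_prod Q P P' (Poly_Mapping.lookup f P * Poly_Mapping.lookup g P'))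
      = (\<Sum>P'\<in>B. path_prod Q P P' (Poly_Mapping.lookup f P * Poly_Mapping.lookup g P'))" for P
    using assms by (intro sum.mono_neutral_left) (auto simp: in_keys_iff)
  then have "path_mult Q f g = (\<Sum>P\<in>Poly_Mapping.keys f. \<Sum>P'\<in>B.
      path_prod Q P P' (Poly_Mapping.lookup f P * Poly_Mapping.lookup g P'))"
    by (simp add: path_mult_def)
  also have "\<dots> = (\<Sum>P\<in>A. \<Sum>P'\<in>B.
      path_prod Q P P' (Poly_Mapping.lookup f P * Poly_Mapping.lookup g P'))"
    using assms by (intro sum.mono_neutral_left) (auto simp: in_keys_iff)
  finally show ?thesis .
qed

lemma path_mult_add_left: "path_mult Q (f + g) h = path_mult Q f h + path_mult Q g h"
proof -
  define A where "A = Poly_Mapping.keys f \<union> Poly_Mapping.keys g"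
  have A: "finite A" "Poly_Mapping.keys f \<subseteq> A" "Poly_Mapping.keys g \<subseteq> A"
      "Poly_Mapping.keys (f + g) \<subseteq> A"
    using Poly_Mapping.keys_add[of f g] by (auto simp: A_def)
  show ?thesis
    using A by (simp add: path_mult_eq[where A = A and B = "Poly_Mapping.keys h"] lookup_add
        distrib_right path_prod_add sum.distrib)
qed

lemma path_mult_add_right: "path_mult Q h (f + g) = path_mult Q h f + path_mult Q h g"
proof -
  define A where "A = Poly_Mapping.keys f \<union> Poly_Mapping.keys g"
  have A: "finite A" "Poly_Mapping.keys f \<subseteq> A" "Poly_Mapping.keys g \<subseteq> A"
      "Poly_Mapping.keys (f + g) \<subseteq> A"
    using Poly_Mapping.keys_add[of f g] by (auto simp: A_def)
  show ?thesis
    using A by (simp add: path_mult_eq[where B = A and A = "Poly_Mapping.keys h"] lookup_add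
        distrib_left path_prod_add sum.distrib)
qed

lemma path_mult_zero [simp]: "path_mult Q 0 g = 0" "path_mult Q f 0 = 0"
  by (simp_all add: path_mult_def)

lemma path_mult_single:
  "path_mult Q (Poly_Mapping.single P k) (Poly_Mapping.single P' l) = path_prod Q P P' (k * l)"
  by (subst path_mult_eq[where A = "{P}" and B = "{P'}"]) auto

lemma poly_mapping_additive_induct [case_names zero single add]:
  fixes f :: "'p \<Rightarrow>\<^sub>0 'k::field"
  assumes "X 0" "\<And>P k. P \<in> Poly_Mapping.keys f \<Longrightarrow> X (Poly_Mapping.single P k)"
    "\<And>g h. X g \<Longrightarrow> X h \<Longrightarrow> X (g + h)"
  shows "X f"
proof -
  have "X (\<Sum>P\<in>A. Poly_Mapping.single P (Poly_Mapping.lookup f P))"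
    if "finite A" "A \<subseteq> Poly_Mapping.keys f" for A
    using that by (induction A rule: finite_induct) (auto intro: assms)
  then have "X (\<Sum>P\<in>Poly_Mapping.keys f. Poly_Mapping.single P (Poly_Mapping.lookup f P))"
    by auto
  moreover have "(\<Sum>P\<in>Poly_Mapping.keys f. Poly_Mapping.single P (Poly_Mapping.lookup f P)) = f"
    by (rule poly_mapping_eqI) (simp add: lookup_sum lookup_single when_def in_keys_iff)
  ultimately show ?thesis
    by simp
qed

lemma cas_append: 
  "pre_digraph.cas Q u (p @ q) w \<longleftrightarrow> (\<exists>v. pre_digraph.cas Q u p v \<and> pre_digraph.cas Q v q w)"
  by (induction p arbitrary: u) (auto simp: pre_digraph.cas.simps)

lemma cas_unique:
  "pre_digraph.cas Q u p v \<Longrightarrow> pre_digraph.cas Q u p w \<Longrightarrow> v = w"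
  by (induction p arbitrary: u) (auto simp: pre_digraph.cas.simps)

lemma path_mult_assoc: "path_mult Q (path_mult Q f g) h = path_mult Q f (path_mult Q g h)"
proof (induction f rule: poly_mapping_additive_induct)
  case (single P k)
  show ?case
  proof (induction g rule: poly_mapping_additive_induct)
    case (single P' k')
    show ?case
    proof (induction h rule: poly_mapping_additive_induct)
      case (single P'' k'')
      show ?case
      proof -
        have "(\<exists>v. pre_digraph.cas Q u p v \<and> pre_digraph.cas Q v q w) \<longleftrightarrow> pre_digraph.cas Q v' q w"
          if "pre_digraph.cas Q u p v'" for u p v' q w
          using that cas_unique by metis
        then show ?thesis
          by (cases P; cases P'; cases P'')
            (simp add: path_mult_single path_prod_def cas_append mult.assoc)
      qed
    qed (auto simp: path_mult_add_right)
  qed (auto simp: path_mult_add_left path_mult_add_right)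
qed (auto simp: path_mult_add_left)

lemma path_mult_closed:
  assumes "Poly_Mapping.keys f \<subseteq> paths Q" "Poly_Mapping.keys g \<subseteq> paths Q"
  shows "Poly_Mapping.keys (path_mult Q f g) \<subseteq> paths Q"
proof (induction f rule: poly_mapping_additive_induct)
  case (single P k)
  then have P: "P \<in> paths Q"
    using assms by auto
  show ?case
  proof (induction g rule: poly_mapping_additive_induct)
    case (single P' k')
    then have P': "P' \<in> paths Q"
      using assms by auto
    obtain v where v: "pre_digraph.awalk Q (fst P) (snd P) v"
      using P by (auto simp: paths_def)
    have "pre_digraph.awalk Q (fst P') (snd P' @ snd P) v"
      if "pre_digraph.cas Q (fst P') (snd P') (fst P)"
      using that v P' by (auto simp: paths_def pre_digraph.awalk_def cas_append)
    then show ?case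
      by (auto simp: path_mult_single path_prod_def paths_def)
  next
    case (add g h)
    then show ?case
      using Poly_Mapping.keys_add[of "path_mult Q (Poly_Mapping.single P k) g"
        "path_mult Q (Poly_Mapping.single P k) h"] by (auto simp: path_mult_add_right)
  qed auto
next
  case (add f1 f2)
  then show ?case
    using Poly_Mapping.keys_add[of "path_mult Q f1 g" "path_mult Q f2 g"]
    by (auto simp: path_mult_add_left)
qed auto

lemma path_mult_sum_left: "path_mult Q (\<Sum>x\<in>A. F x) g = (\<Sum>x\<in>A. path_mult Q (F x) g)"
  by (induction A rule: infinite_finite_induct) (auto simp: path_mult_add_left)

lemma path_mult_sum_right: "path_mult Q g (\<Sum>x\<in>A. F x) = (\<Sum>x\<in>A. path_mult Q g (F x))"
  by (induction A rule: infinite_finite_induct) (auto simp: path_mult_add_right)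

lemma (in fin_digraph) path_mult_one_left:
  assumes "Poly_Mapping.keys f \<subseteq> paths G"
  shows "path_mult G (\<Sum>x\<in>verts G. Poly_Mapping.single (x, []) 1) f = f"
proof (induction f rule: poly_mapping_additive_induct)
  case (single P k)
  then obtain v where v: "awalk (fst P) (snd P) v"
    using assms by (auto simp: paths_def)
  then have "path_mult G (Poly_Mapping.single (x, []) 1) (Poly_Mapping.single P k)
      = (if x = v then Poly_Mapping.single P k else 0)" for x
    using cas_unique[of G "fst P" "snd P" v]
    by (auto simp: path_mult_single path_prod_def awalk_def)
  then show ?case
    using awalk_last_in_verts v by (auto simp: path_mult_sum_left)
qed (auto simp: path_mult_add_right)

lemma (in fin_digraph) path_mult_one_right:
  assumes "Poly_Mapping.keys f \<subseteq> paths G"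
  shows "path_mult G f (\<Sum>x\<in>verts G. Poly_Mapping.single (x, []) 1) = f"
proof (induction f rule: poly_mapping_additive_induct)
  case (single P k)
  then obtain v where v: "awalk (fst P) (snd P) v"
    using assms by (auto simp: paths_def)
  have "path_mult G (Poly_Mapping.single P k) (Poly_Mapping.single (x, []) 1)
      = (if x = fst P then Poly_Mapping.single P k else 0)" for x
    by (auto simp: path_mult_single path_prod_def)
  then show ?case
    using v by (auto simp: path_mult_sum_right awalk_def)
qed (auto simp: path_mult_add_left)

lemma ring_path_algebra:
  assumes "fin_digraph Q"
  shows "ring (path_algebra Q :: (('v, 'a) path \<Rightarrow>\<^sub>0 'k::field) ring)"
proof -
  interpret fin_digraph Q by fact
  have one: "Poly_Mapping.keys (\<Sum>x\<in>verts Q. Poly_Mapping.single (x, []) (1::'k)) \<subseteq> paths Q"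
    using Poly_Mapping.keys_sum[of "\<lambda>x. Poly_Mapping.single (x, []) (1::'k)" "verts Q"]
    by (fastforce simp: paths_def awalk_def)
  have add: "Poly_Mapping.keys (f + g) \<subseteq> paths Q"
    if "Poly_Mapping.keys f \<subseteq> paths Q" "Poly_Mapping.keys g \<subseteq> paths Q"
    for f g :: "('v, 'a) path \<Rightarrow>\<^sub>0 'k"
    using that Poly_Mapping.keys_add[of f g] by auto
  show ?thesis
  proof (rule ringI)
    show "abelian_group (path_algebra Q :: (('v, 'a) path \<Rightarrow>\<^sub>0 'k) ring)"
    proof (rule abelian_groupI)
      fix f :: "('v, 'a) path \<Rightarrow>\<^sub>0 'k"
      assume "f \<in> carrier (path_algebra Q)"
      then show "\<exists>g\<in>carrier (path_algebra Q). g \<oplus>\<^bsub>path_algebra Q\<^esub> f = \<zero>\<^bsub>path_algebra Q\<^esub>"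
        by (intro bexI[of _ "- f"]) (auto simp: path_algebra_def)
    qed (auto simp: path_algebra_def add_ac dest: subsetD[OF add])
  next
    show "monoid (path_algebra Q :: (('v, 'a) path \<Rightarrow>\<^sub>0 'k) ring)"
      by (rule monoidI)
        (use one path_mult_closed[of _ Q] in
          \<open>simp_all add: path_algebra_def path_mult_assoc path_mult_one_left path_mult_one_right\<close>)
  qed (auto simp: path_algebra_def path_mult_add_left path_mult_add_right)
qed

section \<open>Gentle string algebras and colorings\<close>

definition finite_dim_quotient ::
    "('v, 'a) pre_digraph \<Rightarrow> (('v, 'a) path \<Rightarrow>\<^sub>0 'k::field) set \<Rightarrow> bool" where
  "finite_dim_quotient Q I \<longleftrightarrow>
     (\<exists>B. finite B \<and> B \<subseteq> carrier (path_algebra Q) \<and>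
       (\<forall>X\<in>carrier (path_algebra Q Quot I). \<exists>k.
          X = I +>\<^bsub>path_algebra Q\<^esub> (\<Sum>f\<in>B. Poly_Mapping.map ((*) (k f)) f)))"

definition gentle_string_algebra ::
    "('v, 'a) pre_digraph \<Rightarrow> (('v, 'a) path \<Rightarrow>\<^sub>0 'k::field) set \<Rightarrow> bool" where
  "gentle_string_algebra Q I \<longleftrightarrow>
     ideal I (path_algebra Q) \<and> finite_dim_quotient Q I \<and>
     (\<forall>x\<in>verts Q. in_degree Q x \<le> 2 \<and> out_degree Q x \<le> 2) \<and>
     (\<forall>b\<in>arcs Q.
        (\<exists>\<^sub>\<le>\<^sub>1 a. a \<in> arcs Q \<and> tail Q a = head Q b \<and> path_elem Q [b, a] \<notin> I) \<and>
        (\<exists>\<^sub>\<le>\<^sub>1 d. d \<in> arcs Q \<and> head Q d = tail Q b \<and> path_elem Q [d, b] \<notin> I)) \<and>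
     (\<forall>b\<in>arcs Q.
        (\<exists>\<^sub>\<le>\<^sub>1 a. a \<in> arcs Q \<and> tail Q a = head Q b \<and> path_elem Q [b, a] \<in> I) \<and>
        (\<exists>\<^sub>\<le>\<^sub>1 d. d \<in> arcs Q \<and> head Q d = tail Q b \<and> path_elem Q [d, b] \<in> I)) \<and>
     (\<exists>R \<subseteq> {Poly_Mapping.single P 1 | P. P \<in> paths Q \<and> length (snd P) = 2}.
        I = Idl\<^bsub>path_algebra Q\<^esub> R)"

text \<open>A \<open>trail\<close> is a directed walk without repeated arrows; it may revisit vertices and may be
  closed, and it may be empty (an unused color).\<close>

definition coloring :: "('v, 'a) pre_digraph \<Rightarrow> 's set \<Rightarrow> ('a \<Rightarrow> 's) \<Rightarrow> bool" where
  "coloring Q S c \<longleftrightarrow> finite S \<and> c \<in> arcs Q \<rightarrow> S \<and>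
     (\<forall>s\<in>S. \<exists>u p v. pre_digraph.trail Q u p v \<and> set p = {a \<in> arcs Q. c a = s})"

definition color_ideal ::
    "('v, 'a) pre_digraph \<Rightarrow> ('a \<Rightarrow> 's) \<Rightarrow> (('v, 'a) path \<Rightarrow>\<^sub>0 'k::field) set" where
  "color_ideal Q c = Idl\<^bsub>path_algebra Q\<^esub>
     {path_elem Q [a, b] | a b. a \<in> arcs Q \<and> b \<in> arcs Q \<and> head Q a = tail Q b \<and> c a = c b}"

section \<open>Rank maps and representation varieties\<close>

definition rank_map ::
    "('v, 'a) pre_digraph \<Rightarrow> ('a \<Rightarrow> 's) \<Rightarrow> ('v \<Rightarrow> nat) \<Rightarrow> ('a \<Rightarrow> nat) \<Rightarrow> bool" where
  "rank_map Q c \<beta> r \<longleftrightarrow>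
     (\<forall>a\<in>arcs Q. r a \<le> min (\<beta> (tail Q a)) (\<beta> (head Q a))) \<and>
     (\<forall>a1\<in>arcs Q. \<forall>a2\<in>arcs Q. head Q a1 = tail Q a2 \<and> c a1 = c a2 \<longrightarrow>
        r a1 + r a2 \<le> \<beta> (head Q a1))"

definition maximal_rank_map ::
    "('v, 'a) pre_digraph \<Rightarrow> ('a \<Rightarrow> 's) \<Rightarrow> ('v \<Rightarrow> nat) \<Rightarrow> ('a \<Rightarrow> nat) \<Rightarrow> bool" where
  "maximal_rank_map Q c \<beta> r \<longleftrightarrow> rank_map Q c \<beta> r \<and>
     (\<forall>r'. rank_map Q c \<beta> r' \<and> (\<forall>a\<in>arcs Q. r a \<le> r' a) \<longrightarrow> (\<forall>a\<in>arcs Q. r' a = r a))"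

definition rep_space :: "('v, 'a) pre_digraph \<Rightarrow> ('v \<Rightarrow> nat) \<Rightarrow> ('a \<Rightarrow> 'k::field mat) set" where
  "rep_space Q \<beta> = (\<Pi>\<^sub>E a\<in>arcs Q. carrier_mat (\<beta> (head Q a)) (\<beta> (tail Q a)))"

definition rep_variety ::
    "('v, 'a) pre_digraph \<Rightarrow> ('a \<Rightarrow> 's) \<Rightarrow> ('v \<Rightarrow> nat) \<Rightarrow> ('a \<Rightarrow> nat) \<Rightarrow> ('a \<Rightarrow> 'k::field mat) set" where
  "rep_variety Q c \<beta> r = {V \<in> rep_space Q \<beta>.
     (\<forall>a\<in>arcs Q. \<forall>b\<in>arcs Q. head Q a = tail Q b \<and> c a = c b \<longrightarrow>
        V b * V a = 0\<^sub>m (\<beta> (head Q b)) (\<beta> (tail Q a))) \<and>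
     (\<forall>a\<in>arcs Q. vec_space.rank (\<beta> (head Q a)) (V a) \<le> r a)}"

abbreviation GL :: "nat \<Rightarrow> 'k::field mat set" where
  "GL n \<equiv> Units (ring_mat TYPE('k) n ())"

definition gl_act ::
    "('v, 'a) pre_digraph \<Rightarrow> ('v \<Rightarrow> nat) \<Rightarrow> ('v \<Rightarrow> 'k::field mat) \<Rightarrow> ('a \<Rightarrow> 'k mat) \<Rightarrow> 'a \<Rightarrow> 'k mat" where
  "gl_act Q \<beta> g V = (\<lambda>a\<in>arcs Q.
     g (head Q a) * V a * inv\<^bsub>ring_mat TYPE('k) (\<beta> (tail Q a)) ()\<^esub> (g (tail Q a)))"

definition gl_orbit ::
    "('v, 'a) pre_digraph \<Rightarrow> ('v \<Rightarrow> nat) \<Rightarrow> ('a \<Rightarrow> 'k::field mat) \<Rightarrow> ('a \<Rightarrow> 'k mat) set" where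
  "gl_orbit Q \<beta> V = (\<lambda>g. gl_act Q \<beta> g V) ` (\<Pi>\<^sub>E x\<in>verts Q. GL (\<beta> x))"

section \<open>The Zariski topology\<close>

text \<open>Polynomial functions in a given set \<open>X\<close> of coordinate functions.\<close>

inductive_set polynomial_functions :: "('p \<Rightarrow> 'k::field) set \<Rightarrow> ('p \<Rightarrow> 'k) set"
  for X :: "('p \<Rightarrow> 'k) set" where
  const: "(\<lambda>_. k) \<in> polynomial_functions X"
| coord: "f \<in> X \<Longrightarrow> f \<in> polynomial_functions X"
| add: "f \<in> polynomial_functions X \<Longrightarrow> g \<in> polynomial_functions X \<Longrightarrow>
    (\<lambda>p. f p + g p) \<in> polynomial_functions X"
| mult: "f \<in> polynomial_functions X \<Longrightarrow> g \<in> polynomial_functions X \<Longrightarrow>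
    (\<lambda>p. f p * g p) \<in> polynomial_functions X"

text \<open>The Zariski topology on the affine space \<open>A\<close> with coordinate functions \<open>X\<close>: the closed sets
  are the common zero loci of sets of polynomial functions.\<close>

definition zariski_topology :: "'p set \<Rightarrow> ('p \<Rightarrow> 'k::field) set \<Rightarrow> 'p topology" where
  "zariski_topology A X = topology (\<lambda>U. \<exists>F \<subseteq> polynomial_functions X.
     U = A - {p \<in> A. \<forall>f\<in>F. f p = 0})"

lemma istopology_zariski:
  "istopology (\<lambda>U. \<exists>F \<subseteq> polynomial_functions X. U = A - {p \<in> A. \<forall>f\<in>F. f p = (0::'k::field)})"
  unfolding istopology_def
proof (intro conjI allI impI)
  fix U V
  assume "\<exists>F \<subseteq> polynomial_functions X. U = A - {p \<in> A. \<forall>f\<in>F. f p = 0}"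
    and "\<exists>F \<subseteq> polynomial_functions X. V = A - {p \<in> A. \<forall>f\<in>F. f p = 0}"
  then obtain F G where F: "F \<subseteq> polynomial_functions X" "U = A - {p \<in> A. \<forall>f\<in>F. f p = 0}"
    and G: "G \<subseteq> polynomial_functions X" "V = A - {p \<in> A. \<forall>f\<in>G. f p = 0}"
    by blast
  let ?H = "{\<lambda>p. f p * g p | f g. f \<in> F \<and> g \<in> G}"
  have "?H \<subseteq> polynomial_functions X"
    using F G by (auto intro: polynomial_functions.mult)
  moreover have "U \<inter> V = A - {p \<in> A. \<forall>f\<in>?H. f p = 0}"
  proof (intro equalityI subsetI)
    fix p
    assume "p \<in> U \<inter> V"
    then obtain f g where "p \<in> A" "f \<in> F" "g \<in> G" "f p \<noteq> 0" "g p \<noteq> 0"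
      unfolding F(2) G(2) by auto
    then have "(\<lambda>p. f p * g p) \<in> ?H" "f p * g p \<noteq> 0"
      by auto
    with \<open>p \<in> A\<close> show "p \<in> A - {p \<in> A. \<forall>f\<in>?H. f p = 0}"
      by fastforce
  next
    fix p
    assume "p \<in> A - {p \<in> A. \<forall>f\<in>?H. f p = 0}"
    then obtain f g where "p \<in> A" "f \<in> F" "g \<in> G" "f p * g p \<noteq> 0"
      by auto
    then show "p \<in> U \<inter> V"
      unfolding F(2) G(2) by auto
  qed
  ultimately show "\<exists>F \<subseteq> polynomial_functions X. U \<inter> V = A - {p \<in> A. \<forall>f\<in>F. f p = 0}"
    by blast
next
  fix K
  assume "\<forall>U\<in>K. \<exists>F \<subseteq> polynomial_functions X. U = A - {p \<in> A. \<forall>f\<in>F. f p = 0}"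
  then have "\<exists>F. \<forall>U\<in>K. F U \<subseteq> polynomial_functions X \<and> U = A - {p \<in> A. \<forall>f\<in>F U. f p = 0}"
    by (rule bchoice)
  then obtain F where F: "\<And>U. U \<in> K \<Longrightarrow> F U \<subseteq> polynomial_functions X"
      "\<And>U. U \<in> K \<Longrightarrow> U = A - {p \<in> A. \<forall>f\<in>F U. f p = 0}"
    by meson
  have "\<Union>K = (\<Union>U\<in>K. A - {p \<in> A. \<forall>f\<in>F U. f p = 0})"
    using SUP_cong[OF refl F(2), of K "\<lambda>U. U"] by simp
  also have "\<dots> = A - {p \<in> A. \<forall>f\<in>\<Union>(F ` K). f p = 0}"
    by auto
  finally have "\<Union>K = A - {p \<in> A. \<forall>f\<in>\<Union>(F ` K). f p = 0}" .
  moreover have "\<Union>(F ` K) \<subseteq> polynomial_functions X"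
    using F(1) by (rule UN_least)
  ultimately show "\<exists>F \<subseteq> polynomial_functions X. \<Union>K = A - {p \<in> A. \<forall>f\<in>F. f p = 0}"
    by (intro exI conjI)
qed

lemma openin_zariski:
  "openin (zariski_topology A X) U \<longleftrightarrow>
     (\<exists>F \<subseteq> polynomial_functions X. U = A - {p \<in> A. \<forall>f\<in>F. f p = 0})"
  unfolding zariski_topology_def by (subst topology_inverse'[OF istopology_zariski]) (rule refl)

definition rep_coordinates ::
    "('v, 'a) pre_digraph \<Rightarrow> ('v \<Rightarrow> nat) \<Rightarrow> (('a \<Rightarrow> 'k::field mat) \<Rightarrow> 'k) set" where
  "rep_coordinates Q \<beta> = {\<lambda>V. V a $$ (i, j) | a i j.
     a \<in> arcs Q \<and> i < \<beta> (head Q a) \<and> j < \<beta> (tail Q a)}"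

definition rep_variety_topology ::
    "('v, 'a) pre_digraph \<Rightarrow> ('a \<Rightarrow> 's) \<Rightarrow> ('v \<Rightarrow> nat) \<Rightarrow> ('a \<Rightarrow> nat)
       \<Rightarrow> ('a \<Rightarrow> 'k::field mat) topology" where
  "rep_variety_topology Q c \<beta> r =
     subtopology (zariski_topology (rep_space Q \<beta>) (rep_coordinates Q \<beta>)) (rep_variety Q c \<beta> r)"

lemma topspace_rep_variety_topology:
  "topspace (rep_variety_topology Q c \<beta> r :: ('a \<Rightarrow> 'k::field mat) topology) = rep_variety Q c \<beta> r"
proof -
  let ?Z = "zariski_topology (rep_space Q \<beta>) (rep_coordinates Q \<beta>) :: ('a \<Rightarrow> 'k mat) topology"
  have "openin ?Z (rep_space Q \<beta>)"
    unfolding openin_zariski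
    by (rule exI[of _ "{\<lambda>_. 1}"]) (auto intro: polynomial_functions.const)
  then have "rep_space Q \<beta> \<subseteq> topspace ?Z"
    by (rule openin_subset)
  then show ?thesis
    by (auto simp: rep_variety_topology_def rep_variety_def)
qed

definition dense_in :: "'p topology \<Rightarrow> 'p set \<Rightarrow> bool" where
  "dense_in T U \<longleftrightarrow> U \<subseteq> topspace T \<and> T closure_of U = topspace T"

section \<open>Up-and-down graphs and modules\<close>

definition color_incidences ::
    "('v, 'a) pre_digraph \<Rightarrow> 's set \<Rightarrow> ('a \<Rightarrow> 's) \<Rightarrow> ('v \<times> 's) set" where
  "color_incidences Q S c = {(x, s). x \<in> verts Q \<and> s \<in> S \<and>
     (\<exists>a\<in>arcs Q. c a = s \<and> (tail Q a = x \<or> head Q a = x))}"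

definition sign_function ::
    "('v, 'a) pre_digraph \<Rightarrow> 's set \<Rightarrow> ('a \<Rightarrow> 's) \<Rightarrow> ('v \<times> 's \<Rightarrow> int) \<Rightarrow> bool" where
  "sign_function Q S c \<epsilon> \<longleftrightarrow>
     \<epsilon> \<in> color_incidences Q S c \<rightarrow> {1, -1} \<and>
     (\<forall>x s1 s2. (x, s1) \<in> color_incidences Q S c \<and> (x, s2) \<in> color_incidences Q S c \<and>
        (x, s1) \<noteq> (x, s2) \<longrightarrow> \<epsilon> (x, s1) = - \<epsilon> (x, s2))"

text \<open>
  The up-and-down graph: \<open>(x, j)\<close> is the vertex \<open>v\<^sub>j\<^sup>x\<close> and \<open>(a, i)\<close> is the \<open>i\<close>-th edge labeled
  \<open>a\<close>.  It is an undirected multigraph; for each edge we record which of its ends is the one over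
  \<open>tail Q a\<close> and which is the one over \<open>head Q a\<close> (this matters if \<open>a\<close> is a loop).  In all four
  cases of the definition the end over the tail of \<open>a\<close> depends only on the sign at the tail, and
  the end over the head only on the sign at the head.
\<close>

definition updown_graph ::
    "('v, 'a) pre_digraph \<Rightarrow> ('a \<Rightarrow> 's) \<Rightarrow> ('v \<Rightarrow> nat) \<Rightarrow> ('a \<Rightarrow> nat) \<Rightarrow> ('v \<times> 's \<Rightarrow> int)
       \<Rightarrow> ('v \<times> nat, 'a \<times> nat) pre_digraph" where
  "updown_graph Q c \<beta> r \<epsilon> =
     \<lparr> verts = (SIGMA x:verts Q. {1..\<beta> x}),
       arcs = (SIGMA a:arcs Q. {1..r a}),
       tail = (\<lambda>(a, i). (tail Q a,
          if \<epsilon> (tail Q a, c a) = 1 then i else \<beta> (tail Q a) - i + 1)),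
       head = (\<lambda>(a, i). (head Q a,
          if \<epsilon> (head Q a, c a) = 1 then \<beta> (head Q a) - i + 1 else i)) \<rparr>"

text \<open>Connected components, as vertex sets, of the underlying undirected graph.\<close>

definition components :: "('x, 'e) pre_digraph \<Rightarrow> 'x set set" where
  "components \<Gamma> = pre_digraph.sccs_verts (with_proj (mk_symmetric \<Gamma>))"

text \<open>The edges meeting the vertex set \<open>C\<close>, forgetting orientation, form a cycle with vertex set
  \<open>C\<close>.  A cycle of length two consists of two parallel edges.\<close>

definition is_undirected_cycle :: "('x, 'e) pre_digraph \<Rightarrow> 'x set \<Rightarrow> bool" where
  "is_undirected_cycle \<Gamma> C \<longleftrightarrow>
     (\<exists>vs es. vs \<noteq> [] \<and> length es = length vs \<and> distinct vs \<and> distinct es \<and> set vs = C \<and>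
        set es = {e \<in> arcs \<Gamma>. tail \<Gamma> e \<in> C \<or> head \<Gamma> e \<in> C} \<and>
        (\<forall>i<length vs. {tail \<Gamma> (es ! i), head \<Gamma> (es ! i)} =
                        {vs ! i, vs ! (Suc i mod length vs)}))"

definition bands :: "('x, 'e) pre_digraph \<Rightarrow> 'x set set" where
  "bands \<Gamma> = {C \<in> components \<Gamma>. is_undirected_cycle \<Gamma> C}"

text \<open>A target is a vertex at which every edge containing it ends, i.e. no edge has its end over
  the tail of its label there.\<close>

definition is_target :: "('x, 'e) pre_digraph \<Rightarrow> 'x \<Rightarrow> bool" where
  "is_target \<Gamma> v \<longleftrightarrow> v \<in> verts \<Gamma> \<and> (\<forall>e\<in>arcs \<Gamma>. tail \<Gamma> e \<noteq> v)"

definition choice_function :: "('x, 'e) pre_digraph \<Rightarrow> ('x set \<Rightarrow> 'x) \<Rightarrow> bool" where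
  "choice_function \<Gamma> \<Theta> \<longleftrightarrow> (\<forall>b\<in>bands \<Gamma>. \<Theta> b \<in> b \<and> is_target \<Gamma> (\<Theta> b))"

text \<open>The parameter is \<open>l\<close>.  Matrix indices start at 0, vertex indices at 1.\<close>

definition updown_module ::
    "('v, 'a) pre_digraph \<Rightarrow> ('a \<Rightarrow> 's) \<Rightarrow> ('v \<Rightarrow> nat) \<Rightarrow> ('a \<Rightarrow> nat) \<Rightarrow> ('v \<times> 's \<Rightarrow> int)
       \<Rightarrow> (('v \<times> nat) set \<Rightarrow> 'v \<times> nat) \<Rightarrow> (('v \<times> nat) set \<Rightarrow> 'k::field) \<Rightarrow> 'a \<Rightarrow> 'k mat" where
  "updown_module Q c \<beta> r \<epsilon> \<Theta> l =
     (let \<Gamma> = updown_graph Q c \<beta> r \<epsilon> in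
      (\<lambda>a\<in>arcs Q. mat (\<beta> (head Q a)) (\<beta> (tail Q a)) (\<lambda>(k, j).
        if \<exists>i. (a, i) \<in> arcs \<Gamma> \<and> tail \<Gamma> (a, i) = (tail Q a, Suc j)
               \<and> head \<Gamma> (a, i) = (head Q a, Suc k)
        then if (\<exists>b\<in>bands \<Gamma>. \<Theta> b = (head Q a, Suc k)) \<and> \<epsilon> (head Q a, c a) = 1
             then l (THE b. b \<in> bands \<Gamma> \<and> \<Theta> b = (head Q a, Suc k))
             else 1
        else 0)))"

end

theory Submission
  imports Defs "HOL-Library.Function_Algebras"
begin

text \<open>
  Independent base changes on the two sides of each vertex (one side for each sign) form a larger
  group acting on all tuples of matrices. Bases adapted to the maps of a point \<open>V\<close> of
  \<open>Rep\<^sub>Q\<^sub>,\<^sub>c(\<beta>, r)\<close> turn \<open>V\<close> into an up-and-down module with some of its edges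
  removed, hence \<open>V\<close> is a limit of conjugates of one module \<open>M\<^sub>\<lambda>\<close> under the larger group. So a
  polynomial function vanishing on the orbits has to be shown to vanish on these conjugates, and for
  this it suffices that base changes of the vertices, changes of \<open>\<lambda>\<close> and automorphisms of
  \<open>M\<^sub>\<lambda>\<close> with respect to the larger group together move in all tangent directions of that group,
  for generic \<open>\<lambda>\<close>.

  An annihilator of these directions is a function on pairs of vertices of the graph over the same
  point. It is transported along pairs of parallel walks, and by the order of the vertices on each
  side these walks can never end, so they go around bands. For two different bands, going around
  yields a relation between their parameters, which is excluded by genericity. Two different
  positions on one band would give a rotation of the band that preserves an order, and a single
  position is excluded by the variation of the parameter of the band.
\<close>

text \<open>The larger group serves as an intermediary because it is an open subset of an affine
  space. A polynomial function pulled back along its action becomes, once denominators are cleared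
  by determinants, a polynomial \<open>F\<close> on all tuples of matrices, and only the vanishing
  of \<open>F\<close> is at stake. First-order information alone would not give this:
  \<open>F\<close> may vanish to high order at the identity, and differentials are unreliable in
  positive characteristic. Hence every tangent direction at the identity is realised by an actual
  polynomial curve inside the zero locus, and the lowest-order form of \<open>F\<close> is tested on
  these curves. One base point and one generic \<lambda> are enough, since the curves move \<lambda>
  themselves. Genericity must be a finite list of conditions in order to be satisfiable over any
  infinite field; the periods of walks are at most \<open>2 * card (verts \<Gamma>)\<close>, the
  number of darts, so bounded exponents suffice.\<close>

lemma infinite_alg_closed: "infinite (UNIV :: 'k::alg_closed_field set)"
proof
  assume fin: "finite (UNIV :: 'k set)"
  \<comment> \<open>Over a finite field this polynomial takes the value 1 everywhere, so it would be
    nonconstant without a root.\<close>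
  define p :: "'k poly" where "p = (\<Prod>a\<in>UNIV. [:- a, 1:]) + 1"
  have "degree (\<Prod>a\<in>(UNIV::'k set). [:- a, 1:]) = card (UNIV::'k set)"
    using fin by (subst degree_prod_eq_sum_degree) auto
  moreover have "card (UNIV::'k set) > 0"
    using fin by (simp add: card_gt_0_iff)
  ultimately have "degree p > 0"
    unfolding p_def by (subst degree_add_eq_left) auto
  then obtain z where "poly p z = 0"
    using alg_closed_imp_poly_has_root by blast
  moreover have "poly p z = 1"
    using fin by (auto simp: p_def poly_prod prod_zero_iff)
  ultimately show False by simp
qed

section \<open>Polynomial functions and a vanishing test along curves\<close>

lemma poly_eq_0_if_infinite_zeros:
  fixes p :: "'k::field poly"
  assumes "infinite A" "\<And>s. s \<in> A \<Longrightarrow> poly p s = 0"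
  shows "p = 0"
  using assms poly_roots_finite[of p] by (metis (mono_tags, lifting) finite_subset mem_Collect_eq subsetI)

lemma polynomial_functions_sum:
  "(\<And>i. i \<in> A \<Longrightarrow> f i \<in> polynomial_functions X) \<Longrightarrow> (\<lambda>p. \<Sum>i\<in>A. f i p) \<in> polynomial_functions X"
  by (induction A rule: infinite_finite_induct) (auto intro: polynomial_functions.intros)

lemma polynomial_functions_prod:
  "(\<And>i. i \<in> A \<Longrightarrow> f i \<in> polynomial_functions X) \<Longrightarrow> (\<lambda>p. \<Prod>i\<in>A. f i p) \<in> polynomial_functions X"
  by (induction A rule: infinite_finite_induct) (auto intro: polynomial_functions.intros)

lemma polynomial_functions_power:
  "f \<in> polynomial_functions X \<Longrightarrow> (\<lambda>p. f p ^ n) \<in> polynomial_functions X"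
  by (induction n) (auto intro: polynomial_functions.intros)

lemma polynomial_functions_on_curve:
  fixes \<gamma> :: "'k::field \<Rightarrow> 'p"
  assumes "f \<in> polynomial_functions X" "\<And>g. g \<in> X \<Longrightarrow> \<exists>q. \<forall>s. g (\<gamma> s) = poly q s"
  shows "\<exists>q. \<forall>s. f (\<gamma> s) = poly q s"
  using assms(1)
proof induction
  case (const k)
  show ?case by (rule exI[of _ "[:k:]"]) simp
next
  case (coord f)
  then show ?case by (rule assms(2))
next
  case (add f g)
  then obtain q1 q2 where "\<forall>s. f (\<gamma> s) = poly q1 s" "\<forall>s. g (\<gamma> s) = poly q2 s" by blast
  then show ?case by (intro exI[of _ "q1 + q2"]) simp
next
  case (mult f g)
  then obtain q1 q2 where "\<forall>s. f (\<gamma> s) = poly q1 s" "\<forall>s. g (\<gamma> s) = poly q2 s" by blast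
  then show ?case by (intro exI[of _ "q1 * q2"]) simp
qed

definition affine_coords :: "(('i \<Rightarrow> 'k) \<Rightarrow> 'k) set" where
  "affine_coords = range (\<lambda>i z. z i)"

text \<open>Only the expansion in the scalar \<open>t\<close> is recorded, with coefficients
  polynomial in the direction \<open>v\<close>. No derivatives or factorials occur, so the
  characteristic does not matter. The vanishing of \<open>c j\<close> beyond \<open>D\<close> lets
  expansions of different lengths be added and multiplied.\<close>

lemma polynomial_taylor:
  fixes f :: "('i \<Rightarrow> 'k::field) \<Rightarrow> 'k"
  assumes "f \<in> polynomial_functions affine_coords"
  shows "\<exists>c D. (\<forall>j. c j \<in> polynomial_functions affine_coords) \<and> (\<forall>j>D. c j = (\<lambda>_. 0)) \<and>
    (\<forall>t v. f (\<lambda>i. z i + t * v i) = (\<Sum>j\<le>D. c j v * t ^ j))"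
  using assms
proof induction
  case (const k)
  show ?case
    by (rule exI[of _ "\<lambda>j. if j = 0 then (\<lambda>_. k) else (\<lambda>_. 0)"], rule exI[of _ 0])
      (auto intro: polynomial_functions.const)
next
  case (coord f)
  then obtain i where f: "f = (\<lambda>z. z i)" by (auto simp: affine_coords_def)
  have "(\<lambda>v. v i) \<in> polynomial_functions affine_coords"
    by (rule polynomial_functions.coord) (auto simp: affine_coords_def)
  then show ?case
    by (intro exI[of _ "\<lambda>j. if j = 0 then (\<lambda>_. z i) else if j = 1 then (\<lambda>v. v i) else (\<lambda>_. 0)"]
        exI[of _ 1]) (auto simp: f intro: polynomial_functions.const)
next
  case (add f g)
  obtain c D where c:
    "\<forall>j. c j \<in> polynomial_functions affine_coords" "\<forall>j>D. c j = (\<lambda>_. 0)"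
    "\<forall>t v. f (\<lambda>i. z i + t * v i) = (\<Sum>j\<le>D. c j v * t ^ j)"
    using add.IH(1) by blast
  obtain c' D' where c':
    "\<forall>j. c' j \<in> polynomial_functions affine_coords" "\<forall>j>D'. c' j = (\<lambda>_. 0)"
    "\<forall>t v. g (\<lambda>i. z i + t * v i) = (\<Sum>j\<le>D'. c' j v * t ^ j)"
    using add.IH(2) by blast
  note * = c c'
  have 1: "(\<Sum>j\<le>D. c j v * t ^ j) = (\<Sum>j\<le>max D D'. c j v * t ^ j)" for v t
    by (rule sum.mono_neutral_left) (use * in auto)
  have 2: "(\<Sum>j\<le>D'. c' j v * t ^ j) = (\<Sum>j\<le>max D D'. c' j v * t ^ j)" for v t
    by (rule sum.mono_neutral_left) (use * in auto)
  show ?case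
    by (rule exI[of _ "\<lambda>j v. c j v + c' j v"], rule exI[of _ "max D D'"])
      (use * 1 2 in \<open>auto intro: polynomial_functions.add simp: distrib_right sum.distrib\<close>)
next
  case (mult f g)
  obtain c D where c:
    "\<forall>j. c j \<in> polynomial_functions affine_coords" "\<forall>j>D. c j = (\<lambda>_. 0)"
    "\<forall>t v. f (\<lambda>i. z i + t * v i) = (\<Sum>j\<le>D. c j v * t ^ j)"
    using mult.IH(1) by blast
  obtain c' D' where c':
    "\<forall>j. c' j \<in> polynomial_functions affine_coords" "\<forall>j>D'. c' j = (\<lambda>_. 0)"
    "\<forall>t v. g (\<lambda>i. z i + t * v i) = (\<Sum>j\<le>D'. c' j v * t ^ j)"
    using mult.IH(2) by blast
  note * = c c'
  have 1: "(\<Sum>j\<le>D. c j v * t ^ j) * (\<Sum>j\<le>D'. c' j v * t ^ j)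
      = (\<Sum>r\<le>D + D'. (\<Sum>k\<le>r. c k v * c' (r - k) v) * t ^ r)" for v t
    by (rule polynomial_product) (use * in auto)
  have 2: "(\<Sum>k\<le>r. c k v * c' (r - k) v) = 0" if "r > D + D'" for r v
  proof (intro sum.neutral ballI)
    fix k
    have "k > D \<or> r - k > D'" using that by arith
    then show "c k v * c' (r - k) v = 0" using *(2,5) by auto
  qed
  show ?case
  proof (intro exI conjI allI impI)
    show "(\<lambda>v. \<Sum>k\<le>j. c k v * c' (j - k) v) \<in> polynomial_functions affine_coords" for j
      using * by (intro polynomial_functions_sum polynomial_functions.mult) auto
    show "(\<lambda>v. \<Sum>k\<le>j. c k v * c' (j - k) v) = (\<lambda>_. 0)" if "j > D + D'" for j
      using 2 that by blast
    show "f (\<lambda>i. z i + t * v i) * g (\<lambda>i. z i + t * v i)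
        = (\<Sum>j\<le>D + D'. (\<Sum>k\<le>j. c k v * c' (j - k) v) * t ^ j)" for t v
      using *(3,6) 1 by simp
  qed
qed

text \<open>The lowest-order form of \<open>F\<close> at \<open>z\<close> is nonzero in some direction, and a curve with that
  tangent direction then leaves the zero locus.\<close>

lemma polynomial_zero_if_zero_on_curves:
  fixes F :: "('i \<Rightarrow> 'k::field) \<Rightarrow> 'k"
  assumes inf: "infinite (UNIV :: 'k set)"
    and F: "F \<in> polynomial_functions affine_coords"
    and curve: "\<And>w. \<exists>q. \<forall>s. F (\<lambda>i. z i + s * (w i + s * poly (q i) s)) = 0"
  shows "F y = 0"
proof (rule ccontr)
  assume y: "F y \<noteq> 0"
  obtain c D where c: "\<forall>j. c j \<in> polynomial_functions affine_coords" 
    "\<forall>t v. F (\<lambda>i. z i + t * v i) = (\<Sum>j\<le>D. c j v * t ^ j)"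
    using polynomial_taylor[OF F, of z] by blast
  \<comment> \<open>The point \<open>y\<close> is reached from \<open>z\<close> in direction
    \<open>y - z\<close> at \<open>t = 1\<close>, so some coefficient is a nonzero function.\<close>
  have "(\<Sum>j\<le>D. c j (\<lambda>i. y i - z i) * 1 ^ j) \<noteq> 0"
    using y c(2)[rule_format, of 1 "\<lambda>i. y i - z i"] by simp
  then have "\<exists>j\<le>D. c j (\<lambda>i. y i - z i) \<noteq> 0"
    by (metis (no_types, lifting) atMost_iff mult_zero_left sum.not_neutral_contains_not_neutral)
  then have ex: "\<exists>j. j \<le> D \<and> (\<exists>v. c j v \<noteq> 0)" by blast
  define d where "d = (LEAST j. j \<le> D \<and> (\<exists>v. c j v \<noteq> 0))"
  have d: "d \<le> D" "\<exists>v. c d v \<noteq> 0" using LeastI_ex[OF ex] unfolding d_def by auto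
  have below: "c j v = 0" if "j < d" for j v
    using not_less_Least[of j "\<lambda>j. j \<le> D \<and> (\<exists>v. c j v \<noteq> 0)"] that d(1) unfolding d_def
    by (meson le_trans less_imp_le_nat)
  obtain w where w: "c d w \<noteq> 0" using d by blast
  obtain q where q: "\<And>s. F (\<lambda>i. z i + s * (w i + s * poly (q i) s)) = 0" using curve by blast
  have "\<exists>p. \<forall>s. c j (\<lambda>i. w i + s * poly (q i) s) = poly p s" for j
  proof (rule polynomial_functions_on_curve[where f = "c j" and \<gamma> = "\<lambda>s i. w i + s * poly (q i) s"])
    show "c j \<in> polynomial_functions affine_coords" using c by blast
    fix g :: "('i \<Rightarrow> 'k) \<Rightarrow> 'k" assume "g \<in> affine_coords"
    then obtain i where "g = (\<lambda>z. z i)" by (auto simp: affine_coords_def)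
    then show "\<exists>p. \<forall>s. g (\<lambda>i. w i + s * poly (q i) s) = poly p s"
      by (intro exI[of _ "[:w i:] + [:0,1:] * q i"]) simp
  qed
  then obtain p where p: "\<And>j s. c j (\<lambda>i. w i + s * poly (q i) s) = poly (p j) s" by metis
  \<comment> \<open>\<open>P\<close> is \<open>F\<close> along the curve divided by
    \<open>s ^ d\<close>; its value at 0 is \<open>c d w\<close>.\<close>
  define P where "P = (\<Sum>j\<in>{d..D}. p j * [:0, 1:] ^ (j - d))"
  have "poly P s = 0" if "s \<noteq> 0" for s
  proof -
    have "0 = (\<Sum>j\<le>D. poly (p j) s * s ^ j)"
      using q[of s] c(2) p by simp
    also have "\<dots> = (\<Sum>j\<in>{d..D}. poly (p j) s * s ^ j)"
      by (rule sum.mono_neutral_right) (auto simp: below simp flip: p)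
    also have "\<dots> = s ^ d * poly P s"
      by (simp add: P_def poly_sum sum_distrib_left) (rule sum.cong, auto simp: mult.left_commute simp flip: power_add)
    finally show ?thesis using that by simp
  qed
  then have "P = 0"
    using poly_eq_0_if_infinite_zeros[of "UNIV - {0}" P] inf by auto
  then have "poly P 0 = 0" by simp
  moreover have "poly P 0 = (\<Sum>j\<in>{d..D}. if j = d then poly (p j) 0 else 0)"
    unfolding P_def poly_sum by (rule sum.cong) (auto simp: power_0_left)
  ultimately show False using d w p[of d 0] by (simp add: sum.delta')
qed

section \<open>Walks in the up-and-down graph\<close>

text \<open>Every vertex of the up-and-down graph has two sides, one for each sign, and at most one edge is
  attached to each side. A dart is a vertex together with a side through which it is left.\<close>

locale dart_graph = 
  fixes \<Gamma> :: "('x, 'e) pre_digraph" and ts hs :: "'e \<Rightarrow> bool"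
  assumes finite_verts: "finite (verts \<Gamma>)"
    and tail_in_verts: "e \<in> arcs \<Gamma> \<Longrightarrow> tail \<Gamma> e \<in> verts \<Gamma>"
    and head_in_verts: "e \<in> arcs \<Gamma> \<Longrightarrow> head \<Gamma> e \<in> verts \<Gamma>"
    and tail_dart_inj: "e \<in> arcs \<Gamma> \<Longrightarrow> e' \<in> arcs \<Gamma> \<Longrightarrow> tail \<Gamma> e = tail \<Gamma> e' \<Longrightarrow> ts e = ts e' \<Longrightarrow> e = e'"
    and head_dart_inj: "e \<in> arcs \<Gamma> \<Longrightarrow> e' \<in> arcs \<Gamma> \<Longrightarrow> head \<Gamma> e = head \<Gamma> e' \<Longrightarrow> hs e = hs e' \<Longrightarrow> e = e'"
    and tail_head_dart: "e \<in> arcs \<Gamma> \<Longrightarrow> e' \<in> arcs \<Gamma> \<Longrightarrow> tail \<Gamma> e = head \<Gamma> e' \<Longrightarrow> ts e \<noteq> hs e'"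
begin

definition tdart :: "'e \<Rightarrow> 'x \<times> bool" where "tdart e = (tail \<Gamma> e, ts e)"
definition hdart :: "'e \<Rightarrow> 'x \<times> bool" where "hdart e = (head \<Gamma> e, hs e)"

definition flip :: "'x \<times> bool \<Rightarrow> 'x \<times> bool" where "flip d = (fst d, \<not> snd d)"

text \<open>Crossing an edge leads to the dart at its other end, which points back. On sides without
  an edge the value is the dart itself, so that \<open>cross\<close> is an involution of all darts
  and \<open>step\<close> is injective without side conditions.\<close>

definition cross :: "'x \<times> bool \<Rightarrow> 'x \<times> bool" where
  "cross d = (if d \<in> tdart ` arcs \<Gamma> then hdart (the_inv_into (arcs \<Gamma>) tdart d)
     else if d \<in> hdart ` arcs \<Gamma> then tdart (the_inv_into (arcs \<Gamma>) hdart d) else d)"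

definition step :: "'x \<times> bool \<Rightarrow> 'x \<times> bool" where "step d = flip (cross d)"

definition endless :: "'x \<times> bool \<Rightarrow> bool" where
  "endless d \<longleftrightarrow> (\<forall>i. (step ^^ i) d \<in> tdart ` arcs \<Gamma> \<union> hdart ` arcs \<Gamma>)"

lemma fst_darts [simp]: "fst (tdart e) = tail \<Gamma> e" "fst (hdart e) = head \<Gamma> e"
  by (simp_all add: tdart_def hdart_def)

lemma inj_tdart: "inj_on tdart (arcs \<Gamma>)"
  using tail_dart_inj by (auto simp: inj_on_def tdart_def)

lemma inj_hdart: "inj_on hdart (arcs \<Gamma>)"
  using head_dart_inj by (auto simp: inj_on_def hdart_def)

lemma tdart_neq_hdart: "e \<in> arcs \<Gamma> \<Longrightarrow> e' \<in> arcs \<Gamma> \<Longrightarrow> tdart e \<noteq> hdart e'"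
  using tail_head_dart by (auto simp: tdart_def hdart_def)

lemma flip_flip [simp]: "flip (flip d) = d" and flip_neq: "flip d \<noteq> d" and fst_flip [simp]: "fst (flip d) = fst d"
  by (auto simp: flip_def prod_eq_iff)

lemma cross_tdart [simp]: "e \<in> arcs \<Gamma> \<Longrightarrow> cross (tdart e) = hdart e"
  by (simp add: cross_def the_inv_into_f_f inj_tdart)

lemma cross_hdart [simp]: "e \<in> arcs \<Gamma> \<Longrightarrow> cross (hdart e) = tdart e"
  using tdart_neq_hdart[of _ e] by (auto simp: cross_def the_inv_into_f_f inj_hdart eq_commute[of "hdart e"])

lemma cross_cross [simp]: "cross (cross d) = d"
proof (cases "d \<in> tdart ` arcs \<Gamma> \<union> hdart ` arcs \<Gamma>")
  case False
  then have "cross d = d" by (auto simp: cross_def)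
  then show ?thesis by simp
qed auto

lemma cross_neq: "d \<in> tdart ` arcs \<Gamma> \<union> hdart ` arcs \<Gamma> \<Longrightarrow> cross d \<noteq> d"
  using tdart_neq_hdart by (force simp: eq_commute)

lemma inj_step: "inj step"
  by (rule injI) (metis step_def flip_flip cross_cross)

lemma step_flip_step: "step (flip (step d)) = flip d"
  by (simp add: step_def)

text \<open>Walking back: since \<open>flip\<close> and \<open>cross\<close> are involutions,
  \<open>flip\<close> conjugates \<open>step\<close> into its inverse.\<close>

lemma steps_flip_steps: "(step ^^ i) (flip ((step ^^ (i + j)) d)) = flip ((step ^^ j) d)"
proof (induction i)
  case (Suc i)
  have "(step ^^ Suc i) (flip ((step ^^ (Suc i + j)) d)) = (step ^^ i) (step (flip (step ((step ^^ (i + j)) d))))"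
    by (simp add: funpow_swap1)
  then show ?case by (simp only: step_flip_step Suc.IH)
qed simp

lemma endless_steps: "endless d \<Longrightarrow> endless ((step ^^ i) d)"
  by (auto simp: endless_def simp flip: funpow_add[THEN fun_cong, unfolded comp_def])

lemma fst_endless_in_verts: "endless d \<Longrightarrow> fst d \<in> verts \<Gamma>"
  using tail_in_verts head_in_verts
  by (force simp: endless_def tdart_def hdart_def dest!: spec[of _ 0])

definition period :: "'x \<times> bool \<Rightarrow> nat" where
  "period d = (LEAST n. n > 0 \<and> (step ^^ n) d = d)"

text \<open>Finitely many darts make the walk eventually periodic, and injectivity of
  \<open>step\<close> cancels the part before the first repetition.\<close>

lemma period:
  assumes "endless d"
  shows period_pos: "period d > 0" and steps_period: "(step ^^ period d) d = d"
proof -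
  let ?f = "\<lambda>n. (step ^^ n) d"
  have "range ?f \<subseteq> verts \<Gamma> \<times> UNIV"
    using fst_endless_in_verts[OF endless_steps[OF assms]] by (force simp: prod_eq_iff mem_Times_iff)
  then have "finite (range ?f)"
    by (rule finite_subset) (use finite_verts in auto)
  then have "\<not> inj ?f"
    using finite_imageD by (metis infinite_UNIV_nat)
  then obtain m n where mn: "m < n" "?f m = ?f n"
    unfolding inj_def by (metis linorder_neqE_nat)
  have "(step ^^ m) ((step ^^ (n - m)) d) = (step ^^ m) d"
    using mn by (simp flip: funpow_add[THEN fun_cong, unfolded comp_def])
  then have "(step ^^ (n - m)) d = d"
    by (rule injD[OF inj_fn[OF inj_step]])
  then have "\<exists>n. n > 0 \<and> (step ^^ n) d = d" using mn by (intro exI[of _ "n - m"]) auto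
  from LeastI_ex[OF this] show "period d > 0" "(step ^^ period d) d = d"
    by (auto simp: period_def)
qed

lemma steps_period_mult:
  assumes "endless d" shows "(step ^^ (period d * k)) d = d"
  by (induction k) (simp_all add: funpow_add steps_period[OF assms])

lemma steps_mod_period:
  assumes "endless d" shows "(step ^^ (i mod period d)) d = (step ^^ i) d"
proof -
  have "(step ^^ i) d = (step ^^ (i mod period d)) ((step ^^ (period d * (i div period d))) d)"
    by (simp flip: funpow_add[THEN fun_cong, unfolded comp_def])
  then show ?thesis by (simp add: steps_period_mult[OF assms])
qed

lemma steps_inj_below_period:
  assumes "endless d" "i < period d" "j < period d" "(step ^^ i) d = (step ^^ j) d"
  shows "i = j"
proof -
  have *: False if "i < j" "j < period d" "(step ^^ i) d = (step ^^ j) d" for i j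
  proof -
    have "(step ^^ i) ((step ^^ (j - i)) d) = (step ^^ i) d"
      using that by (simp flip: funpow_add[THEN fun_cong, unfolded comp_def])
    then have "(step ^^ (j - i)) d = d"
      by (rule injD[OF inj_fn[OF inj_step]])
    then have "period d \<le> j - i" unfolding period_def using that by (intro Least_le) auto
    then show False using that by auto
  qed
  show ?thesis using *[of i j] *[of j i] assms by (metis linorder_neqE_nat)
qed

lemma steps_back:
  assumes "endless d" shows "\<exists>m. (step ^^ k) d = (step ^^ m) ((step ^^ j) d)"
proof -
  obtain p where p: "period d = Suc p" using period_pos[OF assms] gr0_conv_Suc by blast
  \<comment> \<open>Backward steps are replaced by going on round the cycle: after \<open>j\<close>
    steps, \<open>p * j\<close> more complete \<open>j\<close> full turns.\<close>
  have "k + p * j + j = k + period d * j" by (simp add: p)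
  then have "(step ^^ (k + p * j)) ((step ^^ j) d) = (step ^^ k) ((step ^^ (period d * j)) d)"
    by (metis funpow_add comp_apply)
  then show ?thesis by (metis steps_period_mult[OF assms])
qed

text \<open>A walk does not come back in the opposite direction: in the middle of such a walk it would have
  to turn round at a vertex or on an edge.\<close>

lemma flip_not_on_walk_0:
  assumes "endless d" shows "(step ^^ j) d \<noteq> flip d"
proof
  assume *: "(step ^^ j) d = flip d"
  show False
  proof (cases "even j")
    case True
    then obtain i where "j = i + i" by (metis evenE mult_2)
    then have "(step ^^ i) d = flip ((step ^^ i) d)"
      using steps_flip_steps[of i i d] * by simp
    then show False using flip_neq by metis
  next
    case False
    then obtain i where "j = i + Suc i" by (metis oddE mult_2 add_Suc_right Suc_eq_plus1)
    then have "(step ^^ i) d = flip ((step ^^ Suc i) d)"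
      using steps_flip_steps[of i "Suc i" d] * by simp
    then have "(step ^^ i) d = cross ((step ^^ i) d)" by (simp add: step_def)
    then show False using assms cross_neq by (metis endless_def)
  qed
qed

lemma flip_not_on_walk:
  assumes "endless d" shows "(step ^^ k) d \<noteq> flip ((step ^^ j) d)"
  using steps_back[OF assms, of k j] flip_not_on_walk_0[OF endless_steps[OF assms, of j]] by metis

definition track :: "'x \<times> bool \<Rightarrow> 'x set" where
  "track d = (\<lambda>i. fst ((step ^^ i) d)) ` UNIV"

lemma track_eq: 
  assumes "endless d" shows "track d = (\<lambda>i. fst ((step ^^ i) d)) ` {..<period d}"
proof -
  have "fst ((step ^^ i) d) \<in> (\<lambda>i. fst ((step ^^ i) d)) ` {..<period d}" for i
    using steps_mod_period[OF assms, of i] period_pos[OF assms]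
    by (intro image_eqI[of _ _ "i mod period d"]) auto
  then show ?thesis by (auto simp: track_def)
qed

lemma dart_on_track:
  assumes "fst x \<in> track d"
  obtains i where "x = (step ^^ i) d" | i where "x = flip ((step ^^ i) d)"
proof -
  obtain i where "fst x = fst ((step ^^ i) d)" using assms by (auto simp: track_def)
  then have "x = (step ^^ i) d \<or> x = flip ((step ^^ i) d)"
    by (auto simp: flip_def prod_eq_iff)
  then show ?thesis using that by blast
qed

text \<open>If the walk leaves the vertex of \<open>x\<close> through the other side, then it has
  just arrived through \<open>x\<close>, so the preceding dart is \<open>cross x\<close>. A
  predecessor exists even at index 0, because the walk is cyclic.\<close>

lemma edge_dart_on_track:
  assumes "endless d" "fst x \<in> track d"
  obtains i where "x = (step ^^ i) d" | i where "cross x = (step ^^ i) d"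
proof -
  show ?thesis
  proof (rule dart_on_track[OF assms(2)])
    fix i assume x: "x = flip ((step ^^ i) d)"
    obtain m where m: "(step ^^ i) d = (step ^^ m) ((step ^^ 1) d)"
      using steps_back[OF assms(1)] by blast
    then have "(step ^^ i) d = step ((step ^^ m) d)"
      by (simp add: funpow_swap1)
    then have "cross x = (step ^^ m) d" by (simp add: x step_def)
    then show ?thesis using that by blast
  qed (use that in blast)
qed

lemma endless_cases:
  assumes "endless d"
  obtains e where "e \<in> arcs \<Gamma>" "(step ^^ i) d = tdart e" "(step ^^ Suc i) d = flip (hdart e)"
  | e where "e \<in> arcs \<Gamma>" "(step ^^ i) d = hdart e" "(step ^^ Suc i) d = flip (tdart e)"
  using assms that unfolding endless_def by (force simp: step_def)

text \<open>The walk uses both sides of each of its vertices, one for arriving and one for leaving,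
  so no further edge can lead off the track.\<close>

lemma track_closed:
  assumes "endless d" "e \<in> arcs \<Gamma>"
  shows "tail \<Gamma> e \<in> track d \<longleftrightarrow> head \<Gamma> e \<in> track d"
    and "tail \<Gamma> e \<in> track d \<Longrightarrow> \<exists>i. (step ^^ i) d \<in> {tdart e, hdart e}"
proof -
  have on: "fst ((step ^^ i) d) \<in> track d" for i by (auto simp: track_def)
  have *: "fst (cross x) \<in> track d \<and> (\<exists>i. (step ^^ i) d \<in> {x, cross x})" if "fst x \<in> track d" for x
  proof (rule edge_dart_on_track[OF assms(1) that])
    fix i assume i: "x = (step ^^ i) d"
    then have "cross x = flip ((step ^^ Suc i) d)" by (simp add: step_def)
    then show ?thesis using on[of "Suc i"] i by auto
  next
    fix i assume i: "cross x = (step ^^ i) d"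
    then show ?thesis using on[of i] by auto
  qed
  show "tail \<Gamma> e \<in> track d \<longleftrightarrow> head \<Gamma> e \<in> track d"
    using *[of "tdart e"] *[of "hdart e"] assms(2) by auto
  show "\<exists>i. (step ^^ i) d \<in> {tdart e, hdart e}" if "tail \<Gamma> e \<in> track d"
    using *[of "tdart e"] that assms(2) by simp
qed

lemma wf_graph: "wf_digraph \<Gamma>"
  using tail_in_verts head_in_verts by (simp add: wf_digraph_def)

text \<open>Going round the cycle connects any two vertices of the track, and by
  \<open>track_closed\<close> nothing else can be reached.\<close>

lemma track_component:
  assumes "endless d" shows "track d \<in> components \<Gamma>"
proof -
  let ?G = "with_proj (mk_symmetric \<Gamma>)"
  interpret W: pair_wf_digraph "mk_symmetric \<Gamma>"
    using wf_digraph.wellformed_mk_symmetric[OF wf_graph] .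
  have adj: "(u, v) \<in> parcs (mk_symmetric \<Gamma>) \<longleftrightarrow>
      (\<exists>e\<in>arcs \<Gamma>. (u = tail \<Gamma> e \<and> v = head \<Gamma> e) \<or> (u = head \<Gamma> e \<and> v = tail \<Gamma> e))" for u v
    by (auto simp: parcs_mk_symmetric)
  have sub: "track d \<subseteq> verts \<Gamma>"
    using fst_endless_in_verts[OF endless_steps[OF assms]] by (auto simp: track_def)
  have one: "(fst ((step ^^ i) d), fst ((step ^^ Suc i) d)) \<in> parcs (mk_symmetric \<Gamma>)" for i
    by (rule endless_cases[OF assms, of i]) (auto simp: adj simp del: funpow.simps)
  have fwd: "fst ((step ^^ i) d) \<rightarrow>\<^sup>*\<^bsub>?G\<^esub> fst ((step ^^ (i + k)) d)" for i k
  proof (induction k)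
    case 0
    have "fst ((step ^^ i) d) \<in> track d" by (auto simp: track_def)
    then show ?case using sub by auto
  next
    case (Suc k)
    show ?case using W.reachable_adj_trans[OF Suc one[of "i + k"]] by (simp only: add_Suc_right)
  qed
  have conn: "u \<rightarrow>\<^sup>*\<^bsub>?G\<^esub> v" if uv: "u \<in> track d" "v \<in> track d" for u v
  proof -
    obtain i j where ij: "u = fst ((step ^^ i) d)" "v = fst ((step ^^ j) d)"
      using uv unfolding track_def by blast
    obtain m where "(step ^^ j) d = (step ^^ m) ((step ^^ i) d)" using steps_back[OF assms] by blast
    then have "v = fst ((step ^^ (i + m)) d)"
      using ij by (metis add.commute comp_apply funpow_add)
    then show ?thesis using ij fwd by blast
  qed
  have closed: "v \<in> track d" if "u \<rightarrow>\<^sup>*\<^bsub>?G\<^esub> v" "u \<in> track d" for u v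
    using that(1)
  proof (induction rule: W.reachable_induct)
    case base
    then show ?case using that by simp
  next
    case (step x y)
    then show ?case using adj[of x y] track_closed(1)[OF assms] by auto
  qed
  have "track d \<noteq> {}" by (auto simp: track_def)
  then show ?thesis
    unfolding components_def pre_digraph.sccs_verts_def mem_Collect_eq using conn closed by blast
qed

text \<open>The lists run through one period. A repeated vertex would mean a repeated dart, against
  minimality of the period, or an opposite dart, against \<open>flip_not_on_walk\<close>. A repeated
  edge is excluded in the same way, because crossing it backwards makes the walk meet its own
  reversal.\<close>

lemma track_cycle:
  assumes "endless d" shows "is_undirected_cycle \<Gamma> (track d)"
proof -
  let ?n = "period d"
  define edge where "edge x = (THE e. e \<in> arcs \<Gamma> \<and> x \<in> {tdart e, hdart e})" for x
  have edge: "edge x = e" if "e \<in> arcs \<Gamma>" "x \<in> {tdart e, hdart e}" for e x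
    unfolding edge_def using that tdart_neq_hdart inj_tdart inj_hdart
    by (intro the_equality) (auto simp: inj_on_def, metis)
  have edge': "edge ((step ^^ i) d) \<in> arcs \<Gamma>" 
    "(step ^^ i) d \<in> {tdart (edge ((step ^^ i) d)), hdart (edge ((step ^^ i) d))}" for i
    by (rule endless_cases[OF assms, of i]; simp add: edge)+
  let ?vs = "map (\<lambda>i. fst ((step ^^ i) d)) [0..<?n]"
  let ?es = "map (\<lambda>i. edge ((step ^^ i) d)) [0..<?n]"
  have 1: "i = j" if "i < ?n" "j < ?n" "fst ((step ^^ i) d) = fst ((step ^^ j) d)" for i j
  proof -
    have "(step ^^ i) d = (step ^^ j) d \<or> (step ^^ i) d = flip ((step ^^ j) d)"
      using that by (auto simp: flip_def prod_eq_iff)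
    then show ?thesis using flip_not_on_walk[OF assms] steps_inj_below_period[OF assms] that by blast
  qed
  have 2: "i = j" if "i < ?n" "j < ?n" "edge ((step ^^ i) d) = edge ((step ^^ j) d)" for i j
  proof -
    have "(step ^^ i) d = (step ^^ j) d \<or> (step ^^ i) d = cross ((step ^^ j) d)"
      using edge'[of i] edge'[of j] that(3) by (metis cross_tdart cross_hdart insertE singletonD)
    moreover have "cross ((step ^^ j) d) = flip ((step ^^ Suc j) d)" by (simp add: step_def)
    ultimately show ?thesis
      using flip_not_on_walk[OF assms] steps_inj_below_period[OF assms] that by metis
  qed
  have low: "\<exists>j<?n. (step ^^ i) d = (step ^^ j) d" for i
    using steps_mod_period[OF assms, of i] period_pos[OF assms] by (metis mod_less_divisor)
  have set_es: "set ?es = {e \<in> arcs \<Gamma>. tail \<Gamma> e \<in> track d \<or> head \<Gamma> e \<in> track d}"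
  proof (intro equalityI subsetI)
    fix e assume "e \<in> set ?es"
    then obtain i where e: "e = edge ((step ^^ i) d)" by auto
    have on: "fst ((step ^^ i) d) \<in> track d" by (auto simp: track_def)
    have "fst ((step ^^ i) d) = tail \<Gamma> e \<or> fst ((step ^^ i) d) = head \<Gamma> e"
      using edge'(2)[of i] unfolding e by (metis fst_darts insertE singletonD)
    with on show "e \<in> {e \<in> arcs \<Gamma>. tail \<Gamma> e \<in> track d \<or> head \<Gamma> e \<in> track d}"
      using edge'(1)[of i] by (auto simp: e)
  next
    fix e assume e: "e \<in> {e \<in> arcs \<Gamma>. tail \<Gamma> e \<in> track d \<or> head \<Gamma> e \<in> track d}"
    then obtain i where "(step ^^ i) d \<in> {tdart e, hdart e}"
      using track_closed[OF assms] by blast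
    then obtain j where j: "j < ?n" "(step ^^ j) d \<in> {tdart e, hdart e}" using low by metis
    then have "edge ((step ^^ j) d) = e" using edge e by blast
    then show "e \<in> set ?es" unfolding set_map using j(1) by (intro image_eqI[of _ _ j]) auto
  qed
  have ends: "{tail \<Gamma> (edge ((step ^^ i) d)), head \<Gamma> (edge ((step ^^ i) d))} =
      {fst ((step ^^ i) d), fst ((step ^^ Suc i) d)}" for i
    by (rule endless_cases[OF assms, of i]) 
      (auto simp: edge tdart_def hdart_def flip_def simp del: funpow.simps)
  have wrap: "(step ^^ (Suc i mod ?n)) d = (step ^^ Suc i) d" for i
    by (rule steps_mod_period[OF assms])
  show ?thesis
    unfolding is_undirected_cycle_def
  proof (intro exI conjI allI impI)
    show "?vs \<noteq> []" using period_pos[OF assms] by simp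
    show "length ?es = length ?vs" by simp
    show "distinct ?vs" using 1 by (auto simp: distinct_map inj_on_def)
    show "distinct ?es" using 2 by (auto simp: distinct_map inj_on_def)
    show "set ?vs = track d" using track_eq[OF assms] by auto
    show "set ?es = {e \<in> arcs \<Gamma>. tail \<Gamma> e \<in> track d \<or> head \<Gamma> e \<in> track d}" by (rule set_es)
    fix i assume "i < length ?vs"
    then show "{tail \<Gamma> (?es ! i), head \<Gamma> (?es ! i)} = {?vs ! i, ?vs ! (Suc i mod length ?vs)}"
      using ends[of i] wrap[of i] period_pos[OF assms] by (simp del: funpow.simps)
  qed
qed

lemma track_band: "endless d \<Longrightarrow> track d \<in> bands \<Gamma>"
  using track_component track_cycle by (simp add: bands_def)

lemma bands_disjoint: "b \<in> bands \<Gamma> \<Longrightarrow> b' \<in> bands \<Gamma> \<Longrightarrow> x \<in> b \<Longrightarrow> x \<in> b' \<Longrightarrow> b = b'"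
proof -
  interpret W: pair_wf_digraph "mk_symmetric \<Gamma>"
    using wf_digraph.wellformed_mk_symmetric[OF wf_graph] .
  show "b \<in> bands \<Gamma> \<Longrightarrow> b' \<in> bands \<Gamma> \<Longrightarrow> x \<in> b \<Longrightarrow> x \<in> b' \<Longrightarrow> b = b'"
    using W.sccs_verts_disjoint[of b b'] by (auto simp: bands_def components_def)
qed

end

section \<open>The up-and-down graph of a quiver as a graph with darts\<close>

definition tail_side :: "('v, 'a) pre_digraph \<Rightarrow> ('a \<Rightarrow> 's) \<Rightarrow> ('v \<times> 's \<Rightarrow> int) \<Rightarrow> 'a \<Rightarrow> bool" where
  "tail_side Q c \<epsilon> a \<longleftrightarrow> \<epsilon> (tail Q a, c a) = 1"

definition head_side :: "('v, 'a) pre_digraph \<Rightarrow> ('a \<Rightarrow> 's) \<Rightarrow> ('v \<times> 's \<Rightarrow> int) \<Rightarrow> 'a \<Rightarrow> bool" where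
  "head_side Q c \<epsilon> a \<longleftrightarrow> \<epsilon> (head Q a, c a) = 1"

text \<open>These axioms distill what the gentle relations, the coloring and the sign function
  provide together: on each side of a vertex at most one arrow enters and at most one leaves, and a
  composite is a relation exactly if it stays on one side.\<close>

locale updown =
  fixes Q :: "('v, 'a) pre_digraph" and c :: "'a \<Rightarrow> 's" and \<beta> :: "'v \<Rightarrow> nat" and r :: "'a \<Rightarrow> nat"
    and \<epsilon> :: "'v \<times> 's \<Rightarrow> int"
  assumes fin: "fin_digraph Q"
    and in_unique: "a \<in> arcs Q \<Longrightarrow> b \<in> arcs Q \<Longrightarrow> head Q a = head Q b \<Longrightarrow>
      head_side Q c \<epsilon> a = head_side Q c \<epsilon> b \<Longrightarrow> a = b"
    and out_unique: "a \<in> arcs Q \<Longrightarrow> b \<in> arcs Q \<Longrightarrow> tail Q a = tail Q b \<Longrightarrow>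
      tail_side Q c \<epsilon> a = tail_side Q c \<epsilon> b \<Longrightarrow> a = b"
    and composable: "a \<in> arcs Q \<Longrightarrow> b \<in> arcs Q \<Longrightarrow> head Q a = tail Q b \<Longrightarrow>
      head_side Q c \<epsilon> a = tail_side Q c \<epsilon> b \<longleftrightarrow> c a = c b"
    and rank_map: "rank_map Q c \<beta> r"
begin

abbreviation \<Gamma> :: "('v \<times> nat, 'a \<times> nat) pre_digraph" where "\<Gamma> \<equiv> updown_graph Q c \<beta> r \<epsilon>"
abbreviation "ts \<equiv> tail_side Q c \<epsilon>"
abbreviation "hs \<equiv> head_side Q c \<epsilon>"

lemma wf: "a \<in> arcs Q \<Longrightarrow> tail Q a \<in> verts Q" "a \<in> arcs Q \<Longrightarrow> head Q a \<in> verts Q"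
  and finQ: "finite (verts Q)" "finite (arcs Q)"
  using fin by (auto simp: fin_digraph_def wf_digraph_def fin_digraph_axioms_def)

lemma rank_le: "a \<in> arcs Q \<Longrightarrow> r a \<le> \<beta> (tail Q a)" "a \<in> arcs Q \<Longrightarrow> r a \<le> \<beta> (head Q a)"
  using rank_map by (auto simp: rank_map_def)

lemma rank_sum: "a \<in> arcs Q \<Longrightarrow> b \<in> arcs Q \<Longrightarrow> head Q a = tail Q b \<Longrightarrow> hs a = ts b \<Longrightarrow> r a + r b \<le> \<beta> (head Q a)"
  using rank_map composable by (auto simp: rank_map_def)

lemma arcs_graph: "(a, i) \<in> arcs \<Gamma> \<longleftrightarrow> a \<in> arcs Q \<and> 1 \<le> i \<and> i \<le> r a"
  and verts_graph: "(x, j) \<in> verts \<Gamma> \<longleftrightarrow> x \<in> verts Q \<and> 1 \<le> j \<and> j \<le> \<beta> x"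
  and tail_graph: "tail \<Gamma> (a, i) = (tail Q a, if ts a then i else \<beta> (tail Q a) - i + 1)"
  and head_graph: "head \<Gamma> (a, i) = (head Q a, if hs a then \<beta> (head Q a) - i + 1 else i)"
  by (auto simp: updown_graph_def tail_side_def head_side_def)

lemma in_arcs_graphE:
  assumes "e \<in> arcs \<Gamma>" 
  obtains a i where "e = (a, i)" "a \<in> arcs Q" "1 \<le> i" "i \<le> r a" "i \<le> \<beta> (tail Q a)" "i \<le> \<beta> (head Q a)"
  using assms rank_le by (cases e) (auto simp: arcs_graph intro: order_trans)

sublocale dart_graph \<Gamma> "\<lambda>e. ts (fst e)" "\<lambda>e. hs (fst e)"
proof
  show "finite (verts \<Gamma>)" using finQ by (auto simp: updown_graph_def)
  fix e assume e: "e \<in> arcs \<Gamma>"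
  then show "tail \<Gamma> e \<in> verts \<Gamma>" "head \<Gamma> e \<in> verts \<Gamma>"
    by (auto elim!: in_arcs_graphE simp: tail_graph head_graph verts_graph wf)
  fix e' assume e': "e' \<in> arcs \<Gamma>"
  show "e = e'" if "tail \<Gamma> e = tail \<Gamma> e'" "ts (fst e) = ts (fst e')"
    using e e' that out_unique[of "fst e" "fst e'"]
    by (auto elim!: in_arcs_graphE simp: tail_graph split: if_splits)
  show "e = e'" if "head \<Gamma> e = head \<Gamma> e'" "hs (fst e) = hs (fst e')"
    using e e' that in_unique[of "fst e" "fst e'"]
    by (auto elim!: in_arcs_graphE simp: head_graph split: if_splits)
  \<comment> \<open>On a common side the heads of the incoming edges fill one end of the range of
    positions and the tails of the outgoing edges the other end; \<open>rank_sum\<close> keeps the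
    two ends disjoint.\<close>
  show "ts (fst e) \<noteq> hs (fst e')" if "tail \<Gamma> e = head \<Gamma> e'"
    using e e' that rank_sum[of "fst e'" "fst e"]
    by (auto elim!: in_arcs_graphE simp: tail_graph head_graph split: if_splits)
qed

lemma tdart_graph: "tdart (a, i) = ((tail Q a, if ts a then i else \<beta> (tail Q a) - i + 1), ts a)"
  and hdart_graph: "hdart (a, i) = ((head Q a, if hs a then \<beta> (head Q a) - i + 1 else i), hs a)"
  by (simp_all add: tdart_def hdart_def tail_graph head_graph)

text \<open>On each side the heads of edges are the outermost vertices in one direction and the
  tails the outermost ones in the other.\<close>

lemma hdart_beyond:
  assumes "e \<in> arcs \<Gamma>" "hdart e = (w, \<sigma>)" "v \<in> verts \<Gamma>" "fst v = fst w"
    "v \<noteq> w" "\<sigma> = (snd w < snd v)"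
  shows "\<exists>e'\<in>arcs \<Gamma>. fst e' = fst e \<and> hdart e' = (v, \<sigma>)"
proof -
  obtain a i where a: "e = (a, i)" "a \<in> arcs Q" "1 \<le> i" "i \<le> r a" "i \<le> \<beta> (tail Q a)" "i \<le> \<beta> (head Q a)"
    using assms(1) by (rule in_arcs_graphE)
  obtain j where v: "v = (head Q a, j)" "1 \<le> j" "j \<le> \<beta> (head Q a)"
    using assms a by (cases v) (auto simp: hdart_graph verts_graph)
  have w: "w = (head Q a, if hs a then \<beta> (head Q a) - i + 1 else i)" "\<sigma> = hs a"
    using assms(2) a(1) by (auto simp: hdart_graph)
  show ?thesis
  proof (cases "hs a")
    case True
    then show ?thesis using assms(5,6) a v w
      by (intro bexI[of _ "(a, \<beta> (head Q a) + 1 - j)"]) (auto simp: hdart_graph arcs_graph)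
  next
    case False
    then show ?thesis using assms(5,6) a v w
      by (intro bexI[of _ "(a, j)"]) (auto simp: hdart_graph arcs_graph)
  qed
qed

lemma tdart_beyond:
  assumes "e \<in> arcs \<Gamma>" "tdart e = (v, \<sigma>)" "w \<in> verts \<Gamma>" "fst v = fst w"
    "v \<noteq> w" "\<sigma> = (snd w < snd v)"
  shows "\<exists>e'\<in>arcs \<Gamma>. fst e' = fst e \<and> tdart e' = (w, \<sigma>)"
proof -
  obtain a i where a: "e = (a, i)" "a \<in> arcs Q" "1 \<le> i" "i \<le> r a" "i \<le> \<beta> (tail Q a)" "i \<le> \<beta> (head Q a)"
    using assms(1) by (rule in_arcs_graphE)
  obtain j where w: "w = (tail Q a, j)" "1 \<le> j" "j \<le> \<beta> (tail Q a)"
    using assms a by (cases w) (auto simp: tdart_graph verts_graph)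
  have v: "v = (tail Q a, if ts a then i else \<beta> (tail Q a) - i + 1)" "\<sigma> = ts a"
    using assms(2) a(1) by (auto simp: tdart_graph)
  show ?thesis
  proof (cases "ts a")
    case True
    then show ?thesis using assms(5,6) a v w
      by (intro bexI[of _ "(a, j)"]) (auto simp: tdart_graph arcs_graph)
  next
    case False
    then show ?thesis using assms(5,6) a v w
      by (intro bexI[of _ "(a, \<beta> (tail Q a) + 1 - j)"]) (auto simp: tdart_graph arcs_graph)
  qed
qed

text \<open>Both bracketed equivalences say that \<open>e\<close> has the smaller edge index: along
  the edges of one arrow the position at the tail increases exactly if \<open>ts\<close> holds, the
  position at the head exactly if \<open>hs\<close> fails. It is used to carry the order of a pair
  of vertices across a pair of edges.\<close>

lemma order_tail_head:
  assumes "e \<in> arcs \<Gamma>" "e' \<in> arcs \<Gamma>" "fst e = fst e'" "e \<noteq> e'"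
  shows "(ts (fst e) \<longleftrightarrow> snd (tail \<Gamma> e) < snd (tail \<Gamma> e')) \<longleftrightarrow> 
     (\<not> hs (fst e) \<longleftrightarrow> snd (head \<Gamma> e) < snd (head \<Gamma> e'))"
proof -
  obtain a i where a: "e = (a, i)" "i \<le> \<beta> (tail Q a)" "i \<le> \<beta> (head Q a)"
    using assms(1) by (rule in_arcs_graphE)
  obtain i' where i': "e' = (a, i')" "i' \<le> \<beta> (tail Q a)" "i' \<le> \<beta> (head Q a)"
    using assms(2,3) a by (auto elim!: in_arcs_graphE)
  show ?thesis
    using a i' assms(4) by (cases "ts a"; cases "hs a") (auto simp: tail_graph head_graph)
qed

text \<open>Indexed by darts instead of edges, so that it also gives the weight of a matrix row. The
  side \<open>True\<close> is the sign 1 required in the definition of the module.\<close>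

definition head_weight :: "(('v \<times> nat) set \<Rightarrow> 'v \<times> nat) \<Rightarrow> (('v \<times> nat) set \<Rightarrow> 'k::field) \<Rightarrow> ('v \<times> nat) \<times> bool \<Rightarrow> 'k" where
  "head_weight \<Theta> l d = (if (\<exists>b\<in>bands \<Gamma>. \<Theta> b = fst d) \<and> snd d
     then l (THE b. b \<in> bands \<Gamma> \<and> \<Theta> b = fst d) else 1)"

definition edge_weight :: "(('v \<times> nat) set \<Rightarrow> 'v \<times> nat) \<Rightarrow> (('v \<times> nat) set \<Rightarrow> 'k::field) \<Rightarrow> 'a \<times> nat \<Rightarrow> 'k" where
  "edge_weight \<Theta> l e = head_weight \<Theta> l (hdart e)"

text \<open>An edge crossed from head to tail contributes the inverse weight, so that the product
  along a closed walk is the monodromy of the band.\<close>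

definition step_weight :: "(('v \<times> nat) set \<Rightarrow> 'v \<times> nat) \<Rightarrow> (('v \<times> nat) set \<Rightarrow> 'k::field) \<Rightarrow> ('v \<times> nat) \<times> bool \<Rightarrow> 'k" where
  "step_weight \<Theta> l d = (if d \<in> tdart ` arcs \<Gamma> then head_weight \<Theta> l (cross d) else inverse (head_weight \<Theta> l d))"

lemma step_weight_tdart: "e \<in> arcs \<Gamma> \<Longrightarrow> step_weight \<Theta> l (tdart e) = edge_weight \<Theta> l e"
  by (simp add: step_weight_def edge_weight_def)

lemma step_weight_hdart: "e \<in> arcs \<Gamma> \<Longrightarrow> step_weight \<Theta> l (hdart e) = inverse (edge_weight \<Theta> l e)"
proof -
  assume "e \<in> arcs \<Gamma>"
  then have "hdart e \<notin> tdart ` arcs \<Gamma>" by (auto simp: tdart_neq_hdart[symmetric])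
  then show ?thesis by (simp add: step_weight_def edge_weight_def)
qed

end

locale updown_choice = updown Q c \<beta> r \<epsilon>
  for Q :: "('v, 'a) pre_digraph" and c :: "'a \<Rightarrow> 's" and \<beta> r \<epsilon> +
  fixes \<Theta> :: "('v \<times> nat) set \<Rightarrow> 'v \<times> nat"
  assumes choice: "choice_function (updown_graph Q c \<beta> r \<epsilon>) \<Theta>"
begin

lemma choice_in: "b \<in> bands \<Gamma> \<Longrightarrow> \<Theta> b \<in> b"
  using choice by (auto simp: choice_function_def)

lemma choice_not_tail: "b \<in> bands \<Gamma> \<Longrightarrow> e \<in> arcs \<Gamma> \<Longrightarrow> tail \<Gamma> e \<noteq> \<Theta> b"
  using choice by (auto simp: choice_function_def is_target_def)

lemma choice_in_verts: "b \<in> bands \<Gamma> \<Longrightarrow> \<Theta> b \<in> verts \<Gamma>"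
  using choice by (auto simp: choice_function_def is_target_def)

lemma choice_inj: "b \<in> bands \<Gamma> \<Longrightarrow> b' \<in> bands \<Gamma> \<Longrightarrow> \<Theta> b = \<Theta> b' \<Longrightarrow> b = b'"
  using choice_in bands_disjoint by metis

lemma finite_bands: "finite (bands \<Gamma>)"
proof -
  have "\<Theta> ` bands \<Gamma> \<subseteq> verts \<Gamma>" using choice_in_verts by auto
  moreover have "inj_on \<Theta> (bands \<Gamma>)" using choice_inj by (auto simp: inj_on_def)
  ultimately show ?thesis using finite_verts by (meson finite_imageD finite_subset)
qed

lemma head_weight_choice: "b \<in> bands \<Gamma> \<Longrightarrow> head_weight \<Theta> l (\<Theta> b, True) = l b"
proof -
  assume b: "b \<in> bands \<Gamma>"
  then have "(THE b'. b' \<in> bands \<Gamma> \<and> \<Theta> b' = \<Theta> b) = b"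
    by (intro the_equality conjI choice_inj[of _ b]) auto
  with b show ?thesis by (auto simp: head_weight_def)
qed

lemma head_weight_other: "(\<And>b. b \<in> bands \<Gamma> \<Longrightarrow> d \<noteq> (\<Theta> b, True)) \<Longrightarrow> head_weight \<Theta> l d = 1"
  by (cases d) (force simp: head_weight_def)

lemma head_weight_nonzero: "(\<And>b. b \<in> bands \<Gamma> \<Longrightarrow> l b \<noteq> 0) \<Longrightarrow> head_weight \<Theta> l d \<noteq> 0"
  by (cases "\<exists>b\<in>bands \<Gamma>. d = (\<Theta> b, True)") (auto simp: head_weight_choice head_weight_other)

text \<open>The chosen target has one edge on each side, both ending there, and only the one on side
  \<open>True\<close> carries the parameter. One period passes this edge exactly once; the direction
  of passage decides between the parameter and its inverse.\<close>

lemma walk_weight: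
  assumes d: "endless d"
  shows "(\<Prod>i<period d. step_weight \<Theta> l ((step ^^ i) d)) \<in> {l (track d), inverse (l (track d))}"
proof -
  let ?b = "track d" and ?p = "period d"
  let ?x = "(\<Theta> ?b, True)"
  have b: "?b \<in> bands \<Gamma>" using track_band[OF d] .
  have nt: "?x \<noteq> tdart e" if "e \<in> arcs \<Gamma>" for e
    using choice_not_tail[OF b that] by (auto simp: tdart_def)
  have weight_1: "head_weight \<Theta> l (hdart e) = 1" 
    if "e \<in> arcs \<Gamma>" "tail \<Gamma> e \<in> track d" "hdart e \<noteq> ?x" for e
  proof (rule head_weight_other)
    fix b' assume b': "b' \<in> bands \<Gamma>"
    show "hdart e \<noteq> (\<Theta> b', True)"
    proof
      assume eq: "hdart e = (\<Theta> b', True)"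
      then have "\<Theta> b' = head \<Gamma> e" by (metis fst_conv fst_darts(2))
      then have "\<Theta> b' \<in> ?b" using that track_closed(1)[OF d] by simp
      then have "b' = ?b" using bands_disjoint[OF b' b choice_in[OF b']] by simp
      then show False using eq that by simp
    qed
  qed
  have on: "fst ((step ^^ i) d) \<in> track d" for i by (auto simp: track_def)
  \<comment> \<open>A second passage through the edge at \<open>?x\<close> within one period would
    repeat a dart or reverse the walk.\<close>
  have single: "(\<Prod>j<?p. step_weight \<Theta> l ((step ^^ j) d)) = step_weight \<Theta> l ((step ^^ i) d)"
    if i: "i < ?p" and x: "(step ^^ i) d = ?x \<or> cross ((step ^^ i) d) = ?x" for i
  proof -
    have "step_weight \<Theta> l ((step ^^ j) d) = 1" if "j < ?p" "j \<noteq> i" for j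
    proof (rule ccontr)
      assume ne: "step_weight \<Theta> l ((step ^^ j) d) \<noteq> 1"
      have "(step ^^ j) d = ?x \<or> cross ((step ^^ j) d) = ?x"
      proof (rule endless_cases[OF d, of j])
        fix e assume e: "e \<in> arcs \<Gamma>" "(step ^^ j) d = tdart e"
        then have "hdart e = ?x"
          using weight_1[of e] ne on[of j] by (auto simp: step_weight_tdart edge_weight_def)
        then show ?thesis using e by simp
      next
        fix e assume e: "e \<in> arcs \<Gamma>" "(step ^^ j) d = hdart e"
        then have "hdart e = ?x"
          using weight_1[of e] ne on[of j] track_closed(1)[OF d, of e]
          by (auto simp: step_weight_hdart edge_weight_def)
        then show ?thesis using e by simp
      qed
      with x have "(step ^^ i) d = (step ^^ j) d \<or> cross ((step ^^ i) d) = (step ^^ j) d"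
        by (metis cross_cross)
      moreover have "cross ((step ^^ i) d) = flip ((step ^^ Suc i) d)" by (simp add: step_def)
      ultimately show False
        using steps_inj_below_period[OF d, of i j] flip_not_on_walk[OF d] that i by metis
    qed
    then show ?thesis
      using i by (subst prod.remove[of _ i]) (auto intro!: prod.neutral)
  qed
  have "\<exists>i. (step ^^ i) d = ?x \<or> cross ((step ^^ i) d) = ?x"
  proof (rule edge_dart_on_track[OF d, of ?x])
    show "fst ?x \<in> ?b" using choice_in[OF b] by simp
  next
    fix i assume "?x = (step ^^ i) d"
    then show ?thesis by metis
  next
    fix i assume "cross ?x = (step ^^ i) d"
    then show ?thesis by (metis cross_cross)
  qed
  then obtain i' where i': "(step ^^ i') d = ?x \<or> cross ((step ^^ i') d) = ?x" by blast
  define i where "i = i' mod ?p"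
  have i: "i < ?p" "(step ^^ i) d = ?x \<or> cross ((step ^^ i) d) = ?x"
    using i' steps_mod_period[OF d] period_pos[OF d] by (auto simp: i_def)
  have "step_weight \<Theta> l ((step ^^ i) d) \<in> {l ?b, inverse (l ?b)}"
  proof (rule endless_cases[OF d, of i])
    fix e assume e: "e \<in> arcs \<Gamma>" "(step ^^ i) d = tdart e"
    then have "hdart e = ?x" using i(2) nt[of e] by auto
    then show ?thesis using e by (simp add: step_weight_tdart edge_weight_def head_weight_choice[OF b])
  next
    fix e assume e: "e \<in> arcs \<Gamma>" "(step ^^ i) d = hdart e"
    then have "hdart e = ?x" using i(2) nt[of e] by auto
    then show ?thesis
      using e(2) step_weight_hdart[OF e(1), of \<Theta> l] by (simp add: edge_weight_def head_weight_choice[OF b])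
  qed
  then show ?thesis using single[OF i] by simp
qed

lemma prod_periodic:
  fixes f :: "nat \<Rightarrow> 'k::field"
  assumes "\<And>i. f (i + p) = f i"
  shows "(\<Prod>i<q * p. f i) = (\<Prod>i<p. f i) ^ q"
proof -
  have "f (i + m * p) = f i" for i m
  proof (induction m)
    case (Suc m)
    then show ?case using assms[of "i + m * p"] by (simp add: ac_simps)
  qed simp
  then have "prod f {m * p..<m * p + p} = prod f {..<p}" for m
    using prod.shift_bounds_nat_ivl[of f 0 "m * p" p] by (simp add: add.commute lessThan_atLeast0)
  then show ?thesis by (simp flip: prod.nat_group)
qed

lemma walk_weight_mult:
  assumes "endless d"
  shows "(\<Prod>i<q * period d. step_weight \<Theta> l ((step ^^ i) d)) \<in> {l (track d) ^ q, inverse (l (track d) ^ q)}"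
proof -
  have "(step ^^ (i + period d)) d = (step ^^ i) d" for i
    by (simp add: funpow_add steps_period[OF assms])
  then have "(\<Prod>i<q * period d. step_weight \<Theta> l ((step ^^ i) d))
      = (\<Prod>i<period d. step_weight \<Theta> l ((step ^^ i) d)) ^ q"
    by (intro prod_periodic) simp
  then show ?thesis using walk_weight[OF assms, of l] by (auto simp: power_inverse)
qed

end

section \<open>Annihilators of the tangent directions vanish\<close>

definition side_sign :: "bool \<Rightarrow> 'k::field" where "side_sign \<sigma> = (if \<sigma> then 1 else - 1)"

lemma side_sign_simps [simp]: "side_sign True = 1" "side_sign False = - 1" "side_sign \<sigma> \<noteq> 0"
  "side_sign (\<not> \<sigma>) = - side_sign \<sigma>"
  by (auto simp: side_sign_def)

text \<open>The conditions on \<open>u\<close> say that it annihilates the differences \<open>Z\<^sub>+ - Z\<^sub>-\<close> of the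
  two components of infinitesimal automorphisms of the module, and the variations of the parameters.\<close>

locale updown_annihilator = updown_choice Q c \<beta> r \<epsilon> \<Theta>
  for Q :: "('v, 'a) pre_digraph" and c :: "'a \<Rightarrow> 's" and \<beta> r \<epsilon> \<Theta> +
  fixes l :: "('v \<times> nat) set \<Rightarrow> 'k::field" and u :: "'v \<times> nat \<Rightarrow> 'v \<times> nat \<Rightarrow> 'k"
  assumes parameter_nonzero: "b \<in> bands \<Gamma> \<Longrightarrow> l b \<noteq> 0"
    and generic: "b \<in> bands \<Gamma> \<Longrightarrow> b' \<in> bands \<Gamma> \<Longrightarrow> b \<noteq> b' \<Longrightarrow> m \<in> {1..2 * card (verts \<Gamma>)} \<Longrightarrow>
      n \<in> {1..2 * card (verts \<Gamma>)} \<Longrightarrow> l b ^ m \<noteq> l b' ^ n \<and> l b ^ m * l b' ^ n \<noteq> 1"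
    and linked: "e \<in> arcs \<Gamma> \<Longrightarrow> e' \<in> arcs \<Gamma> \<Longrightarrow> fst e = fst e' \<Longrightarrow>
      side_sign (ts (fst e)) * edge_weight \<Theta> l e * u (tail \<Gamma> e') (tail \<Gamma> e)
        + side_sign (hs (fst e)) * edge_weight \<Theta> l e' * u (head \<Gamma> e') (head \<Gamma> e) = 0"
    and free: "v \<in> verts \<Gamma> \<Longrightarrow> w \<in> verts \<Gamma> \<Longrightarrow> fst v = fst w \<Longrightarrow>
      (v, \<sigma>) \<notin> tdart ` arcs \<Gamma> \<Longrightarrow> (w, \<sigma>) \<notin> hdart ` arcs \<Gamma> \<Longrightarrow> u v w = 0"
    and target: "b \<in> bands \<Gamma> \<Longrightarrow> u (\<Theta> b) (\<Theta> b) = 0"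
begin

lemma edge_weight_nonzero [simp]: "edge_weight \<Theta> l e \<noteq> 0"
  by (simp add: edge_weight_def head_weight_nonzero parameter_nonzero)

lemma linked_iff: "e \<in> arcs \<Gamma> \<Longrightarrow> e' \<in> arcs \<Gamma> \<Longrightarrow> fst e = fst e' \<Longrightarrow>
    u (tail \<Gamma> e') (tail \<Gamma> e) = 0 \<longleftrightarrow> u (head \<Gamma> e') (head \<Gamma> e) = 0"
  using linked[of e e'] by auto

text \<open>The side is forced by the order of the two vertices: it is the side on which heads of
  edges accumulate towards \<open>fst d\<close> and tails towards \<open>fst d'\<close>. If
  \<open>fst d\<close> is a tail there, so is \<open>fst d'\<close>; if \<open>fst d'\<close> is a
  head, so is \<open>fst d\<close>.\<close>

definition parallel :: "('v \<times> nat) \<times> bool \<Rightarrow> ('v \<times> nat) \<times> bool \<Rightarrow> bool" where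
  "parallel d d' \<longleftrightarrow> fst d \<in> verts \<Gamma> \<and> fst d' \<in> verts \<Gamma> \<and> fst (fst d) = fst (fst d') \<and> fst d \<noteq> fst d'
     \<and> snd d = (snd (fst d') < snd (fst d)) \<and> snd d' = snd d \<and> u (fst d) (fst d') \<noteq> 0"

text \<open>Each step also changes the side, so the factor \<open>side_sign\<close> absorbs the
  minus sign hidden in \<open>linked\<close>, and the transport along walks is sign-free.\<close>

definition pairing :: "('v \<times> nat) \<times> bool \<Rightarrow> ('v \<times> nat) \<times> bool \<Rightarrow> 'k" where
  "pairing d d' = side_sign (snd d) * u (fst d) (fst d')"

text \<open>On the side determined by the order of its two vertices, a pair in the support of \<open>u\<close> is
  neither free nor at a dead end, so both vertices can be moved along edges with the same label.\<close>

lemma parallel_cases: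
  assumes "parallel d d'"
  obtains e e' where "e \<in> arcs \<Gamma>" "e' \<in> arcs \<Gamma>" "fst e = fst e'" "d = tdart e'" "d' = tdart e"
  | e e' where "e \<in> arcs \<Gamma>" "e' \<in> arcs \<Gamma>" "fst e = fst e'" "d = hdart e'" "d' = hdart e"
proof -
  obtain v w \<sigma> where d: "d = (v, \<sigma>)" "d' = (w, \<sigma>)"
    using assms by (cases d; cases d') (auto simp: parallel_def)
  have p: "v \<in> verts \<Gamma>" "w \<in> verts \<Gamma>" "fst v = fst w" "v \<noteq> w" "\<sigma> = (snd w < snd v)" "u v w \<noteq> 0"
    using assms unfolding parallel_def d by auto
  have "(v, \<sigma>) \<in> tdart ` arcs \<Gamma> \<or> (w, \<sigma>) \<in> hdart ` arcs \<Gamma>"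
    using free[OF p(1-3)] p(6) by blast
  then show ?thesis
  proof
    assume "(v, \<sigma>) \<in> tdart ` arcs \<Gamma>"
    then obtain e' where e': "e' \<in> arcs \<Gamma>" "(v, \<sigma>) = tdart e'" by blast
    from tdart_beyond[OF e'(1) e'(2)[symmetric] p(2-5)] obtain e where "e \<in> arcs \<Gamma>" "fst e = fst e'" "tdart e = (w, \<sigma>)" by blast
    then show ?thesis using that(1)[of e e'] e' d by simp
  next
    assume "(w, \<sigma>) \<in> hdart ` arcs \<Gamma>"
    then obtain e where e: "e \<in> arcs \<Gamma>" "(w, \<sigma>) = hdart e" by blast
    from hdart_beyond[OF e(1) e(2)[symmetric] p(1,3,4,5)] obtain e' where "e' \<in> arcs \<Gamma>" "fst e' = fst e" "hdart e' = (v, \<sigma>)" by blast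
    then show ?thesis using that(2)[of e e'] e d by simp
  qed
qed

text \<open>By \<open>order_tail_head\<close>, crossing two edges with one label and then changing
  sides keeps the side matched to the order of the pair. Hence the criterion that both walks can
  continue applies again after each step.\<close>

lemma parallel_step:
  assumes "parallel d d'"
  shows "parallel (step d) (step d') \<and>
     pairing (step d) (step d') * step_weight \<Theta> l d = step_weight \<Theta> l d' * pairing d d'"
proof (rule parallel_cases[OF assms])
  fix e e' assume e: "e \<in> arcs \<Gamma>" "e' \<in> arcs \<Gamma>" "fst e = fst e'" "d = tdart e'" "d' = tdart e"
  have st: "step d = (head \<Gamma> e', \<not> hs (fst e))" "step d' = (head \<Gamma> e, \<not> hs (fst e))"
    using e by (simp_all add: step_def flip_def hdart_def)
  have dd: "d = (tail \<Gamma> e', ts (fst e))" "d' = (tail \<Gamma> e, ts (fst e))"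
    using e by (simp_all add: tdart_def)
  have p: "tail \<Gamma> e' \<noteq> tail \<Gamma> e" "ts (fst e) = (snd (tail \<Gamma> e) < snd (tail \<Gamma> e'))"
    "u (tail \<Gamma> e') (tail \<Gamma> e) \<noteq> 0"
    using assms unfolding parallel_def dd by auto
  have "e \<noteq> e'" using p by auto
  then have ne: "head \<Gamma> e' \<noteq> head \<Gamma> e" using head_dart_inj[of e e'] e by auto
  have o: "\<not> hs (fst e) \<longleftrightarrow> snd (head \<Gamma> e) < snd (head \<Gamma> e')"
    using order_tail_head[OF e(1-3) \<open>e \<noteq> e'\<close>] p(2) by simp
  have x: "fst (head \<Gamma> e') = fst (head \<Gamma> e)"
    using e(3) by (cases e; cases e') (simp add: head_graph)
  have nz: "u (head \<Gamma> e') (head \<Gamma> e) \<noteq> 0" using p(3) linked_iff[OF e(1-3)] by simp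
  have "parallel (step d) (step d')"
    unfolding parallel_def st using e head_in_verts ne o x nz by simp
  moreover have "pairing (step d) (step d') * step_weight \<Theta> l d = step_weight \<Theta> l d' * pairing d d'"
  proof -
    have "step_weight \<Theta> l d = edge_weight \<Theta> l e'" "step_weight \<Theta> l d' = edge_weight \<Theta> l e"
      using e by (simp_all add: step_weight_tdart)
    then show ?thesis
      using linked[OF e(1-3)] unfolding pairing_def st unfolding dd
      by (simp add: algebra_simps add_eq_0_iff)
  qed
  ultimately show ?thesis by blast
next
  fix e e' assume e: "e \<in> arcs \<Gamma>" "e' \<in> arcs \<Gamma>" "fst e = fst e'" "d = hdart e'" "d' = hdart e"
  have st: "step d = (tail \<Gamma> e', \<not> ts (fst e))" "step d' = (tail \<Gamma> e, \<not> ts (fst e))"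
    using e by (simp_all add: step_def flip_def tdart_def)
  have dd: "d = (head \<Gamma> e', hs (fst e))" "d' = (head \<Gamma> e, hs (fst e))"
    using e by (simp_all add: hdart_def)
  have p: "head \<Gamma> e' \<noteq> head \<Gamma> e" "hs (fst e) = (snd (head \<Gamma> e) < snd (head \<Gamma> e'))"
    "u (head \<Gamma> e') (head \<Gamma> e) \<noteq> 0"
    using assms unfolding parallel_def dd by auto
  have "e \<noteq> e'" using p by auto
  then have ne: "tail \<Gamma> e' \<noteq> tail \<Gamma> e" using tail_dart_inj[of e e'] e by auto
  have o: "\<not> ts (fst e) \<longleftrightarrow> snd (tail \<Gamma> e) < snd (tail \<Gamma> e')"
    using order_tail_head[OF e(1-3) \<open>e \<noteq> e'\<close>] p(2) by simp
  have x: "fst (tail \<Gamma> e') = fst (tail \<Gamma> e)"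
    using e(3) by (cases e; cases e') (simp add: tail_graph)
  have nz: "u (tail \<Gamma> e') (tail \<Gamma> e) \<noteq> 0" using p(3) linked_iff[OF e(1-3)] by simp
  have "parallel (step d) (step d')"
    unfolding parallel_def st using e tail_in_verts ne o x nz by simp
  moreover have "pairing (step d) (step d') * step_weight \<Theta> l d = step_weight \<Theta> l d' * pairing d d'"
  proof -
    have w: "step_weight \<Theta> l d = inverse (edge_weight \<Theta> l e')" "step_weight \<Theta> l d' = inverse (edge_weight \<Theta> l e)"
      using e by (simp_all add: step_weight_hdart)
    have "side_sign (ts (fst e)) * u (tail \<Gamma> e') (tail \<Gamma> e) * edge_weight \<Theta> l e
        = - (side_sign (hs (fst e)) * u (head \<Gamma> e') (head \<Gamma> e) * edge_weight \<Theta> l e')"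
      using linked[OF e(1-3)] by (simp add: algebra_simps add_eq_0_iff)
    then show ?thesis
      unfolding w unfolding pairing_def st unfolding dd by (simp add: field_simps)
  qed
  ultimately show ?thesis by blast
qed

lemma parallel_steps:
  assumes "parallel d d'"
  shows "parallel ((step ^^ n) d) ((step ^^ n) d') \<and>
     pairing ((step ^^ n) d) ((step ^^ n) d') * (\<Prod>i<n. step_weight \<Theta> l ((step ^^ i) d))
       = (\<Prod>i<n. step_weight \<Theta> l ((step ^^ i) d')) * pairing d d'"
proof (induction n)
  case (Suc n)
  let ?x = "(step ^^ n) d" and ?y = "(step ^^ n) d'"
  have IH: "pairing ?x ?y * (\<Prod>i<n. step_weight \<Theta> l ((step ^^ i) d))
       = (\<Prod>i<n. step_weight \<Theta> l ((step ^^ i) d')) * pairing d d'" and p: "parallel ?x ?y"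
    using Suc by auto
  have "pairing (step ?x) (step ?y) * (\<Prod>i<Suc n. step_weight \<Theta> l ((step ^^ i) d))
      = (pairing (step ?x) (step ?y) * step_weight \<Theta> l ?x) * (\<Prod>i<n. step_weight \<Theta> l ((step ^^ i) d))"
    by (simp add: ac_simps)
  also have "\<dots> = step_weight \<Theta> l ?y * (pairing ?x ?y * (\<Prod>i<n. step_weight \<Theta> l ((step ^^ i) d)))"
    using parallel_step[OF p] by (simp add: ac_simps)
  also have "\<dots> = (\<Prod>i<Suc n. step_weight \<Theta> l ((step ^^ i) d')) * pairing d d'"
    unfolding IH by (simp add: ac_simps)
  finally show ?case using parallel_step[OF p] by simp
qed (use assms in simp)

lemma parallel_endless:
  assumes "parallel d d'" shows "endless d" "endless d'"
proof -
  have "(step ^^ i) d \<in> tdart ` arcs \<Gamma> \<union> hdart ` arcs \<Gamma>" "(step ^^ i) d' \<in> tdart ` arcs \<Gamma> \<union> hdart ` arcs \<Gamma>" for i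
    by (rule parallel_cases[OF parallel_steps[OF assms, THEN conjunct1, of i]]; blast)+
  then show "endless d" "endless d'" unfolding endless_def by blast+
qed

text \<open>The darts of one period are distinct and every vertex has two; this is the origin of the
  exponent bound in \<open>generic\<close>.\<close>

lemma period_le: "endless d \<Longrightarrow> period d \<in> {1..2 * card (verts \<Gamma>)}"
proof -
  assume d: "endless d"
  let ?f = "\<lambda>i. (step ^^ i) d"
  have "inj_on ?f {..<period d}" using steps_inj_below_period[OF d] by (auto simp: inj_on_def)
  moreover have "?f i \<in> verts \<Gamma> \<times> UNIV" for i
    using fst_endless_in_verts[OF endless_steps[OF d]] by (simp add: mem_Times_iff)
  then have "?f ` {..<period d} \<subseteq> verts \<Gamma> \<times> UNIV" by blast
  moreover have "finite (verts \<Gamma> \<times> (UNIV :: bool set))" using finite_verts by simp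
  ultimately have "card {..<period d} \<le> card (verts \<Gamma> \<times> (UNIV :: bool set))"
    by (metis card_image card_mono)
  then show ?thesis using period_pos[OF d] by (simp add: card_cartesian_product card_UNIV_bool)
qed

text \<open>After a common multiple of both periods the pair returns to itself with the same nonzero
  pairing, so the two walks have equal weights. The first has gone round its band
  \<open>period d'\<close> times and the second \<open>period d\<close> times, which equates powers
  of the two parameters up to inversion.\<close>

lemma parallel_same_track:
  assumes "parallel d d'" shows "track d = track d'"
proof (rule ccontr)
  assume ne: "track d \<noteq> track d'"
  note d = parallel_endless[OF assms]
  let ?N = "period d * period d'"
  have e: "(step ^^ ?N) d = d" "(step ^^ ?N) d' = d'"
    using steps_period_mult[OF d(1), of "period d'"] steps_period_mult[OF d(2), of "period d"]
    by (simp_all only: mult.commute[of "period d'"])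
  have "pairing d d' \<noteq> 0" using assms by (simp add: pairing_def parallel_def)
  then have eq: "(\<Prod>i<?N. step_weight \<Theta> l ((step ^^ i) d)) = (\<Prod>i<?N. step_weight \<Theta> l ((step ^^ i) d'))"
    using parallel_steps[OF assms, of ?N] unfolding e by simp
  let ?b = "track d" and ?b' = "track d'"
  have b: "?b \<in> bands \<Gamma>" "?b' \<in> bands \<Gamma>" using track_band d by auto
  then have nz: "l ?b \<noteq> 0" "l ?b' \<noteq> 0" using parameter_nonzero by auto
  have "(\<Prod>i<?N. step_weight \<Theta> l ((step ^^ i) d)) \<in> {l ?b ^ period d', inverse (l ?b ^ period d')}"
    using walk_weight_mult[OF d(1), where q = "period d'" and l = l] by (simp add: mult.commute)
  moreover have "(\<Prod>i<?N. step_weight \<Theta> l ((step ^^ i) d')) \<in> {l ?b' ^ period d, inverse (l ?b' ^ period d)}"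
    using walk_weight_mult[OF d(2), where q = "period d" and l = l] by simp
  moreover have "l ?b ^ period d' \<noteq> l ?b' ^ period d \<and> l ?b ^ period d' * l ?b' ^ period d \<noteq> 1"
    using generic[OF b ne period_le[OF d(2)] period_le[OF d(1)]] .
  \<comment> \<open>The directions of the two walks are unknown; all four combinations reduce to the
    two relations excluded by \<open>generic\<close>.\<close>
  moreover have "x = y \<or> x * y = 1" if "p \<in> {x, inverse x}" "p \<in> {y, inverse y}" "x \<noteq> 0" "y \<noteq> 0" for p x y :: 'k
    using that by auto
  ultimately show False using nz unfolding eq by (metis power_not_zero)
qed

text \<open>Two parallel darts on one band would give a rotation of the band that preserves the order of
  the vertices over each point, hence one without finite order.\<close>

lemma not_parallel: "\<not> parallel d d'"
proof
  assume par: "parallel d d'"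
  note d = parallel_endless[OF par]
  have steps: "parallel ((step ^^ i) d) ((step ^^ i) d')" for i
    using parallel_steps[OF par] by blast
  have "fst d' \<in> track d'" by (auto simp: track_def intro!: image_eqI[of _ _ 0])
  then have "fst d' \<in> track d" using parallel_same_track[OF par] by simp
  then show False
  proof (rule dart_on_track)
    fix j assume j: "d' = (step ^^ j) d"
    \<comment> \<open>The positions after multiples of \<open>j\<close> steps lie over one vertex of
      the quiver and on one side. Each consecutive pair is parallel, so they are strictly monotone
      in \<open>m\<close>, yet they return after \<open>period d\<close> such rotations.\<close>
    define x where "x m = snd (fst ((step ^^ (m * j)) d))" for m
    have par': "parallel ((step ^^ (m * j)) d) ((step ^^ (Suc m * j)) d)" for m
    proof -
      have "Suc m * j = m * j + j" by simp
      then show ?thesis using steps[of "m * j"] unfolding j by (simp only: funpow_add comp_apply)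
    qed
    have side: "snd ((step ^^ (m * j)) d) = snd d" for m
    proof (induction m)
      case (Suc m)
      then show ?case using par'[of m] unfolding parallel_def by simp
    qed simp
    have *: "x (Suc m) \<noteq> x m \<and> snd d = (x (Suc m) < x m)" for m
      using par'[of m] unfolding parallel_def x_def side by (metis prod_eq_iff)
    have "x (Suc m) \<noteq> x 0 \<and> snd d = (x (Suc m) < x 0)" for m
    proof (induction m)
      case 0
      then show ?case using *[of 0] by simp
    next
      case (Suc m)
      then show ?case using *[of "Suc m"] by (cases "snd d") auto
    qed
    moreover have "x (period d) = x 0"
      unfolding x_def by (simp add: steps_period_mult[OF d(1)])
    moreover obtain p where "period d = Suc p" using period_pos[OF d(1)] gr0_conv_Suc by blast
    ultimately show False by metis
  next
    \<comment> \<open>Here the walks run towards each other and meet halfway. Meeting at a vertex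
      (even \<open>j\<close>) contradicts that parallel darts have different vertices; meeting on an
      edge (odd \<open>j\<close>) makes one dart a tail and the other a head, against
      \<open>parallel_cases\<close>.\<close>
    fix j assume j: "d' = flip ((step ^^ j) d)"
    show False
    proof (cases "even j")
      case True
      then obtain i where i: "j = i + i" by (metis evenE mult_2)
      have "(step ^^ i) d' = flip ((step ^^ i) d)" unfolding j i by (rule steps_flip_steps)
      then show False using steps[of i] by (simp add: parallel_def flip_def)
    next
      case False
      then obtain i where i: "j = i + Suc i" by (metis oddE mult_2 add_Suc_right Suc_eq_plus1)
      have "(step ^^ i) d' = flip ((step ^^ Suc i) d)" unfolding j i by (rule steps_flip_steps)
      then have x: "(step ^^ i) d' = cross ((step ^^ i) d)" by (simp add: step_def)
      show False
      proof (rule parallel_cases[OF steps[of i]])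
        fix e e' assume "e \<in> arcs \<Gamma>" "e' \<in> arcs \<Gamma>" "(step ^^ i) d = tdart e'" "(step ^^ i) d' = tdart e"
        then show False using x tdart_neq_hdart[of e e'] by simp
      next
        fix e e' assume "e \<in> arcs \<Gamma>" "e' \<in> arcs \<Gamma>" "(step ^^ i) d = hdart e'" "(step ^^ i) d' = hdart e"
        then show False using x tdart_neq_hdart[of e' e] by simp
      qed
    qed
  qed
qed

lemma off_diagonal:
  assumes "v \<in> verts \<Gamma>" "w \<in> verts \<Gamma>" "fst v = fst w" "v \<noteq> w" shows "u v w = 0"
  using not_parallel[of "(v, snd w < snd v)" "(w, snd w < snd v)"] assms by (simp add: parallel_def)

text \<open>If \<open>u v v\<close> is nonzero, then \<open>free\<close> provides an edge on each
  side of \<open>v\<close>, and \<open>linked\<close> transports nonvanishing across it. So the walk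
  from \<open>v\<close> never ends, and it reaches the chosen target of its band, where
  \<open>u\<close> is zero.\<close>

lemma diagonal:
  assumes "v \<in> verts \<Gamma>" shows "u v v = 0"
proof (rule ccontr)
  assume nz: "u v v \<noteq> 0"
  have one: "d \<in> tdart ` arcs \<Gamma> \<union> hdart ` arcs \<Gamma> \<and> fst (step d) \<in> verts \<Gamma> \<and> u (fst (step d)) (fst (step d)) \<noteq> 0"
    if d: "fst d \<in> verts \<Gamma>" "u (fst d) (fst d) \<noteq> 0" for d
  proof -
    have dd: "d \<in> tdart ` arcs \<Gamma> \<union> hdart ` arcs \<Gamma>" using free[of "fst d" "fst d" "snd d"] d by auto
    then consider e where "e \<in> arcs \<Gamma>" "d = tdart e" | e where "e \<in> arcs \<Gamma>" "d = hdart e" by blast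
    then show ?thesis
    proof cases
      case (1 e)
      then show ?thesis using d dd linked_iff[of e e] head_in_verts by (simp add: step_def)
    next
      case (2 e)
      then show ?thesis using d dd linked_iff[of e e] tail_in_verts by (simp add: step_def)
    qed
  qed
  let ?d = "(v, True)"
  have all: "fst ((step ^^ i) ?d) \<in> verts \<Gamma> \<and> u (fst ((step ^^ i) ?d)) (fst ((step ^^ i) ?d)) \<noteq> 0" for i
    by (induction i) (use assms nz one in auto)
  then have d: "endless ?d" using one unfolding endless_def by blast
  obtain i where "\<Theta> (track ?d) = fst ((step ^^ i) ?d)"
    using choice_in[OF track_band[OF d]] by (auto simp: track_def)
  then show False using all[of i] target[OF track_band[OF d]] by simp
qed

lemma annihilator_zero: "v \<in> verts \<Gamma> \<Longrightarrow> w \<in> verts \<Gamma> \<Longrightarrow> fst v = fst w \<Longrightarrow> u v w = 0"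
  using diagonal off_diagonal by metis

end

section \<open>Choice of generic parameters\<close>

lemma finite_power_eq:
  fixes x :: "'k::field"
  assumes "m > 0" shows "finite {z. z ^ m = x}"
proof -
  have "coeff (monom 1 m - [:x:]) m = 1" using assms by (simp add: coeff_pCons split: nat.splits)
  then have "monom 1 m - [:x:] \<noteq> 0" by force
  then have "finite {z. poly (monom 1 m - [:x:]) z = 0}" by (rule poly_roots_finite)
  then show ?thesis by (simp add: poly_monom)
qed

text \<open>The parameters are chosen one after the other: given the earlier ones, every condition
  on the new one has positive exponent and excludes only finitely many values.\<close>

lemma generic_parameters_exist:
  assumes "infinite (UNIV :: 'k::field set)" "finite B"
  shows "\<exists>l :: 'b \<Rightarrow> 'k. (\<forall>b\<in>B. l b \<noteq> 0) \<and> (\<forall>b\<in>B. \<forall>b'\<in>B. b \<noteq> b' \<longrightarrow> (\<forall>m\<in>{1..K::nat}. \<forall>n\<in>{1..K}.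
     l b ^ m \<noteq> l b' ^ n \<and> l b ^ m * l b' ^ n \<noteq> 1))"
  using assms(2)
proof induction
  case (insert a B)
  then obtain l :: "'b \<Rightarrow> 'k" where l: "\<And>b. b \<in> B \<Longrightarrow> l b \<noteq> 0"
    "\<And>b b' m n. b \<in> B \<Longrightarrow> b' \<in> B \<Longrightarrow> b \<noteq> b' \<Longrightarrow> m \<in> {1..K} \<Longrightarrow> n \<in> {1..K} \<Longrightarrow>
      l b ^ m \<noteq> l b' ^ n \<and> l b ^ m * l b' ^ n \<noteq> 1"
    by metis
  define bad where "bad = {0} \<union> (\<Union>b\<in>B. \<Union>m\<in>{1..K}. \<Union>n\<in>{1..K}.
     {z. z ^ m = l b ^ n} \<union> {z. z ^ m = inverse (l b ^ n)})"
  have "finite bad"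
    unfolding bad_def using insert.hyps by (intro finite_UnI finite_UN_I finite_power_eq) auto
  then obtain z where z: "z \<notin> bad" using assms(1) by (metis ex_new_if_finite)
  have z0: "z \<noteq> 0" using z by (auto simp: bad_def)
  have z1: "z ^ m \<noteq> l b ^ n \<and> z ^ m * l b ^ n \<noteq> 1" if "b \<in> B" "m \<in> {1..K}" "n \<in> {1..K}" for b m n
  proof -
    have "z ^ m \<noteq> l b ^ n" "z ^ m \<noteq> inverse (l b ^ n)" using z that unfolding bad_def by blast+
    moreover have "l b ^ n \<noteq> 0" using l(1) that by simp
    ultimately show ?thesis by (metis inverse_unique mult.commute)
  qed
  let ?l = "l(a := z)"
  show ?case
  proof (intro exI[of _ ?l] conjI ballI impI)
    fix b assume "b \<in> insert a B"
    then show "?l b \<noteq> 0" using z0 l(1) by auto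
    fix b' m n assume "b' \<in> insert a B" "b \<noteq> b'" "m \<in> {1..K}" "n \<in> {1..K}"
    then have "?l b ^ m \<noteq> ?l b' ^ n \<and> ?l b ^ m * ?l b' ^ n \<noteq> 1"
      using \<open>b \<in> insert a B\<close> l(2)[of b b' m n] z1[of b' m n] z1[of b n m] insert.hyps
      by (cases "b = a"; cases "b' = a") (auto simp: mult.commute)
    then show "?l b ^ m \<noteq> ?l b' ^ n" "?l b ^ m * ?l b' ^ n \<noteq> 1" by auto
  qed
qed simp

section \<open>Surjectivity of the tangent map by duality\<close>

text \<open>Finite-dimensional duality for functions of which only the values on \<open>I\<close>
  count. The induction adds one coordinate \<open>j\<close>: it suffices to find an element of
  \<open>W\<close> that vanishes on \<open>I\<close> but not at \<open>j\<close>.\<close>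

lemma subspace_full_if_no_annihilator:
  fixes W :: "('i \<Rightarrow> 'k::field) set"
  assumes "finite I"
    and zero: "(\<lambda>_. 0) \<in> W"
    and add: "\<And>y y'. y \<in> W \<Longrightarrow> y' \<in> W \<Longrightarrow> (\<lambda>i. y i + y' i) \<in> W"
    and scale: "\<And>k y. y \<in> W \<Longrightarrow> (\<lambda>i. k * y i) \<in> W"
    and ann: "\<And>u. \<forall>y\<in>W. (\<Sum>i\<in>I. u i * y i) = 0 \<Longrightarrow> \<forall>i\<in>I. u i = 0"
  shows "\<exists>y\<in>W. \<forall>i\<in>I. y i = t i"
  using assms(1) ann
proof (induction I arbitrary: t)
  case empty
  then show ?case using zero by auto
next
  case (insert j I)
  have IH: "\<exists>y\<in>W. \<forall>i\<in>I. y i = t i" for t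
  proof (rule insert.IH)
    fix u assume u: "\<forall>y\<in>W. (\<Sum>i\<in>I. u i * y i) = 0"
    have "(\<Sum>i\<in>insert j I. (u(j := 0)) i * y i) = (\<Sum>i\<in>I. u i * y i)" for y
      using insert.hyps by (simp, intro sum.cong) auto
    then have "\<forall>i\<in>insert j I. (u(j := 0)) i = 0" using u by (intro insert.prems) simp
    then show "\<forall>i\<in>I. u i = 0" using insert.hyps by (auto split: if_splits)
  qed
  have "\<forall>i. \<exists>y\<in>W. \<forall>i'\<in>I. y i' = (if i' = i then 1 else 0)" by (intro allI IH)
  then obtain Y where Y: "\<And>i. Y i \<in> W" "\<And>i i'. i' \<in> I \<Longrightarrow> Y i i' = (if i' = i then 1 else 0)" by metis
  have sum_W: "(\<lambda>x. \<Sum>i\<in>A. k i * Y i x) \<in> W" for k A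
    by (induction A rule: infinite_finite_induct) (use zero add scale Y(1) in auto)
  have "\<exists>y\<in>W. (\<forall>i\<in>I. y i = 0) \<and> y j \<noteq> 0"
  proof (rule ccontr)
    assume no: "\<not> (\<exists>y\<in>W. (\<forall>i\<in>I. y i = 0) \<and> y j \<noteq> 0)"
    \<comment> \<open>If there were no such element, then the value at \<open>j\<close> would be a
      linear combination of the values on \<open>I\<close>, with coefficients read off from the dual
      family \<open>Y\<close>; this relation is an annihilator with coefficient 1 at
      \<open>j\<close>.\<close>
    define u where "u i = (if i = j then 1 else - Y i j)" for i
    have "(\<Sum>i\<in>insert j I. u i * y i) = 0" if y: "y \<in> W" for y
    proof -
      define y' where "y' = (\<lambda>x. y x + (- 1) * (\<Sum>i\<in>I. y i * Y i x))"
      have "y' \<in> W" unfolding y'_def using add[OF y scale[OF sum_W, of "- 1" y I]] by simp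
      moreover have "y' x = 0" if "x \<in> I" for x
      proof -
        have "(\<Sum>i\<in>I. y i * Y i x) = (\<Sum>i\<in>I. if i = x then y i else 0)"
          by (rule sum.cong) (auto simp: Y(2) that)
        then show ?thesis using that insert.hyps by (simp add: y'_def)
      qed
      ultimately have "y' j = 0" using no by blast
      then have "y j = (\<Sum>i\<in>I. y i * Y i j)" by (simp add: y'_def)
      moreover have "(\<Sum>i\<in>I. u i * y i) = - (\<Sum>i\<in>I. y i * Y i j)"
        unfolding sum_negf[symmetric] using insert.hyps by (intro sum.cong) (auto simp: u_def)
      ultimately show ?thesis using insert.hyps by (simp add: u_def)
    qed
    then have "u j = 0" using insert.prems[of u] by blast
    then show False by (simp add: u_def)
  qed
  then obtain y0 where y0: "y0 \<in> W" "\<forall>i\<in>I. y0 i = 0" "y0 j \<noteq> 0" by blast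
  obtain y where y: "y \<in> W" "\<forall>i\<in>I. y i = t i" using IH by blast
  let ?y = "\<lambda>i. y i + (t j - y j) / y0 j * y0 i"
  have "?y \<in> W" using add[OF y(1) scale[OF y0(1)]] .
  moreover have "\<forall>i\<in>insert j I. ?y i = t i" using y y0 by auto
  ultimately show ?case by (intro bexI[of _ ?y])
qed

context updown_choice
begin

text \<open>\<open>z v w \<sigma>\<close> is the entry in row \<open>v\<close> and column \<open>w\<close> of the component at side \<open>\<sigma>\<close> of an
  endomorphism of the module.\<close>

definition endo :: "(('v \<times> nat) set \<Rightarrow> 'k::field) \<Rightarrow> ('v \<times> nat \<Rightarrow> 'v \<times> nat \<Rightarrow> bool \<Rightarrow> 'k) \<Rightarrow> bool" where
  "endo l z \<longleftrightarrow>
     (\<forall>e\<in>arcs \<Gamma>. \<forall>e'\<in>arcs \<Gamma>. fst e = fst e' \<longrightarrow>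
        z (head \<Gamma> e') (head \<Gamma> e) (hs (fst e)) * edge_weight \<Theta> l e
          = edge_weight \<Theta> l e' * z (tail \<Gamma> e') (tail \<Gamma> e) (ts (fst e))) \<and>
     (\<forall>e\<in>arcs \<Gamma>. \<forall>v. (v, hs (fst e)) \<notin> hdart ` arcs \<Gamma> \<longrightarrow> z v (head \<Gamma> e) (hs (fst e)) = 0) \<and>
     (\<forall>e\<in>arcs \<Gamma>. \<forall>w. (w, ts (fst e)) \<notin> tdart ` arcs \<Gamma> \<longrightarrow> z (tail \<Gamma> e) w (ts (fst e)) = 0)"

text \<open>A base change at a vertex acts equally on both sides, so modulo base changes only the
  difference of the two sides remains. The second summand is the variation of the parameters, placed
  at the diagonal entries of the chosen targets.\<close>

definition tangent :: "('v \<times> nat \<Rightarrow> 'v \<times> nat \<Rightarrow> bool \<Rightarrow> 'k::field) \<Rightarrow> ('v \<times> nat \<Rightarrow> 'k) \<Rightarrow> ('v \<times> nat) \<times> ('v \<times> nat) \<Rightarrow> 'k" where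
  "tangent z \<tau> = (\<lambda>(v, w). z v w True - z v w False + (if v = w \<and> v \<in> \<Theta> ` bands \<Gamma> then \<tau> v else 0))"

text \<open>An elementary endomorphism taking \<open>e\<close> to \<open>e'\<close>, with one entry
  at the tails and one at the heads. The weights are placed crosswise so that the two entries
  intertwine; uniqueness of the edge at a dart keeps all other conditions untouched.\<close>

lemma endo_linked:
  assumes e: "e \<in> arcs \<Gamma>" "e' \<in> arcs \<Gamma>" "fst e = fst e'"
  shows "endo l (\<lambda>v w \<sigma>. if (v, \<sigma>) = tdart e' \<and> (w, \<sigma>) = tdart e then edge_weight \<Theta> l e
     else if (v, \<sigma>) = hdart e' \<and> (w, \<sigma>) = hdart e then edge_weight \<Theta> l e' else 0)" (is "endo l ?z")
proof -
  have darts: "(tail \<Gamma> f, ts (fst f)) = tdart f" "(head \<Gamma> f, hs (fst f)) = hdart f" for f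
    by (simp_all add: tdart_def hdart_def)
  have th: "(tdart f = tdart g) = (f = g)" "(hdart f = hdart g) = (f = g)" "hdart f \<noteq> tdart g" "tdart f \<noteq> hdart g"
    if "f \<in> arcs \<Gamma>" "g \<in> arcs \<Gamma>" for f g
    using that inj_tdart inj_hdart tdart_neq_hdart[OF that] tdart_neq_hdart[OF that(2,1)]
    by (auto simp: inj_on_def)
  have fst_eq: "hs (fst f) = hs (fst f')" "ts (fst f) = ts (fst f')" if "fst f = fst f'" for f f' :: "'a \<times> nat"
    using that by auto
  show ?thesis
    unfolding endo_def
  proof (intro conjI ballI allI impI)
    fix f f' assume f: "f \<in> arcs \<Gamma>" "f' \<in> arcs \<Gamma>" "fst f = fst f'"
    have h': "(head \<Gamma> f', hs (fst f)) = hdart f'" "(tail \<Gamma> f', ts (fst f)) = tdart f'"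
      using f(3) by (simp_all add: tdart_def hdart_def)
    show "?z (head \<Gamma> f') (head \<Gamma> f) (hs (fst f)) * edge_weight \<Theta> l f
          = edge_weight \<Theta> l f' * ?z (tail \<Gamma> f') (tail \<Gamma> f) (ts (fst f))"
      unfolding darts h' using e f by (auto simp: th)
  next
    fix f v assume f: "f \<in> arcs \<Gamma>" "(v, hs (fst f)) \<notin> hdart ` arcs \<Gamma>"
    then show "?z v (head \<Gamma> f) (hs (fst f)) = 0"
      unfolding darts using e by (auto simp: th)
  next
    fix f w assume f: "f \<in> arcs \<Gamma>" "(w, ts (fst f)) \<notin> tdart ` arcs \<Gamma>"
    then show "?z (tail \<Gamma> f) w (ts (fst f)) = 0"
      unfolding darts using e by (auto simp: th)
  qed
qed

text \<open>The conditions in \<open>endo\<close> concern only entries whose column is a head or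
  whose row is a tail on the given side, so any other single entry is unconstrained.\<close>

lemma endo_free:
  assumes "(v, \<sigma>) \<notin> tdart ` arcs \<Gamma>" "(w, \<sigma>) \<notin> hdart ` arcs \<Gamma>"
  shows "endo (l :: _ \<Rightarrow> 'b::field) (\<lambda>v' w' \<sigma>'. if v' = v \<and> w' = w \<and> \<sigma>' = \<sigma> then 1 else 0)"
proof -
  have 1: "\<not> (head \<Gamma> e = w \<and> hs (fst e) = \<sigma>)" if "e \<in> arcs \<Gamma>" for e
    using assms(2) imageI[OF that, of hdart] by (auto simp: hdart_def)
  have 2: "\<not> (tail \<Gamma> e = v \<and> ts (fst e) = \<sigma>)" if "e \<in> arcs \<Gamma>" for e
    using assms(1) imageI[OF that, of tdart] by (auto simp: tdart_def)
  show ?thesis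
    unfolding endo_def
  proof (intro conjI ballI allI impI)
    fix e e' assume e: "e \<in> arcs \<Gamma>" "e' \<in> arcs \<Gamma>" "fst e = fst e'"
    have "\<not> (head \<Gamma> e = w \<and> hs (fst e) = \<sigma>)" "\<not> (tail \<Gamma> e' = v \<and> ts (fst e) = \<sigma>)"
      using 1[OF e(1)] 2[OF e(2)] e(3) by auto
    then show "(if head \<Gamma> e' = v \<and> head \<Gamma> e = w \<and> hs (fst e) = \<sigma> then 1 else 0) * edge_weight \<Theta> l e
        = edge_weight \<Theta> l e' * (if tail \<Gamma> e' = v \<and> tail \<Gamma> e = w \<and> ts (fst e) = \<sigma> then 1 else 0)"
      by auto
  next
    fix e v' assume "e \<in> arcs \<Gamma>"
    then show "(if v' = v \<and> head \<Gamma> e = w \<and> hs (fst e) = \<sigma> then 1 else 0) = (0 :: 'b)" using 1 by simp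
  next
    fix e w' assume "e \<in> arcs \<Gamma>"
    then show "(if tail \<Gamma> e = v \<and> w' = w \<and> ts (fst e) = \<sigma> then 1 else 0) = (0 :: 'b)" using 2 by simp
  qed
qed

lemma endo_add: "endo l z \<Longrightarrow> endo l z' \<Longrightarrow> endo l (\<lambda>v w \<sigma>. z v w \<sigma> + z' v w \<sigma>)"
  by (simp add: endo_def distrib_left distrib_right)

lemma endo_scale: "endo l z \<Longrightarrow> endo l (\<lambda>v w \<sigma>. k * z v w \<sigma>)"
  by (simp add: endo_def mult.assoc mult.left_commute)

lemma endo_zero: "endo l (\<lambda>v w \<sigma>. 0)"
  by (simp add: endo_def)

lemma tangent_zero: "tangent (\<lambda>v w \<sigma>. 0) (\<lambda>_. 0) = (\<lambda>_. 0)"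
  by (auto simp: tangent_def fun_eq_iff)

lemma tangent_add: "tangent (\<lambda>v w \<sigma>. z v w \<sigma> + z' v w \<sigma>) (\<lambda>v. \<tau> v + \<tau>' v) = (\<lambda>i. tangent z \<tau> i + tangent z' \<tau>' i)"
  by (rule ext) (auto simp: tangent_def)

lemma tangent_scale: "tangent (\<lambda>v w \<sigma>. k * z v w \<sigma>) (\<lambda>v. k * \<tau> v) = (\<lambda>i. k * tangent z \<tau> i)"
  by (rule ext) (auto simp: tangent_def algebra_simps)

text \<open>By duality it suffices that every annihilator \<open>u\<close> of the image vanishes.
  Testing \<open>u\<close> on \<open>endo_linked\<close>, on \<open>endo_free\<close> and on the
  variation of one parameter gives the axioms \<open>linked\<close>, \<open>free\<close> and
  \<open>target\<close> of \<open>updown_annihilator\<close>.\<close>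

lemma tangent_surjective:
  fixes l :: "('v \<times> nat) set \<Rightarrow> 'k::field"
  assumes nz: "\<And>b. b \<in> bands \<Gamma> \<Longrightarrow> l b \<noteq> 0"
    and gen: "\<And>b b' m n. b \<in> bands \<Gamma> \<Longrightarrow> b' \<in> bands \<Gamma> \<Longrightarrow> b \<noteq> b' \<Longrightarrow> m \<in> {1..2 * card (verts \<Gamma>)} \<Longrightarrow>
      n \<in> {1..2 * card (verts \<Gamma>)} \<Longrightarrow> l b ^ m \<noteq> l b' ^ n \<and> l b ^ m * l b' ^ n \<noteq> 1"
  shows "\<exists>z \<tau>. endo l z \<and> (\<forall>v\<in>verts \<Gamma>. \<forall>w\<in>verts \<Gamma>. fst v = fst w \<longrightarrow> tangent z \<tau> (v, w) = y (v, w))"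
proof -
  define I where "I = {(v, w). v \<in> verts \<Gamma> \<and> w \<in> verts \<Gamma> \<and> fst v = fst w}"
  define W where "W = {tangent z \<tau> | z \<tau>. endo l z}"
  have "I \<subseteq> verts \<Gamma> \<times> verts \<Gamma>" by (auto simp: I_def)
  then have finI: "finite I" using finite_verts by (meson finite_SigmaI finite_subset)
  have "\<exists>y'\<in>W. \<forall>i\<in>I. y' i = y i"
  proof (rule subspace_full_if_no_annihilator[OF finI])
    show "(\<lambda>_. 0) \<in> W" unfolding W_def tangent_zero[symmetric] using endo_zero by blast
  next
    fix y y' assume "y \<in> W" "y' \<in> W"
    then obtain z \<tau> z' \<tau>' where "y = tangent z \<tau>" "endo l z" "y' = tangent z' \<tau>'" "endo l z'"
      by (auto simp: W_def)
    then show "(\<lambda>i. y i + y' i) \<in> W" unfolding W_def using endo_add tangent_add[symmetric] by blast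
  next
    fix y k assume "y \<in> W"
    then obtain z \<tau> where "y = tangent z \<tau>" "endo l z"
      by (auto simp: W_def)
    then show "(\<lambda>i. k * y i) \<in> W" unfolding W_def using endo_scale tangent_scale[symmetric] by blast
  next
    fix u assume u: "\<forall>y\<in>W. (\<Sum>i\<in>I. u i * y i) = 0"
    have ann: "(\<Sum>i\<in>I. u i * tangent z \<tau> i) = 0" if "endo l z" for z \<tau>
      using u that by (auto simp: W_def)
    have delta: "(\<Sum>i\<in>I. u i * (if i = p then k else 0)) = u p * k" if "p \<in> I" for p k
    proof -
      have "(\<Sum>i\<in>I. u i * (if i = p then k else 0)) = (\<Sum>i\<in>I. if i = p then u p * k else 0)"
        by (rule sum.cong) auto
      then show ?thesis using that finI by simp
    qed
    interpret updown_annihilator Q c \<beta> r \<epsilon> \<Theta> l "\<lambda>v w. u (v, w)"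
    proof
      fix e e' assume e: "e \<in> arcs \<Gamma>" "e' \<in> arcs \<Gamma>" "fst e = fst e'"
      let ?z = "\<lambda>v w \<sigma>. if (v, \<sigma>) = tdart e' \<and> (w, \<sigma>) = tdart e then edge_weight \<Theta> l e
          else if (v, \<sigma>) = hdart e' \<and> (w, \<sigma>) = hdart e then edge_weight \<Theta> l e' else 0"
      define p q where "p = (tail \<Gamma> e', tail \<Gamma> e)" and "q = (head \<Gamma> e', head \<Gamma> e)"
      have z: "?z v w \<sigma> = (if (v, w) = p \<and> \<sigma> = ts (fst e) then edge_weight \<Theta> l e
          else if (v, w) = q \<and> \<sigma> = hs (fst e) then edge_weight \<Theta> l e' else 0)" for v w \<sigma>
        using e(3) by (auto simp: tdart_def hdart_def p_def q_def)
      \<comment> \<open>The two entries may share their position in the matrix; they then lie on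
        different sides, so both contribute.\<close>
      have ne: "p = q \<Longrightarrow> ts (fst e) \<noteq> hs (fst e)" 
        using tail_head_dart[OF e(1) e(1)] by (simp add: p_def q_def)
      have "tangent ?z (\<lambda>_. 0) = (\<lambda>i. (if i = p then side_sign (ts (fst e)) * edge_weight \<Theta> l e else 0)
          + (if i = q then side_sign (hs (fst e)) * edge_weight \<Theta> l e' else 0))"
      proof (rule ext)
        fix i :: "('v \<times> nat) \<times> ('v \<times> nat)"
        obtain v w where i: "i = (v, w)" by (cases i)
        show "tangent ?z (\<lambda>_. 0) i = (if i = p then side_sign (ts (fst e)) * edge_weight \<Theta> l e else 0)
          + (if i = q then side_sign (hs (fst e)) * edge_weight \<Theta> l e' else 0)"
          unfolding i tangent_def prod.case z unfolding i[symmetric] using ne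
          by (cases "i = p"; cases "i = q"; cases "ts (fst e)"; cases "hs (fst e)") simp_all
      qed
      then have "tangent ?z (\<lambda>_. 0) = (\<lambda>i. (if i = (tail \<Gamma> e', tail \<Gamma> e) then side_sign (ts (fst e)) * edge_weight \<Theta> l e else 0)
          + (if i = (head \<Gamma> e', head \<Gamma> e) then side_sign (hs (fst e)) * edge_weight \<Theta> l e' else 0))"
        unfolding p_def q_def .
      moreover have "(tail \<Gamma> e', tail \<Gamma> e) \<in> I" "(head \<Gamma> e', head \<Gamma> e) \<in> I"
      proof -
        have "fst (tail \<Gamma> e') = fst (tail \<Gamma> e)" "fst (head \<Gamma> e') = fst (head \<Gamma> e)"
          using e(3) by (cases e; cases e'; simp add: tail_graph head_graph)+
        then show "(tail \<Gamma> e', tail \<Gamma> e) \<in> I" "(head \<Gamma> e', head \<Gamma> e) \<in> I"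
          using tail_in_verts[OF e(1)] tail_in_verts[OF e(2)] head_in_verts[OF e(1)] head_in_verts[OF e(2)]
          by (simp_all add: I_def)
      qed
      ultimately show "side_sign (ts (fst e)) * edge_weight \<Theta> l e * u (tail \<Gamma> e', tail \<Gamma> e)
        + side_sign (hs (fst e)) * edge_weight \<Theta> l e' * u (head \<Gamma> e', head \<Gamma> e) = 0"
        using ann[OF endo_linked[OF e], of "\<lambda>_. 0"] by (simp add: distrib_left sum.distrib delta mult.commute)
    next
      fix v w :: "'v \<times> nat" and \<sigma>
      assume vw: "v \<in> verts \<Gamma>" "w \<in> verts \<Gamma>" "fst v = fst w"
        and "(v, \<sigma>) \<notin> tdart ` arcs \<Gamma>" "(w, \<sigma>) \<notin> hdart ` arcs \<Gamma>"
      then have "(\<Sum>i\<in>I. u i * tangent (\<lambda>v' w' \<sigma>'. if v' = v \<and> w' = w \<and> \<sigma>' = \<sigma> then 1 else 0) (\<lambda>_. 0) i) = 0"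
        by (intro ann endo_free)
      moreover have "tangent (\<lambda>v' w' \<sigma>'. if v' = v \<and> w' = w \<and> \<sigma>' = \<sigma> then 1 else 0) (\<lambda>_. 0)
          = (\<lambda>i. if i = (v, w) then side_sign \<sigma> else 0 :: 'k)"
        by (auto simp: tangent_def fun_eq_iff side_sign_def)
      moreover have "(v, w) \<in> I" using vw by (simp add: I_def)
      ultimately show "u (v, w) = 0" by (simp add: delta)
    next
      fix b assume b: "b \<in> bands \<Gamma>"
      have "tangent (\<lambda>v w \<sigma>. 0) (\<lambda>v. if v = \<Theta> b then 1 else 0) = (\<lambda>i. if i = (\<Theta> b, \<Theta> b) then 1 else 0 :: 'k)"
      proof (rule ext)
        fix i :: "('v \<times> nat) \<times> ('v \<times> nat)"
        show "tangent (\<lambda>v w \<sigma>. 0) (\<lambda>v. if v = \<Theta> b then 1 else 0) i = (if i = (\<Theta> b, \<Theta> b) then 1 else 0 :: 'k)"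
          using b unfolding tangent_def by (cases "fst i = \<Theta> b"; cases "snd i = \<Theta> b"; simp add: case_prod_beta prod_eq_iff[of i])
      qed
      moreover have "(\<Theta> b, \<Theta> b) \<in> I" using choice_in_verts[OF b] by (simp add: I_def)
      ultimately show "u (\<Theta> b, \<Theta> b) = 0"
        using ann[OF endo_zero, of "\<lambda>v. if v = \<Theta> b then 1 else 0"] by (simp add: delta)
    qed (use nz gen in auto)
    show "\<forall>i\<in>I. u i = 0" using annihilator_zero by (auto simp: I_def)
  qed
  then show ?thesis unfolding W_def I_def by blast
qed

end

section \<open>Adapted bases\<close>

text \<open>Vectors of all lengths are functions on all natural numbers, so that one
  \<open>vector_space\<close> serves every vertex; \<open>coord_space n\<close> singles out those of
  length \<open>n\<close>.\<close>

definition fscale :: "'k::field \<Rightarrow> (nat \<Rightarrow> 'k) \<Rightarrow> nat \<Rightarrow> 'k" where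
  "fscale k v = (\<lambda>i. k * v i)"

lemma vector_space_fscale: "vector_space (fscale :: 'k::field \<Rightarrow> _)"
  by unfold_locales (auto simp: fscale_def fun_eq_iff algebra_simps)

lemma fscale_apply [simp]: "fscale k v i = k * v i"
  by (simp add: fscale_def)

lemma fun_sum_apply: "(\<Sum>i\<in>A. f i) x = (\<Sum>i\<in>A. f i (x :: nat) :: 'k::field)"
  by (induction A rule: infinite_finite_induct) auto

definition coord_space :: "nat \<Rightarrow> (nat \<Rightarrow> 'k::field) set" where
  "coord_space n = {v. \<forall>i\<ge>n. v i = 0}"

definition unit_fun :: "nat \<Rightarrow> nat \<Rightarrow> 'k::field" where
  "unit_fun j = (\<lambda>i. if i = j then 1 else 0)"

definition apply_mat :: "'k::field mat \<Rightarrow> (nat \<Rightarrow> 'k) \<Rightarrow> nat \<Rightarrow> 'k" where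
  "apply_mat A v = (\<lambda>i. if i < dim_row A then (\<Sum>j<dim_col A. A $$ (i, j) * v j) else 0)"

lemma apply_mat_add: "apply_mat A (v + w) = apply_mat A v + apply_mat A w"
  by (auto simp: apply_mat_def fun_eq_iff distrib_left sum.distrib)

lemma apply_mat_scale: "apply_mat A (fscale k v) = fscale k (apply_mat A v)"
  by (auto simp: apply_mat_def fun_eq_iff sum_distrib_left mult.left_commute intro!: sum.cong)

lemma apply_mat_zero: "apply_mat A 0 = 0"
  by (auto simp: apply_mat_def fun_eq_iff)

lemma apply_mat_sum: "apply_mat A (\<Sum>i\<in>I. fscale (c i) (v i)) = (\<Sum>i\<in>I. fscale (c i) (apply_mat A (v i)))"
  by (induction I rule: infinite_finite_induct)
    (simp_all only: apply_mat_add apply_mat_scale apply_mat_zero sum.infinite sum.empty sum.insert not_False_eq_True)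

lemma apply_mat_unit: "j < dim_col A \<Longrightarrow> i < dim_row A \<Longrightarrow> apply_mat A (unit_fun j) i = A $$ (i, j)"
  by (simp add: apply_mat_def unit_fun_def if_distrib[of "\<lambda>x. _ * x"] cong: if_cong)

lemma coord_space_expansion:
  assumes "v \<in> coord_space n" shows "v = (\<Sum>j<n. fscale (v j) (unit_fun j))"
proof
  fix i
  have "(\<Sum>j<n. fscale (v j) (unit_fun j)) i = (\<Sum>j<n. if j = i then v i else 0)"
    unfolding fun_sum_apply by (rule sum.cong) (auto simp: unit_fun_def)
  then show "v i = (\<Sum>j<n. fscale (v j) (unit_fun j)) i"
    using assms by (auto simp: coord_space_def not_less)
qed

definition indep_family :: "nat \<Rightarrow> (nat \<Rightarrow> nat \<Rightarrow> 'k::field) \<Rightarrow> bool" where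
  "indep_family m v \<longleftrightarrow> (\<forall>c. (\<Sum>i<m. fscale (c i) (v i)) = 0 \<longrightarrow> (\<forall>i<m. c i = 0))"

lemma indep_familyD: "indep_family m v \<Longrightarrow> (\<Sum>i<m. fscale (c i) (v i)) = 0 \<Longrightarrow> i < m \<Longrightarrow> c i = 0"
  unfolding indep_family_def by blast

lemma unit_fun_in_coord_space: "j < n \<Longrightarrow> unit_fun j \<in> coord_space n"
  by (auto simp: coord_space_def unit_fun_def)

lemma indep_family_inj:
  assumes "indep_family m v" shows "inj_on v {..<m}"
proof (rule inj_onI, rule ccontr)
  fix i j assume ij: "i \<in> {..<m}" "j \<in> {..<m}" "v i = v j" "i \<noteq> j"
  define c :: "nat \<Rightarrow> 'a" where "c k = (if k = i then 1 else if k = j then - 1 else 0)" for k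
  have "(\<Sum>k<m. fscale (c k) (v k)) x = 0" for x
  proof -
    have "(\<Sum>k<m. fscale (c k) (v k)) x = (\<Sum>k<m. (if k = i then v i x else 0) + (if k = j then - v i x else 0))"
      unfolding fun_sum_apply using ij by (intro sum.cong) (auto simp: c_def)
    then show ?thesis using ij by (simp add: sum.distrib)
  qed
  then have "(\<Sum>k<m. fscale (c k) (v k)) = 0" by (simp add: fun_eq_iff)
  then have "c i = 0" using assms ij unfolding indep_family_def by blast
  then show False by (simp add: c_def)
qed

lemma indep_family_independent:
  assumes "indep_family m v" shows "\<not> Modules.module.dependent fscale (v ` {..<m})"
proof -
  interpret vector_space "fscale :: 'a \<Rightarrow> _" by (rule vector_space_fscale)
  show ?thesis
  proof (rule independent_if_scalars_zero)
    fix f x assume f: "(\<Sum>x\<in>v ` {..<m}. fscale (f x) x) = 0" and x: "x \<in> v ` {..<m}"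
    have "(\<Sum>i<m. fscale (f (v i)) (v i)) = 0"
      using f by (simp add: sum.reindex[OF indep_family_inj[OF assms]])
    then have "f (v i) = 0" if "i < m" for i
      using indep_familyD[OF assms, of "\<lambda>i. f (v i)"] that by blast
    then show "f x = 0" using x by auto
  qed simp
qed

lemma independent_indep_family:
  assumes "inj_on v {..<m}" "\<not> Modules.module.dependent fscale (v ` {..<m})" shows "indep_family m v"
proof -
  interpret vector_space "fscale :: 'a \<Rightarrow> _" by (rule vector_space_fscale)
  show ?thesis
    unfolding indep_family_def
  proof (intro allI impI)
    fix c i assume c: "(\<Sum>i<m. fscale (c i) (v i)) = 0" and i: "i < m"
    let ?f = "\<lambda>x. c (the_inv_into {..<m} v x)"
    have "(\<Sum>x\<in>v ` {..<m}. fscale (?f x) x) = (\<Sum>i<m. fscale (c i) (v i))"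
      by (subst sum.reindex[OF assms(1)]) (auto simp: the_inv_into_f_f[OF assms(1)] intro!: sum.cong)
    then have "?f (v i) = 0"
      using independentD[OF assms(2), of "v ` {..<m}" ?f "v i"] c i by auto
    then show "c i = 0" using i by (simp add: the_inv_into_f_f[OF assms(1)])
  qed
qed

lemma indep_family_unit_fun: "indep_family n unit_fun"
  unfolding indep_family_def
proof (intro allI impI)
  fix c :: "nat \<Rightarrow> 'a" and i assume c: "(\<Sum>j<n. fscale (c j) (unit_fun j)) = 0" and i: "i < n"
  have "(\<Sum>j<n. fscale (c j) (unit_fun j)) i = (\<Sum>j<n. if j = i then c i else 0)"
    unfolding fun_sum_apply by (rule sum.cong) (auto simp: unit_fun_def)
  then show "c i = 0" using c i by simp
qed

lemma in_span_family:
  fixes v :: "nat \<Rightarrow> nat \<Rightarrow> 'a::field"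
  assumes "x \<in> Modules.module.span fscale (v ` {..<m})" "inj_on v {..<m}"
  shows "\<exists>c. x = (\<Sum>i<m. fscale (c i) (v i))"
proof -
  interpret vector_space "fscale :: 'a \<Rightarrow> _" by (rule vector_space_fscale)
  have "span (v ` {..<m}) = range (\<lambda>f. \<Sum>y\<in>v ` {..<m}. fscale (f y) y)"
    by (rule span_finite) simp
  with assms(1) obtain f where "x = (\<Sum>y\<in>v ` {..<m}. fscale (f y) y)" by blast
  then have "x = (\<Sum>i<m. fscale (f (v i)) (v i))" by (simp add: sum.reindex[OF assms(2)])
  then show ?thesis by (rule exI[where x = "\<lambda>i. f (v i)"])
qed

text \<open>A maximal independent set of columns spans the image, and the corresponding unit vectors
  are the \<open>u i\<close>. The upper bound for \<open>k\<close> is what lets the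
  \<open>u i\<close> be placed among the \<open>r a\<close> edge positions.\<close>

lemma rank_image_basis:
  fixes A :: "'k::field mat"
  assumes A: "A \<in> carrier_mat n' n"
  obtains k u where "k \<le> vec_space.rank n' A" "\<And>i. i < k \<Longrightarrow> u i \<in> coord_space n"
    "indep_family k (\<lambda>i. apply_mat A (u i))"
    "\<And>v. v \<in> coord_space n \<Longrightarrow> \<exists>c. apply_mat A v = (\<Sum>i<k. fscale (c i) (apply_mat A (u i)))"
proof -
  interpret V: vector_space "fscale :: 'k \<Rightarrow> _" by (rule vector_space_fscale)
  interpret vec_space "TYPE('k)" n' .
  have dims: "dim_row A = n'" "dim_col A = n" using A by auto
  let ?C = "\<lambda>j. apply_mat A (unit_fun j)"
  obtain B where B: "B \<subseteq> ?C ` {..<n}" "V.independent B" "?C ` {..<n} \<subseteq> V.span B"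
    by (rule V.maximal_independent_subset)
  have finB: "finite B" using B(1) finite_subset by blast
  obtain b where b: "bij_betw b {..<card B} B"
    using ex_bij_betw_nat_finite[OF finB] by (auto simp: atLeast0LessThan)
  have "\<forall>i\<in>{..<card B}. \<exists>j<n. b i = ?C j" using b B(1) by (auto simp: bij_betw_def)
  then obtain J where J: "\<And>i. i < card B \<Longrightarrow> J i < n \<and> b i = ?C (J i)" by (metis lessThan_iff)
  have bB: "b ` {..<card B} = B" "inj_on b {..<card B}" using b by (auto simp: bij_betw_def)
  have ind_b: "indep_family (card B) b"
    by (rule independent_indep_family) (use bB B(2) in auto)
  have ind: "indep_family (card B) (\<lambda>i. apply_mat A (unit_fun (J i)))"
  proof -
    have "(\<Sum>i<card B. fscale (c i) (apply_mat A (unit_fun (J i)))) = (\<Sum>i<card B. fscale (c i) (b i))" for c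
      using J by (intro sum.cong) auto
    then show ?thesis using ind_b unfolding indep_family_def by simp
  qed
  have injJ: "inj_on (\<lambda>i. col A (J i)) {..<card B}"
  proof (rule inj_onI)
    fix i j assume ij: "i \<in> {..<card B}" "j \<in> {..<card B}" "col A (J i) = col A (J j)"
    have "A $$ (x, J i) = A $$ (x, J j)" if "x < n'" for x
      using ij(3) that J ij dims by (metis index_col lessThan_iff)
    then have "?C (J i) x = ?C (J j) x" for x
      using J[of i] J[of j] ij dims by (cases "x < n'") (simp_all add: apply_mat_unit, simp add: apply_mat_def)
    then have "b i = b j" using J ij by (metis ext lessThan_iff)
    then show "i = j" using bB(2) ij by (auto dest: inj_onD)
  qed
  let ?U = "(\<lambda>i. col A (J i)) ` {..<card B}"
  have U: "?U \<subseteq> set (cols A)" using J dims by (auto simp: cols_def)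
  have Uc: "?U \<subseteq> carrier_vec n'" using dims by auto
  have "lin_indpt ?U"
  proof
    assume "lin_dep ?U"
    then obtain a v where a: "lincomb a ?U = 0\<^sub>v n'" "v \<in> ?U" "a v \<noteq> 0"
      using finite_lin_dep[of ?U] Uc by auto
    define c where "c i = a (col A (J i))" for i
    have "(\<Sum>i<card B. fscale (c i) (b i)) x = 0" for x
    proof (cases "x < n'")
      case True
      have "0 = lincomb a ?U $ x" using a(1) True by simp
      also have "\<dots> = (\<Sum>y\<in>?U. a y * y $ x)" by (rule lincomb_index[OF True Uc])
      also have "\<dots> = (\<Sum>i<card B. c i * col A (J i) $ x)"
        by (subst sum.reindex[OF injJ]) (simp add: c_def)
      also have "\<dots> = (\<Sum>i<card B. fscale (c i) (b i) x)"
        using J True dims by (intro sum.cong) (auto simp: apply_mat_unit)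
      finally show ?thesis by (simp add: fun_sum_apply)
    next
      case False
      then show ?thesis using J dims unfolding fun_sum_apply
        by (intro sum.neutral) (auto simp: apply_mat_def)
    qed
    then have "(\<Sum>i<card B. fscale (c i) (b i)) = 0" by (simp add: fun_eq_iff)
    then have "c i = 0" if "i < card B" for i using indep_familyD[OF ind_b] that by blast
    then show False using a(2,3) by (auto simp: c_def)
  qed
  then have "card ?U \<le> rank A" by (rule rank_ge_card_indpt[OF A U])
  then have le: "card B \<le> rank A" by (simp add: card_image[OF injJ])
  have span: "\<exists>c. apply_mat A v = (\<Sum>i<card B. fscale (c i) (apply_mat A (unit_fun (J i))))"
    if v: "v \<in> coord_space n" for v
  proof -
    have "apply_mat A v = apply_mat A (\<Sum>j<n. fscale (v j) (unit_fun j))"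
      using coord_space_expansion[OF v] by simp
    also have "\<dots> = (\<Sum>j<n. fscale (v j) (?C j))" by (rule apply_mat_sum)
    also have "\<dots> \<in> V.span B"
      by (intro V.span_sum V.span_scale) (use B(3) in auto)
    finally have "\<exists>c. apply_mat A v = (\<Sum>i<card B. fscale (c i) (b i))"
      using in_span_family[of _ b "card B"] bB by simp
    moreover have "(\<Sum>i<card B. fscale (c i) (apply_mat A (unit_fun (J i)))) = (\<Sum>i<card B. fscale (c i) (b i))" for c
      using J by (intro sum.cong) auto
    ultimately show ?thesis by simp
  qed
  show ?thesis
    by (rule that[of "card B" "\<lambda>i. unit_fun (J i)"])
      (use le ind span J in \<open>auto simp: unit_fun_in_coord_space\<close>)
qed

text \<open>\<open>w\<close> is a basis of the image of the incoming map and \<open>u\<close> of a complement of the kernel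
  of the outgoing map \<open>A\<close>; they are placed at the prescribed positions \<open>g\<close> and \<open>f\<close>.\<close>

lemma adapted_basis:
  fixes A :: "'k::field mat"
  assumes w: "\<And>i. i < l \<Longrightarrow> w i \<in> coord_space n" "\<And>i. i < l \<Longrightarrow> apply_mat A (w i) = 0" "indep_family l w"
    and u: "\<And>i. i < m \<Longrightarrow> u i \<in> coord_space n" "indep_family m (\<lambda>i. apply_mat A (u i))"
      "\<And>v. v \<in> coord_space n \<Longrightarrow> \<exists>c. apply_mat A v = (\<Sum>i<m. fscale (c i) (apply_mat A (u i)))"
    and f: "inj_on f {..<m}" "f ` {..<m} \<subseteq> {..<n}"
    and g: "inj_on g {..<l}" "g ` {..<l} \<subseteq> {..<n}"
    and fg: "f ` {..<m} \<inter> g ` {..<l} = {}"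
  obtains h q where "\<And>i. i < m \<Longrightarrow> h (f i) = u i" "\<And>i. i < l \<Longrightarrow> h (g i) = w i"
    "\<And>j. j < n \<Longrightarrow> h j \<in> coord_space n" "\<And>j. j < n \<Longrightarrow> j \<notin> f ` {..<m} \<Longrightarrow> apply_mat A (h j) = 0"
    "\<And>i j. i < n \<Longrightarrow> j < n \<Longrightarrow> (\<Sum>k<n. h k i * q k j) = (if i = j then 1 else 0)"
proof -
  interpret V: vector_space "fscale :: 'k \<Rightarrow> _" by (rule vector_space_fscale)
  let ?F = "coord_space n :: (nat \<Rightarrow> 'k) set"
  let ?K = "{v \<in> ?F. apply_mat A v = 0}" and ?U = "u ` {..<m}" and ?W = "w ` {..<l}"
  have W: "?W \<subseteq> ?K" "V.independent ?W" using w indep_family_independent by auto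
  \<comment> \<open>A basis of the kernel of \<open>A\<close> that contains the image vectors
    \<open>w i\<close>.\<close>
  obtain B where B: "?W \<subseteq> B" "B \<subseteq> ?K" "V.independent B" "?K \<subseteq> V.span B"
    by (rule V.maximal_independent_subset_extend[OF W])
  have injU: "inj_on u {..<m}"
    using indep_family_inj[OF u(2)] by (auto simp: inj_on_def)
  have BU: "v \<notin> B" if "v \<in> ?U" for v
  proof
    assume v: "v \<in> B"
    obtain i where i: "i < m" "v = u i" using \<open>v \<in> ?U\<close> by auto
    have "(\<Sum>j<m. fscale (if j = i then 1 else 0) (apply_mat A (u j))) = (\<Sum>j<m. if j = i then apply_mat A (u i) else 0)"
      by (rule sum.cong) (auto simp: fun_eq_iff)
    also have "\<dots> = 0" using v i B(2) by auto
    finally have "(if i = i then 1 else 0) = (0 :: 'k)"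
      by (rule indep_familyD[OF u(2), where c = "\<lambda>j. if j = i then 1 else 0", OF _ i(1)])
    then show False by simp
  qed
  let ?T = "B \<union> ?U"
  have TF: "?T \<subseteq> ?F" using B u by auto
  have span: "?F \<subseteq> V.span ?T"
  proof
    fix v assume v: "v \<in> ?F"
    obtain c where c: "apply_mat A v = (\<Sum>i<m. fscale (c i) (apply_mat A (u i)))" using u(3)[OF v] by blast
    let ?s = "\<Sum>i<m. fscale (c i) (u i)"
    have "apply_mat A (v + fscale (- 1) ?s) = 0"
      unfolding apply_mat_add apply_mat_scale apply_mat_sum c by (simp add: fun_eq_iff)
    moreover have "v + fscale (- 1) ?s \<in> ?F"
      using v u(1) by (auto simp: coord_space_def fun_sum_apply)
    ultimately have "v + fscale (- 1) ?s \<in> V.span ?T"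
      using B(4) V.span_mono[of B ?T] by auto
    moreover have "?s \<in> V.span ?T"
      by (intro V.span_sum V.span_scale V.span_base) auto
    ultimately have "(v + fscale (- 1) ?s) + ?s \<in> V.span ?T" by (rule V.span_add)
    moreover have "(v + fscale (- 1) ?s) + ?s = v" by (simp add: fun_eq_iff)
    ultimately show "v \<in> V.span ?T" by simp
  qed
  \<comment> \<open>The map \<open>A\<close> kills the part of a relation inside \<open>B\<close>
    and keeps the vectors of \<open>?U\<close> independent, so their coefficients vanish first;
    independence of \<open>B\<close> settles the rest.\<close>
  have indep: "V.independent ?T"
    unfolding V.independent_explicit_finite_subsets
  proof (intro allI impI)
    fix S a assume S: "S \<subseteq> ?T" "finite S" and a: "(\<Sum>v\<in>S. fscale (a v) v) = 0"
    have split: "(\<Sum>v\<in>S. fscale (a v) v) = (\<Sum>v\<in>S \<inter> B. fscale (a v) v) + (\<Sum>v\<in>S \<inter> ?U. fscale (a v) v)"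
      using S BU by (subst sum.union_disjoint[symmetric]) (auto intro!: sum.cong)
    define c where "c i = (if u i \<in> S then a (u i) else 0)" for i
    have SU: "(\<Sum>v\<in>S \<inter> ?U. fscale (a v) v) = (\<Sum>i<m. fscale (c i) (u i))"
    proof -
      have "(\<Sum>i<m. fscale (c i) (u i)) = (\<Sum>v\<in>?U. fscale (if v \<in> S then a v else 0) v)"
        by (subst sum.reindex[OF injU]) (simp add: c_def)
      also have "\<dots> = (\<Sum>v\<in>S \<inter> ?U. fscale (a v) v)"
        by (rule sum.mono_neutral_cong_right) (auto simp: fun_eq_iff)
      finally show ?thesis by simp
    qed
    have SB: "apply_mat A (\<Sum>v\<in>S \<inter> B. fscale (a v) v) = 0"
      unfolding apply_mat_sum using B(2) by (intro sum.neutral) (auto simp: fun_eq_iff)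
    have "apply_mat A ((\<Sum>v\<in>S \<inter> B. fscale (a v) v) + (\<Sum>i<m. fscale (c i) (u i))) = 0"
      by (simp only: a[unfolded split SU] apply_mat_zero)
    then have "apply_mat A (\<Sum>i<m. fscale (c i) (u i)) = 0"
      by (simp only: apply_mat_add SB add_0_left)
    then have c0: "c i = 0" if "i < m" for i using indep_familyD[OF u(2)] that unfolding apply_mat_sum by blast
    have aU: "a v = 0" if v: "v \<in> S \<inter> ?U" for v
    proof -
      from v obtain i where "i < m" "v = u i" by blast
      then show ?thesis using c0[of i] v by (simp add: c_def)
    qed
    then have "(\<Sum>v\<in>S \<inter> ?U. fscale (a v) v) = 0" by (intro sum.neutral) (auto simp: fun_eq_iff)
    then have "(\<Sum>v\<in>S \<inter> B. fscale (a v) v) = 0" using a split by simp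
    then have aB: "a v = 0" if "v \<in> S \<inter> B" for v
      using V.independentD[OF B(3), of "S \<inter> B" a v] S that by auto
    show "\<forall>v\<in>S. a v = 0" using aU aB S by auto
  qed
  \<comment> \<open>Comparison with the standard basis shows that \<open>?T\<close> has exactly
    \<open>n\<close> elements.\<close>
  let ?E = "unit_fun ` {..<n} :: (nat \<Rightarrow> 'k) set"
  have E: "V.independent ?E" "card ?E = n"
    using indep_family_independent[OF indep_family_unit_fun]
    by (simp_all add: card_image indep_family_inj[OF indep_family_unit_fun])
  have EF: "?E \<subseteq> ?F" by (auto simp: coord_space_def unit_fun_def)
  have FE: "?F \<subseteq> V.span ?E"
  proof
    fix v assume "v \<in> ?F"
    then have "v = (\<Sum>j<n. fscale (v j) (unit_fun j))" by (rule coord_space_expansion)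
    also have "\<dots> \<in> V.span ?E" by (intro V.span_sum V.span_scale V.span_base) auto
    finally show "v \<in> V.span ?E" .
  qed
  have T1: "finite ?T \<and> card ?T \<le> n"
    using V.independent_span_bound[of ?E ?T] indep TF FE E(2) by auto
  have T2: "n \<le> card ?T"
    using V.independent_span_bound[of ?T ?E] E EF span T1 by auto
  have cT: "card ?T = n" "finite ?T" using T1 T2 by auto
  have injW: "inj_on w {..<l}" using indep_family_inj[OF w(3)] .
  have UW: "?U \<inter> ?W = {}" using BU B(1) by auto
  let ?P = "f ` {..<m}" and ?R = "g ` {..<l}"
  have "card ({..<n} - (?P \<union> ?R)) = n - (m + l)"
    using f g fg by (subst card_Diff_subset) (auto simp: card_Un_disjoint card_image)
  moreover have "card (?T - (?U \<union> ?W)) = n - (m + l)"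
    using B(1) cT UW by (subst card_Diff_subset) (auto simp: card_Un_disjoint card_image injU injW)
  \<comment> \<open>The remaining basis vectors lie in the kernel and fill the remaining positions
    in any order.\<close>
  ultimately obtain \<phi> where \<phi>: "bij_betw \<phi> ({..<n} - (?P \<union> ?R)) (?T - (?U \<union> ?W))"
    using cT(2) by (metis finite_Diff finite_lessThan finite_same_card_bij)
  define h where "h j = (if j \<in> ?P then u (the_inv_into {..<m} f j)
     else if j \<in> ?R then w (the_inv_into {..<l} g j) else \<phi> j)" for j
  have hf: "h (f i) = u i" if "i < m" for i
    using that by (simp add: h_def the_inv_into_f_f[OF f(1)])
  have hg: "h (g i) = w i" if "i < l" for i
    using that fg by (auto simp: h_def the_inv_into_f_f[OF g(1)])
  have hP: "h ` ?P = ?U" using hf by (auto simp: image_iff)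
  have hR: "h ` ?R = ?W" using hg by (auto simp: image_iff)
  have h3: "h ` ({..<n} - (?P \<union> ?R)) = ?T - (?U \<union> ?W)"
    using \<phi> by (auto simp: h_def bij_betw_def image_iff)
  have "{..<n} = ?P \<union> (?R \<union> ({..<n} - (?P \<union> ?R)))" using f g by auto
  then have "h ` {..<n} = h ` ?P \<union> (h ` ?R \<union> h ` ({..<n} - (?P \<union> ?R)))" by (metis image_Un)
  then have hT: "h ` {..<n} = ?T" unfolding hP hR h3 using B(1) by auto
  then have inj: "inj_on h {..<n}" using cT by (intro eq_card_imp_inj_on) auto
  have "\<exists>a. unit_fun j = (\<Sum>k<n. fscale (a k) (h k))" if "j < n" for j
  proof -
    have "unit_fun j \<in> V.span (h ` {..<n})" using EF span that hT by auto
    then show ?thesis by (rule in_span_family[OF _ inj])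
  qed
  then obtain a where a: "\<And>j. j < n \<Longrightarrow> unit_fun j = (\<Sum>k<n. fscale (a j k) (h k))" by metis
  show ?thesis
  proof (rule that[of h "\<lambda>k j. a j k"])
    fix j assume j: "j < n"
    have "h j \<in> ?T" using hT j by auto
    then show "h j \<in> ?F" using TF by auto
    assume nj: "j \<notin> ?P"
    then have "h j \<in> ?W \<union> (?T - (?U \<union> ?W))" using hR h3 j by (cases "j \<in> ?R") auto
    then have "h j \<in> B" using B(1) by auto
    then show "apply_mat A (h j) = 0" using B(2) by auto
  next
    fix i j assume ij: "i < n" "j < n"
    have "unit_fun j i = (\<Sum>k<n. h k i * a j k)"
      using fun_cong[OF a[OF ij(2)], of i] by (simp add: fun_sum_apply mult.commute)
    then show "(\<Sum>k<n. h k i * a j k) = (if i = j then 1 else 0)" by (simp add: unit_fun_def)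
  qed (use hf hg in auto)
qed

section \<open>Matrices\<close>

lemma mat_mult_index:
  assumes "A \<in> carrier_mat n m" "B \<in> carrier_mat m k" "i < n" "j < k"
  shows "(A * B) $$ (i, j) = (\<Sum>t<m. A $$ (i, t) * B $$ (t, j))"
  using assms by (auto simp: scalar_prod_def atLeast0LessThan intro!: sum.cong)

text \<open>The product is a sum of \<open>k\<close> matrices of rank at most one, each a column
  times a row.\<close>

lemma rank_factor_le:
  fixes B C :: "'k::field mat"
  assumes "B \<in> carrier_mat n k" "C \<in> carrier_mat k nc"
  shows "vec_space.rank n (B * C) \<le> k"
proof -
  interpret vec_space "TYPE('k)" n .
  have sums: "rank (mat n nc (\<lambda>(x, y). \<Sum>t<m. f t x * g t y)) \<le> m" for m and f g :: "nat \<Rightarrow> nat \<Rightarrow> 'k"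
  proof (induction m)
    case 0
    have eq: "mat n nc (\<lambda>(x, y). \<Sum>t<0. f t x * g t y) = 0\<^sub>m n nc" by auto
    show ?case unfolding eq by (simp only: rank_0I)
  next
    case (Suc m)
    let ?S = "\<lambda>m. mat n nc (\<lambda>(x, y). \<Sum>t<m. f t x * g t y)"
    let ?R = "mat n nc (\<lambda>(x, y). f m x * g m y)"
    have "?S (Suc m) = ?S m + ?R" by auto
    moreover have "rank (?S m + ?R) \<le> rank (?S m) + rank ?R" by (rule rank_subadditive) auto
    moreover have "rank ?R \<le> 1" by (rule rank_le_1_product_entries[where f = "f m" and g = "g m"]) auto
    ultimately show ?case using Suc by simp
  qed
  have "B * C = mat n nc (\<lambda>(x, y). \<Sum>t<k. B $$ (x, t) * C $$ (t, y))"
    using assms by (intro eq_matI) (auto simp: mat_mult_index[OF assms] simp del: index_mult_mat(1))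
  then show ?thesis by (simp only: sums)
qed

lemma det_polynomial:
  fixes A :: "'p \<Rightarrow> 'k::field mat"
  assumes "\<And>p. A p \<in> carrier_mat n n"
    and "\<And>i j. i < n \<Longrightarrow> j < n \<Longrightarrow> (\<lambda>p. A p $$ (i, j)) \<in> polynomial_functions X"
  shows "(\<lambda>p. det (A p)) \<in> polynomial_functions X"
proof -
  have "(\<lambda>p. det (A p)) = (\<lambda>p. \<Sum>\<pi>\<in>{\<pi>. \<pi> permutes {0..<n}}. signof \<pi> * (\<Prod>i\<in>{0..<n}. A p $$ (i, \<pi> i)))"
    using assms(1) by (auto simp: det_def')
  also have "\<dots> \<in> polynomial_functions X"
  proof (intro polynomial_functions_sum polynomial_functions.mult polynomial_functions.const
        polynomial_functions_prod assms(2))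
    fix \<pi> i assume "\<pi> \<in> {\<pi>. \<pi> permutes {0..<n}}" "i \<in> {0..<n}"
    then show "i < n" "\<pi> i < n" using permutes_in_image[of \<pi> "{0..<n}" i] by auto
  qed
  finally show ?thesis .
qed

lemma adj_mat_polynomial:
  fixes A :: "'p \<Rightarrow> 'k::field mat"
  assumes A: "\<And>p. A p \<in> carrier_mat n n"
    and poly: "\<And>i j. i < n \<Longrightarrow> j < n \<Longrightarrow> (\<lambda>p. A p $$ (i, j)) \<in> polynomial_functions X"
    and ij: "i < n" "j < n"
  shows "(\<lambda>p. adj_mat (A p) $$ (i, j)) \<in> polynomial_functions X"
proof -
  have "(\<lambda>p. adj_mat (A p) $$ (i, j)) = (\<lambda>p. (- 1) ^ (j + i) * det (mat_delete (A p) j i))"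
  proof
    fix p
    have "dim_row (A p) = n" "dim_col (A p) = n" using A[of p] by auto
    then show "adj_mat (A p) $$ (i, j) = (- 1) ^ (j + i) * det (mat_delete (A p) j i)"
      using ij by (simp add: adj_mat_def cofactor_def)
  qed
  moreover have "(\<lambda>p. det (mat_delete (A p) j i)) \<in> polynomial_functions X"
  proof (rule det_polynomial[where n = "n - 1"])
    show "mat_delete (A p) j i \<in> carrier_mat (n - 1) (n - 1)" for p
      by (rule mat_delete_carrier[OF A])
    fix i' j' assume ij': "i' < n - 1" "j' < n - 1"
    let ?i = "if i' < j then i' else Suc i'" and ?j = "if j' < i then j' else Suc j'"
    have "mat_delete (A p) j i $$ (i', j') = A p $$ (?i, ?j)" for p
    proof -
      have "dim_row (A p) = n" "dim_col (A p) = n" using A[of p] by auto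
      then show ?thesis using ij' unfolding mat_delete_def by simp
    qed
    moreover have "(\<lambda>p. A p $$ (?i, ?j)) \<in> polynomial_functions X" using ij' by (intro poly) auto
    ultimately show "(\<lambda>p. mat_delete (A p) j i $$ (i', j')) \<in> polynomial_functions X" by simp
  qed
  ultimately show ?thesis by (simp add: polynomial_functions.mult[OF polynomial_functions.const])
qed

lemma mat_mult_polynomial:
  fixes A :: "'p \<Rightarrow> 'k::field mat"
  assumes A: "\<And>p. A p \<in> carrier_mat n m" and B: "\<And>p. B p \<in> carrier_mat m k"
    and pA: "\<And>i j. i < n \<Longrightarrow> j < m \<Longrightarrow> (\<lambda>p. A p $$ (i, j)) \<in> polynomial_functions X"
    and pB: "\<And>i j. i < m \<Longrightarrow> j < k \<Longrightarrow> (\<lambda>p. B p $$ (i, j)) \<in> polynomial_functions X"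
    and ij: "i < n" "j < k"
  shows "(\<lambda>p. (A p * B p) $$ (i, j)) \<in> polynomial_functions X"
proof -
  have "(\<lambda>p. (A p * B p) $$ (i, j)) = (\<lambda>p. \<Sum>t<m. A p $$ (i, t) * B p $$ (t, j))"
    using mat_mult_index[OF A B ij] by auto
  also have "\<dots> \<in> polynomial_functions X"
    using ij by (intro polynomial_functions_sum polynomial_functions.mult pA pB) auto
  finally show ?thesis .
qed

text \<open>The adjugate formula makes the entries polynomial up to the factor
  \<open>1 / det A\<close>.\<close>

definition inv_mat :: "'k::field mat \<Rightarrow> 'k mat" where
  "inv_mat A = (1 / det A) \<cdot>\<^sub>m adj_mat A"

lemma inv_mat:
  assumes A: "A \<in> carrier_mat n n" and "det A \<noteq> 0"
  shows "inv_mat A \<in> carrier_mat n n" "A * inv_mat A = 1\<^sub>m n" "inv_mat A * A = 1\<^sub>m n"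
proof -
  note adj = adj_mat[OF A]
  show "inv_mat A \<in> carrier_mat n n" using adj by (simp add: inv_mat_def)
  have one: "(1 / det A) \<cdot>\<^sub>m (det A \<cdot>\<^sub>m 1\<^sub>m n) = (1\<^sub>m n :: 'a mat)"
    using assms(2) by (intro eq_matI) auto
  show "A * inv_mat A = 1\<^sub>m n"
    using mult_smult_distrib[OF A adj(1), of "1 / det A"] adj(2) one by (simp add: inv_mat_def)
  show "inv_mat A * A = 1\<^sub>m n"
    using mult_smult_assoc_mat[OF adj(1) A, of "1 / det A"] adj(3) one by (simp add: inv_mat_def)
qed

lemma det_nonzero_if_inverse:
  fixes A :: "'k::field mat"
  assumes "A \<in> carrier_mat n n" "B \<in> carrier_mat n n" "A * B = 1\<^sub>m n"
  shows "det A \<noteq> 0"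
  using det_mult[OF assms(1,2)] assms(3) by auto

lemma inverse_mat_unique:
  fixes A :: "'k::field mat"
  assumes "A \<in> carrier_mat n n" "B \<in> carrier_mat n n" "C \<in> carrier_mat n n" "A * B = 1\<^sub>m n" "A * C = 1\<^sub>m n"
  shows "B = C"
proof -
  have "B * A = 1\<^sub>m n" using mat_mult_left_right_inverse[OF assms(1,2,4)] .
  then have "(B * A) * C = C" using assms by simp
  moreover have "(B * A) * C = B * (A * C)" by (rule assoc_mult_mat) (use assms in auto)
  ultimately show ?thesis using assms by simp
qed

lemma Units_ring_mat:
  fixes A :: "'k::field mat"
  assumes "A \<in> carrier_mat n n" "det A \<noteq> 0"
  shows "A \<in> GL n" "inv\<^bsub>ring_mat TYPE('k) n ()\<^esub> A = inv_mat A"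
proof -
  interpret R: ring "ring_mat TYPE('k) n ()" by (rule ring_mat)
  note i = inv_mat[OF assms]
  show "A \<in> GL n"
    using assms(1) i unfolding Units_def by (auto simp: ring_mat_def)
  show "inv\<^bsub>ring_mat TYPE('k) n ()\<^esub> A = inv_mat A"
    by (rule R.inv_unique'[symmetric]) (use assms i in \<open>auto simp: ring_mat_def\<close>)
qed

lemma GL_inverse:
  fixes A :: "'k::field mat"
  assumes "A \<in> GL n"
  shows "A \<in> carrier_mat n n" "det A \<noteq> 0"
proof -
  obtain B where "A \<in> carrier_mat n n" "B \<in> carrier_mat n n" "A * B = 1\<^sub>m n"
    using assms by (auto simp: Units_def ring_mat_def)
  then show "A \<in> carrier_mat n n" "det A \<noteq> 0" using det_nonzero_if_inverse by auto
qed

definition diag_fun_mat :: "nat \<Rightarrow> (nat \<Rightarrow> 'k::field) \<Rightarrow> 'k mat" where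
  "diag_fun_mat n d = mat n n (\<lambda>(i, j). if i = j then d i else 0)"

lemma diag_fun_mat_carrier [simp]: "diag_fun_mat n d \<in> carrier_mat n n"
  by (simp add: diag_fun_mat_def)

lemma diag_fun_mat_index: "i < n \<Longrightarrow> j < n \<Longrightarrow> diag_fun_mat n d $$ (i, j) = (if i = j then d i else 0)"
  by (simp add: diag_fun_mat_def)

lemma diag_fun_mat_mult_index:
  assumes "B \<in> carrier_mat n m" "i < n" "j < m"
  shows "(diag_fun_mat n d * B) $$ (i, j) = d i * B $$ (i, j)"
proof -
  have "(diag_fun_mat n d * B) $$ (i, j) = (\<Sum>k<n. if k = i then d i * B $$ (i, j) else 0)"
    unfolding mat_mult_index[OF diag_fun_mat_carrier assms]
    using assms by (intro sum.cong) (auto simp: diag_fun_mat_index)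
  then show ?thesis using assms by simp
qed

lemma diag_fun_mat_inverse:
  assumes "\<And>i. i < n \<Longrightarrow> d i \<noteq> 0"
  shows "diag_fun_mat n d * diag_fun_mat n (\<lambda>i. inverse (d i)) = 1\<^sub>m n"
  by (rule eq_matI) (auto simp: diag_fun_mat_mult_index[OF diag_fun_mat_carrier] diag_fun_mat_index assms,
      auto simp: diag_fun_mat_def)

lemma diag_fun_mat_nonzero:
  assumes "det (diag_fun_mat n d) \<noteq> 0" "i < n" shows "d i \<noteq> 0"
proof
  assume "d i = 0"
  have "(diag_fun_mat n d * inv_mat (diag_fun_mat n d)) $$ (i, i) = 1"
    using inv_mat(2)[OF diag_fun_mat_carrier assms(1)] assms(2) by simp
  then show False
    using diag_fun_mat_mult_index[OF inv_mat(1)[OF diag_fun_mat_carrier assms(1)] assms(2,2)] \<open>d i = 0\<close> by simp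
qed

text \<open>The grouping exhibits the tangent \<open>A + B + C\<close> and a remainder polynomial in
  \<open>s\<close>, as required of the curves in
  \<open>polynomial_zero_if_zero_on_curves\<close>.\<close>

lemma one_plus_products:
  fixes A B C :: "'k::field mat"
  assumes "A \<in> carrier_mat n n" "B \<in> carrier_mat n n" "C \<in> carrier_mat n n" and ij: "i < n" "j < n"
  shows "((1\<^sub>m n + s \<cdot>\<^sub>m A) * (1\<^sub>m n + s \<cdot>\<^sub>m B) * (1\<^sub>m n + s \<cdot>\<^sub>m C)) $$ (i, j) =
    1\<^sub>m n $$ (i, j) + s * (A $$ (i, j) + B $$ (i, j) + C $$ (i, j)
      + s * ((A * B + A * C + B * C) $$ (i, j) + s * (A * B * C) $$ (i, j)))"
proof -
  let ?A = "s \<cdot>\<^sub>m A" and ?B = "s \<cdot>\<^sub>m B" and ?C = "s \<cdot>\<^sub>m C"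
  have c: "?A \<in> carrier_mat n n" "?B \<in> carrier_mat n n" "?C \<in> carrier_mat n n" using assms by auto
  have 1: "(1\<^sub>m n + ?A) * (1\<^sub>m n + ?B) = (1\<^sub>m n + ?B) + (?A + ?A * ?B)"
  proof -
    have "(1\<^sub>m n + ?A) * (1\<^sub>m n + ?B) = 1\<^sub>m n * (1\<^sub>m n + ?B) + ?A * (1\<^sub>m n + ?B)"
      by (rule add_mult_distrib_mat[of _ n n _ _ n]) (use c in auto)
    also have "?A * (1\<^sub>m n + ?B) = ?A * 1\<^sub>m n + ?A * ?B"
      by (rule mult_add_distrib_mat[of _ n n _ n _]) (use c in auto)
    also have "1\<^sub>m n * (1\<^sub>m n + ?B) = 1\<^sub>m n + ?B" by (rule left_mult_one_mat[of _ n n]) (use c in auto)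
    also have "?A * 1\<^sub>m n = ?A" by (rule right_mult_one_mat[of _ n n]) (use c in auto)
    finally show ?thesis .
  qed
  have 2: "((1\<^sub>m n + ?B) + (?A + ?A * ?B)) * ?C = (?C + ?B * ?C) + (?A * ?C + ?A * ?B * ?C)"
  proof -
    have "((1\<^sub>m n + ?B) + (?A + ?A * ?B)) * ?C = (1\<^sub>m n + ?B) * ?C + (?A + ?A * ?B) * ?C"
      by (rule add_mult_distrib_mat[of _ n n _ _ n]) (use c in auto)
    also have "(1\<^sub>m n + ?B) * ?C = 1\<^sub>m n * ?C + ?B * ?C"
      by (rule add_mult_distrib_mat[of _ n n _ _ n]) (use c in auto)
    also have "(?A + ?A * ?B) * ?C = ?A * ?C + ?A * ?B * ?C"
      by (rule add_mult_distrib_mat[of _ n n _ _ n]) (use c in auto)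
    also have "1\<^sub>m n * ?C = ?C" by (rule left_mult_one_mat[of _ n n]) (use c in auto)
    finally show ?thesis .
  qed
  have "((1\<^sub>m n + ?B) + (?A + ?A * ?B)) * (1\<^sub>m n + ?C)
      = ((1\<^sub>m n + ?B) + (?A + ?A * ?B)) * 1\<^sub>m n + ((1\<^sub>m n + ?B) + (?A + ?A * ?B)) * ?C"
    by (rule mult_add_distrib_mat[of _ n n _ n _]) (use c in auto)
  also have "((1\<^sub>m n + ?B) + (?A + ?A * ?B)) * 1\<^sub>m n = (1\<^sub>m n + ?B) + (?A + ?A * ?B)"
    by (rule right_mult_one_mat[of _ n n]) (use c in auto)
  finally have "(1\<^sub>m n + ?A) * (1\<^sub>m n + ?B) * (1\<^sub>m n + ?C)
      = ((1\<^sub>m n + ?B) + (?A + ?A * ?B)) + ((?C + ?B * ?C) + (?A * ?C + ?A * ?B * ?C))"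
    unfolding 1 2 .
  moreover have "?A * ?B = s \<cdot>\<^sub>m (s \<cdot>\<^sub>m (A * B))" "?A * ?C = s \<cdot>\<^sub>m (s \<cdot>\<^sub>m (A * C))" "?B * ?C = s \<cdot>\<^sub>m (s \<cdot>\<^sub>m (B * C))"
    using assms by (simp_all add: mult_smult_distrib[of _ n n] mult_smult_assoc_mat[of _ n n])
  moreover have "s \<cdot>\<^sub>m (s \<cdot>\<^sub>m (A * B)) * ?C = s \<cdot>\<^sub>m (s \<cdot>\<^sub>m (s \<cdot>\<^sub>m (A * B * C)))"
    using assms by (simp add: mult_smult_distrib[of _ n n] mult_smult_assoc_mat[of _ n n])
  ultimately show ?thesis using assms c ij by (simp add: algebra_simps del: index_mult_mat(1))
qed

section \<open>Modules as edge matrices and the action of the larger group\<close>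

context updown
begin

abbreviation "hdim a \<equiv> \<beta> (head Q a)"
abbreviation "tdim a \<equiv> \<beta> (tail Q a)"

text \<open>Matrix indices start at 0, vertex indices at 1.\<close>

definition edge_at :: "'a \<Rightarrow> nat \<Rightarrow> nat \<Rightarrow> nat \<Rightarrow> bool" where
  "edge_at a i j k \<longleftrightarrow> (a, i) \<in> arcs \<Gamma> \<and> tail \<Gamma> (a, i) = (tail Q a, Suc j) \<and> head \<Gamma> (a, i) = (head Q a, Suc k)"

abbreviation "tpos a i \<equiv> snd (tail \<Gamma> (a, i)) - 1"
abbreviation "hpos a i \<equiv> snd (head \<Gamma> (a, i)) - 1"

lemma edge_at_pos: "(a, i) \<in> arcs \<Gamma> \<Longrightarrow> edge_at a i (tpos a i) (hpos a i)"
  by (rule in_arcs_graphE[of "(a, i)"]) (auto simp: edge_at_def tail_graph head_graph)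

lemma edge_at_arc: "edge_at a i j k \<Longrightarrow> (a, i) \<in> arcs \<Gamma>"
  by (simp add: edge_at_def)

lemma edge_at_bounds:
  assumes "edge_at a i j k" shows "j < tdim a" "k < hdim a"
  using tail_in_verts[OF edge_at_arc[OF assms]] head_in_verts[OF edge_at_arc[OF assms]] assms
  by (auto simp: edge_at_def verts_graph)

lemma edge_at_unique:
  assumes "edge_at a i j k" "edge_at a i' j' k'" shows "j = j' \<longleftrightarrow> i = i'" "k = k' \<longleftrightarrow> i = i'"
  using tail_dart_inj[of "(a, i)" "(a, i')"] head_dart_inj[of "(a, i)" "(a, i')"] assms
  by (auto simp: edge_at_def)

text \<open>A row meets at most one edge of \<open>a\<close>, so the weights can be indexed by rows.
  The module, its partial degenerations and its parameter changes are all of this form.\<close>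

definition edge_mat :: "'a \<Rightarrow> (nat \<Rightarrow> 'k::field) \<Rightarrow> 'k mat" where
  "edge_mat a n = mat (hdim a) (tdim a) (\<lambda>(k, j). if \<exists>i. edge_at a i j k then n k else 0)"

lemma edge_mat_carrier [simp]: "edge_mat a n \<in> carrier_mat (hdim a) (tdim a)"
  by (simp add: edge_mat_def)

lemma edge_mat_index:
  assumes "edge_at a i j k" "k' < hdim a" shows "edge_mat a n $$ (k', j) = (if k' = k then n k else 0)"
proof -
  have "(\<exists>i'. edge_at a i' j k') \<longleftrightarrow> k' = k"
  proof
    assume "\<exists>i'. edge_at a i' j k'"
    then obtain i' where i': "edge_at a i' j k'" by blast
    then show "k' = k" using edge_at_unique[OF assms(1) i'] by simp
  qed (use assms in blast)
  then show ?thesis using assms edge_at_bounds[OF assms(1)] by (auto simp: edge_mat_def)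
qed

lemma edge_mat_index':
  assumes "edge_at a i j k" "j' < tdim a" shows "edge_mat a n $$ (k, j') = (if j' = j then n k else 0)"
proof -
  have "(\<exists>i'. edge_at a i' j' k) \<longleftrightarrow> j' = j"
  proof
    assume "\<exists>i'. edge_at a i' j' k"
    then obtain i' where i': "edge_at a i' j' k" by blast
    then show "j' = j" using edge_at_unique[OF assms(1) i'] by simp
  qed (use assms in blast)
  then show ?thesis using assms edge_at_bounds[OF assms(1)] by (auto simp: edge_mat_def)
qed

lemma mult_edge_mat:
  assumes "X \<in> carrier_mat p (hdim a)" "edge_at a i j k'" "k < p"
  shows "(X * edge_mat a n) $$ (k, j) = X $$ (k, k') * n k'"
proof -
  note b = edge_at_bounds[OF assms(2)]
  have "(X * edge_mat a n) $$ (k, j) = (\<Sum>t<hdim a. if t = k' then X $$ (k, k') * n k' else 0)"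
    unfolding mat_mult_index[OF assms(1) edge_mat_carrier assms(3) b(1)]
    by (intro sum.cong) (auto simp: edge_mat_index[OF assms(2)])
  then show ?thesis using b by simp
qed

lemma mult_edge_mat_0:
  assumes "X \<in> carrier_mat p (hdim a)" "\<nexists>i k'. edge_at a i j k'" "k < p" "j < tdim a"
  shows "(X * edge_mat a n) $$ (k, j) = 0"
  unfolding mat_mult_index[OF assms(1) edge_mat_carrier assms(3,4)]
  using assms by (intro sum.neutral) (auto simp: edge_mat_def)

lemma edge_mat_mult:
  assumes "Y \<in> carrier_mat (tdim a) p" "edge_at a i j' k" "j < p"
  shows "(edge_mat a n * Y) $$ (k, j) = n k * Y $$ (j', j)"
proof -
  note b = edge_at_bounds[OF assms(2)]
  have "(edge_mat a n * Y) $$ (k, j) = (\<Sum>t<tdim a. if t = j' then n k * Y $$ (j', j) else 0)"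
    unfolding mat_mult_index[OF edge_mat_carrier assms(1) b(2) assms(3)]
    by (intro sum.cong) (auto simp: edge_mat_index'[OF assms(2)])
  then show ?thesis using b by simp
qed

lemma edge_mat_mult_0:
  assumes "Y \<in> carrier_mat (tdim a) p" "\<nexists>i j'. edge_at a i j' k" "j < p" "k < hdim a"
  shows "(edge_mat a n * Y) $$ (k, j) = 0"
  unfolding mat_mult_index[OF edge_mat_carrier assms(1,4,3)]
  using assms by (intro sum.neutral) (auto simp: edge_mat_def)

text \<open>Hypothesis \<open>2\<close> makes \<open>X\<close> preserve the span of the heads of
  edges, and \<open>3\<close> makes \<open>Y\<close> preserve the span of the vertices that are not
  tails; only the comparison on pairs of edges in \<open>1\<close> is left.\<close>

lemma edge_mat_intertwine:
  assumes X: "X \<in> carrier_mat (hdim a) (hdim a)" and Y: "Y \<in> carrier_mat (tdim a) (tdim a)"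
    and 1: "\<And>i i' j j' k k'. edge_at a i j k \<Longrightarrow> edge_at a i' j' k' \<Longrightarrow> X $$ (k', k) * n k = n' k' * Y $$ (j', j)"
    and 2: "\<And>i j k k'. edge_at a i j k \<Longrightarrow> k' < hdim a \<Longrightarrow> \<nexists>i' j'. edge_at a i' j' k' \<Longrightarrow> X $$ (k', k) = 0"
    and 3: "\<And>i j j' k'. edge_at a i j' k' \<Longrightarrow> j < tdim a \<Longrightarrow> \<nexists>i' k. edge_at a i' j k \<Longrightarrow> Y $$ (j', j) = 0"
  shows "X * edge_mat a n = edge_mat a n' * Y"
proof (rule eq_matI)
  show "dim_row (X * edge_mat a n) = dim_row (edge_mat a n' * Y)" "dim_col (X * edge_mat a n) = dim_col (edge_mat a n' * Y)"
    using X Y by (simp_all add: edge_mat_def)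
  fix k' j assume "k' < dim_row (edge_mat a n' * Y)" "j < dim_col (edge_mat a n' * Y)"
  then have kj: "k' < hdim a" "j < tdim a" using Y by (simp_all add: edge_mat_def)
  show "(X * edge_mat a n) $$ (k', j) = (edge_mat a n' * Y) $$ (k', j)"
  proof (cases "\<exists>i k. edge_at a i j k"; cases "\<exists>i' j'. edge_at a i' j' k'")
    assume "\<exists>i k. edge_at a i j k" "\<exists>i' j'. edge_at a i' j' k'"
    then obtain i k i' j' where e: "edge_at a i j k" "edge_at a i' j' k'" by blast
    show ?thesis unfolding mult_edge_mat[OF X e(1) kj(1)] edge_mat_mult[OF Y e(2) kj(2)] by (rule 1[OF e])
  next
    assume e': "\<exists>i k. edge_at a i j k" "\<nexists>i' j'. edge_at a i' j' k'"
    then obtain i k where e: "edge_at a i j k" by blast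
    show ?thesis unfolding mult_edge_mat[OF X e kj(1)] edge_mat_mult_0[OF Y e'(2) kj(2,1)] 2[OF e kj(1) e'(2)] by simp
  next
    assume e': "\<nexists>i k. edge_at a i j k" "\<exists>i' j'. edge_at a i' j' k'"
    then obtain i' j' where e: "edge_at a i' j' k'" by blast
    show ?thesis unfolding mult_edge_mat_0[OF X e'(1) kj] edge_mat_mult[OF Y e kj(2)] 3[OF e kj(2) e'(1)] by simp
  next
    assume e': "\<nexists>i k. edge_at a i j k" "\<nexists>i' j'. edge_at a i' j' k'"
    show ?thesis unfolding mult_edge_mat_0[OF X e'(1) kj] edge_mat_mult_0[OF Y e'(2) kj(2,1)] ..
  qed
qed

lemma edge_mat_intertwine_diag:
  assumes "\<And>i j k. edge_at a i j k \<Longrightarrow> d k * n k = n' k * d' j"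
  shows "diag_fun_mat (hdim a) d * edge_mat a n = edge_mat a n' * diag_fun_mat (tdim a) d'"
proof (rule edge_mat_intertwine)
  fix i j k j' k'
  assume e: "edge_at a i j k"
  note b = edge_at_bounds[OF e]
  {
    fix i' assume e': "edge_at a i' j' k'"
    show "diag_fun_mat (hdim a) d $$ (k', k) * n k = n' k' * diag_fun_mat (tdim a) d' $$ (j', j)"
      using b edge_at_bounds[OF e'] edge_at_unique[OF e' e] assms[OF e]
      by (cases "i' = i") (simp_all add: diag_fun_mat_index)
  next
    assume "k' < hdim a" "\<nexists>i' j'. edge_at a i' j' k'"
    then show "diag_fun_mat (hdim a) d $$ (k', k) = 0" using b e by (auto simp: diag_fun_mat_index)
  next
    assume "j' < tdim a" "\<nexists>i' k. edge_at a i' j' k"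
    then show "diag_fun_mat (tdim a) d' $$ (j, j') = 0" using b e by (auto simp: diag_fun_mat_index)
  }
qed simp_all

text \<open>Arrows of the same color meet on one side, where no vertex is both a head and a tail, so
  an edge of \<open>a\<close> is never continued by one of \<open>b\<close>.\<close>

lemma edge_mat_comp_zero:
  assumes "a \<in> arcs Q" "b \<in> arcs Q" "head Q a = tail Q b" "c a = c b"
  shows "edge_mat b n' * edge_mat a n = 0\<^sub>m (hdim b) (tdim a)"
proof (rule eq_matI)
  fix k j assume "k < dim_row (0\<^sub>m (hdim b) (tdim a) :: 'b mat)" "j < dim_col (0\<^sub>m (hdim b) (tdim a) :: 'b mat)"
  then have kj: "k < hdim b" "j < tdim a" by auto
  have side: "hs a = ts b" using composable assms by blast
  have X: "edge_mat b n' \<in> carrier_mat (hdim b) (hdim a)" by (simp add: assms(3))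
  have "(edge_mat b n' * edge_mat a n) $$ (k, j) = 0"
  proof (cases "\<exists>i k'. edge_at a i j k'")
    case True
    then obtain i k' where e: "edge_at a i j k'" by blast
    have "\<not> edge_at b i' k' k" for i'
      using tail_head_dart[of "(b, i')" "(a, i)"] side e assms(3) by (auto simp: edge_at_def)
    then have "edge_mat b n' $$ (k, k') = 0" using kj edge_at_bounds[OF e] assms(3) by (auto simp: edge_mat_def)
    then show ?thesis using mult_edge_mat[OF X e kj(1)] by simp
  next
    case False
    then show ?thesis using mult_edge_mat_0[OF X _ kj] by blast
  qed
  then show "(edge_mat b n' * edge_mat a n) $$ (k, j) = 0\<^sub>m (hdim b) (tdim a) $$ (k, j)" using kj by simp
qed (simp_all add: edge_mat_def)

text \<open>Factoring through the space indexed by the \<open>r a\<close> edges yields the rank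
  bound.\<close>

lemma edge_mat_factor:
  assumes "a \<in> arcs Q"
  obtains B C where "B \<in> carrier_mat (hdim a) (r a)" "C \<in> carrier_mat (r a) (tdim a)" "edge_mat a n = B * C"
proof
  let ?B = "mat (hdim a) (r a) (\<lambda>(k, i). if \<exists>j. edge_at a (Suc i) j k then n k else 0)"
  let ?C = "mat (r a) (tdim a) (\<lambda>(i, j). if \<exists>k. edge_at a (Suc i) j k then 1 else 0)"
  show B: "?B \<in> carrier_mat (hdim a) (r a)" and C: "?C \<in> carrier_mat (r a) (tdim a)" by auto
  show "edge_mat a n = ?B * ?C"
  proof (rule eq_matI)
    fix k j assume "k < dim_row (?B * ?C)" "j < dim_col (?B * ?C)"
    then have kj: "k < hdim a" "j < tdim a" by auto
    have prod: "(?B * ?C) $$ (k, j) = (\<Sum>i<r a. if (\<exists>j. edge_at a (Suc i) j k) \<and> (\<exists>k. edge_at a (Suc i) j k) then n k else 0)"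
      unfolding mat_mult_index[OF B C kj] using kj by (intro sum.cong) auto
    show "edge_mat a n $$ (k, j) = (?B * ?C) $$ (k, j)"
    proof (cases "\<exists>i k'. edge_at a i j k'")
      case True
      then obtain i' k' where e': "edge_at a i' j k'" by blast
      then obtain i where i: "i' = Suc i" "i < r a"
        by (cases i') (auto simp: edge_at_def arcs_graph)
      note e = e'[unfolded i(1)]
      have "(\<exists>j. edge_at a (Suc m) j k) \<and> (\<exists>k. edge_at a (Suc m) j k) \<longleftrightarrow> m = i \<and> k = k'" for m
        using edge_at_unique[OF e] e by (metis Suc_inject)
      then have "(?B * ?C) $$ (k, j) = (\<Sum>m<r a. if m = i then (if k = k' then n k else 0) else 0)"
        unfolding prod by (intro sum.cong) auto
      then show ?thesis using edge_mat_index[OF e kj(1), of n] i(2) by simp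
    next
      case False
      then show ?thesis unfolding prod using kj by (subst sum.neutral) (auto simp: edge_mat_def)
    qed
  qed (simp_all add: edge_mat_def)
qed

lemma updown_module_eq:
  "updown_module Q c \<beta> r \<epsilon> \<Theta> l = (\<lambda>a\<in>arcs Q. edge_mat a (\<lambda>k. head_weight \<Theta> l ((head Q a, Suc k), hs a)))"
  unfolding updown_module_def Let_def edge_mat_def edge_at_def head_weight_def fst_conv snd_conv head_side_def ..

text \<open>The function \<open>z\<close> is a point of the affine space around the larger group:
  one square matrix for each vertex and each side.\<close>

definition block :: "('v \<times> bool \<times> nat \<times> nat \<Rightarrow> 'k::field) \<Rightarrow> 'v \<Rightarrow> bool \<Rightarrow> 'k mat" where
  "block z x \<sigma> = mat (\<beta> x) (\<beta> x) (\<lambda>(i, j). z (x, \<sigma>, i, j))"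

lemma block_carrier [simp]: "block z x \<sigma> \<in> carrier_mat (\<beta> x) (\<beta> x)"
  by (simp add: block_def)

definition det_prod :: "('v \<times> bool \<times> nat \<times> nat \<Rightarrow> 'k::field) \<Rightarrow> 'k" where
  "det_prod z = (\<Prod>p\<in>verts Q \<times> UNIV. det (block z (fst p) (snd p)))"

text \<open>The action of the larger group: each end of an arrow sees only the component on its own
  side, so the relations between different arrows impose no compatibility.\<close>

definition conj_rep :: "('v \<Rightarrow> bool \<Rightarrow> 'k::field mat) \<Rightarrow> ('a \<Rightarrow> 'k mat) \<Rightarrow> 'a \<Rightarrow> 'k mat" where
  "conj_rep h M = (\<lambda>a\<in>arcs Q. h (head Q a) (hs a) * M a * inv_mat (h (tail Q a) (ts a)))"

lemma det_prod_nonzero: "det_prod z \<noteq> 0 \<longleftrightarrow> (\<forall>x\<in>verts Q. \<forall>\<sigma>. det (block z x \<sigma>) \<noteq> 0)"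
  using finQ by (auto simp: det_prod_def)

lemma block_polynomial: "i < \<beta> x \<Longrightarrow> j < \<beta> x \<Longrightarrow> (\<lambda>z. block z x \<sigma> $$ (i, j)) \<in> polynomial_functions affine_coords"
  by (auto simp: block_def affine_coords_def intro!: polynomial_functions.coord)

lemma det_block_polynomial: "(\<lambda>z. det (block z x \<sigma>)) \<in> polynomial_functions affine_coords"
  by (rule det_polynomial[of _ "\<beta> x"]) (auto intro: block_polynomial)

lemma det_prod_polynomial: "det_prod \<in> polynomial_functions affine_coords"
proof -
  have "(\<lambda>z. det_prod z) \<in> polynomial_functions affine_coords"
    unfolding det_prod_def by (intro polynomial_functions_prod det_block_polynomial)
  then show ?thesis by simp
qed

text \<open>The only denominators are determinants of blocks, so a power of \<open>det_prod\<close>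
  clears them; the exponent grows along the construction of \<open>P\<close>.\<close>

lemma conj_rep_polynomial:
  assumes M: "M \<in> rep_space Q \<beta>" and P: "P \<in> polynomial_functions (rep_coordinates Q \<beta>)"
  shows "\<exists>N. \<exists>F\<in>polynomial_functions affine_coords. \<forall>z. det_prod z \<noteq> 0 \<longrightarrow> F z = det_prod z ^ N * P (conj_rep (block z) M)"
  using P
proof induction
  case (const k)
  show ?case by (rule exI[of _ 0], rule bexI[of _ "\<lambda>_. k"]) (auto intro: polynomial_functions.const)
next
  case (coord f)
  then obtain a i j where f: "f = (\<lambda>V. V a $$ (i, j))" and a: "a \<in> arcs Q" and ij: "i < hdim a" "j < tdim a"
    by (auto simp: rep_coordinates_def)
  have Ma: "M a \<in> carrier_mat (hdim a) (tdim a)" using M a by (auto simp: rep_space_def)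
  \<comment> \<open>The product of all other determinants: it completes the single determinant
    cancelled by the adjugate to \<open>det_prod\<close>.\<close>
  let ?R = "\<lambda>z. \<Prod>p\<in>verts Q \<times> UNIV - {(tail Q a, ts a)}. det (block z (fst p) (snd p))"
  let ?A = "\<lambda>z. (block z (head Q a) (hs a) * M a * adj_mat (block z (tail Q a) (ts a))) $$ (i, j)"
  have adj: "adj_mat (block z (tail Q a) (ts a)) \<in> carrier_mat (tdim a) (tdim a)" for z
    by (rule adj_mat(1)) simp
  have HM: "block z (head Q a) (hs a) * M a \<in> carrier_mat (hdim a) (tdim a)" for z
    using Ma by (intro mult_carrier_mat[of _ _ "hdim a"]) auto
  have "?A \<in> polynomial_functions affine_coords"
  proof (rule mat_mult_polynomial[OF HM adj _ _ ij])
    fix i j assume "i < hdim a" "j < tdim a"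
    then show "(\<lambda>z. (block z (head Q a) (hs a) * M a) $$ (i, j)) \<in> polynomial_functions affine_coords"
      by (intro mat_mult_polynomial[OF block_carrier Ma] block_polynomial polynomial_functions.const)
  next
    fix i j assume "i < tdim a" "j < tdim a"
    then show "(\<lambda>z. adj_mat (block z (tail Q a) (ts a)) $$ (i, j)) \<in> polynomial_functions affine_coords"
      by (intro adj_mat_polynomial[OF block_carrier] block_polynomial)
  qed
  moreover have "?R \<in> polynomial_functions affine_coords"
    by (intro polynomial_functions_prod det_block_polynomial)
  ultimately have poly: "(\<lambda>z. ?R z * ?A z) \<in> polynomial_functions affine_coords"
    by (rule polynomial_functions.mult[rotated])
  have "?R z * ?A z = det_prod z ^ 1 * f (conj_rep (block z) M)" if z: "det_prod z \<noteq> 0" for z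
  proof -
    let ?d = "det (block z (tail Q a) (ts a))"
    have D: "det_prod z = ?d * ?R z"
      unfolding det_prod_def using finQ wf(1)[OF a] by (subst prod.remove[of _ "(tail Q a, ts a)"]) auto
    have d: "?d \<noteq> 0" using z D by auto
    have "f (conj_rep (block z) M) = (block z (head Q a) (hs a) * M a * ((1 / ?d) \<cdot>\<^sub>m adj_mat (block z (tail Q a) (ts a)))) $$ (i, j)"
      using a by (simp add: f conj_rep_def inv_mat_def)
    also have "\<dots> = (1 / ?d) * ?A z"
      unfolding mult_smult_distrib[OF HM adj]
      by (subst index_smult_mat(1)) (use mult_carrier_mat[OF HM adj, of z z] ij in auto)
    finally show ?thesis using D d by simp
  qed
  then show ?case by (intro exI[of _ 1] bexI[OF _ poly] allI impI)
next
  case (add f g)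
  then obtain N F N' F' where F: "F \<in> polynomial_functions affine_coords" "F' \<in> polynomial_functions affine_coords"
    "\<And>z. det_prod z \<noteq> 0 \<Longrightarrow> F z = det_prod z ^ N * f (conj_rep (block z) M)"
    "\<And>z. det_prod z \<noteq> 0 \<Longrightarrow> F' z = det_prod z ^ N' * g (conj_rep (block z) M)"
    by blast
  have poly: "(\<lambda>z. F z * det_prod z ^ N' + F' z * det_prod z ^ N) \<in> polynomial_functions affine_coords"
    by (intro polynomial_functions.add polynomial_functions.mult F polynomial_functions_power det_prod_polynomial)
  have "\<forall>z. det_prod z \<noteq> 0 \<longrightarrow> F z * det_prod z ^ N' + F' z * det_prod z ^ N
      = det_prod z ^ (N + N') * (f (conj_rep (block z) M) + g (conj_rep (block z) M))"
    by (simp add: F(3,4) power_add algebra_simps)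
  then show ?case by (intro exI[of _ "N + N'"] bexI[OF _ poly])
next
  case (mult f g)
  then obtain N F N' F' where F: "F \<in> polynomial_functions affine_coords" "F' \<in> polynomial_functions affine_coords"
    "\<And>z. det_prod z \<noteq> 0 \<Longrightarrow> F z = det_prod z ^ N * f (conj_rep (block z) M)"
    "\<And>z. det_prod z \<noteq> 0 \<Longrightarrow> F' z = det_prod z ^ N' * g (conj_rep (block z) M)"
    by blast
  have poly: "(\<lambda>z. F z * F' z) \<in> polynomial_functions affine_coords"
    by (intro polynomial_functions.mult F)
  have "\<forall>z. det_prod z \<noteq> 0 \<longrightarrow> F z * F' z
      = det_prod z ^ (N + N') * (f (conj_rep (block z) M) * g (conj_rep (block z) M))"
    by (simp add: F(3,4) power_add algebra_simps)
  then show ?case by (intro exI[of _ "N + N'"] bexI[OF _ poly])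
qed

end

section \<open>Curves inside the union of the orbits\<close>

lemma commute_one_plus:
  fixes Z :: "'k::field mat"
  assumes "Z \<in> carrier_mat n n" "W \<in> carrier_mat m m" "M \<in> carrier_mat n m" "Z * M = M * W"
  shows "(1\<^sub>m n + s \<cdot>\<^sub>m Z) * M = M * (1\<^sub>m m + s \<cdot>\<^sub>m W)"
proof -
  have "(1\<^sub>m n + s \<cdot>\<^sub>m Z) * M = 1\<^sub>m n * M + (s \<cdot>\<^sub>m Z) * M"
    by (rule add_mult_distrib_mat[of _ n n _ _ m]) (use assms in auto)
  also have "1\<^sub>m n * M = M * 1\<^sub>m m" using assms(3) by simp
  also have "(s \<cdot>\<^sub>m Z) * M = M * (s \<cdot>\<^sub>m W)"
    using mult_smult_assoc_mat[OF assms(1,3)] mult_smult_distrib[OF assms(3,2)] assms(4) by simp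
  also have "M * 1\<^sub>m m + M * (s \<cdot>\<^sub>m W) = M * (1\<^sub>m m + s \<cdot>\<^sub>m W)"
    by (rule mult_add_distrib_mat[symmetric, of _ n m _ m]) (use assms in auto)
  finally show ?thesis .
qed

text \<open>The order of the factors matters. The innermost \<open>Z\<close> commutes past the
  module and cancels, \<open>T\<close> turns \<open>M\<close> into \<open>M'\<close> and cancels,
  and only the conjugation by \<open>A\<close> and \<open>A'\<close> survives.\<close>

lemma conj_factor:
  fixes A :: "'k::field mat"
  assumes h: "A \<in> carrier_mat p p" "T \<in> carrier_mat p p" "Z \<in> carrier_mat p p"
    and t: "A' \<in> carrier_mat q q" "T' \<in> carrier_mat q q" "Z' \<in> carrier_mat q q"
    and M: "M \<in> carrier_mat p q" "M' \<in> carrier_mat p q"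
    and Z: "Z * M = M * Z'" and T: "T * M = M' * T'"
    and det: "det (A' * T' * Z') \<noteq> 0"
  shows "A * T * Z * M * inv_mat (A' * T' * Z') = A * M' * inv_mat A'"
proof -
  let ?G = "A' * T' * Z'"
  have G: "?G \<in> carrier_mat q q" using t by auto
  have "det ?G = det A' * det T' * det Z'" using t by (simp add: det_mult[of _ q])
  then have dA: "det A' \<noteq> 0" using det by auto
  note iG = inv_mat[OF G det] and iA = inv_mat[OF t(1) dA]
  have TZ: "T' * Z' \<in> carrier_mat q q" using t by auto
  have "A' * (T' * Z') = ?G" by (rule assoc_mult_mat[symmetric]) (use t in auto)
  then have "inv_mat A' * ?G = (inv_mat A' * A') * (T' * Z')"
    using assoc_mult_mat[OF iA(1) t(1) TZ] by simp
  also have "\<dots> = T' * Z'" unfolding iA(3) by (rule left_mult_one_mat[OF TZ])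
  finally have 1: "T' * Z' = inv_mat A' * ?G" by simp
  have "A * T * Z * M = A * T * (Z * M)" by (rule assoc_mult_mat[of _ p p _ p _ q]) (use h M in auto)
  also have "\<dots> = A * (T * (M * Z'))" unfolding Z by (rule assoc_mult_mat[of _ p p _ p _ q]) (use h M t in auto)
  also have "T * (M * Z') = T * M * Z'" by (rule assoc_mult_mat[symmetric, of _ p p _ q _ q]) (use h M t in auto)
  also have "\<dots> = M' * (T' * Z')" unfolding T by (rule assoc_mult_mat[of _ p q _ q _ q]) (use M t in auto)
  also have "\<dots> = M' * inv_mat A' * ?G" unfolding 1 by (rule assoc_mult_mat[symmetric, of _ p q _ q _ q]) (use M iA G in auto)
  finally have "A * T * Z * M * inv_mat ?G = A * (M' * inv_mat A' * ?G) * inv_mat ?G" by simp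
  also have "\<dots> = A * (M' * inv_mat A' * ?G * inv_mat ?G)"
    by (rule assoc_mult_mat[of _ p p _ q _ q]) (use h M iA G iG in auto)
  also have "M' * inv_mat A' * ?G * inv_mat ?G = M' * inv_mat A' * (?G * inv_mat ?G)"
    by (rule assoc_mult_mat[of _ p q _ q _ q]) (use M iA G iG in auto)
  also have "\<dots> = M' * inv_mat A'" unfolding iG(2) using M iA by simp
  also have "A * (M' * inv_mat A') = A * M' * inv_mat A'"
    by (rule assoc_mult_mat[symmetric, of _ p p _ q _ q]) (use h M iA in auto)
  finally show ?thesis .
qed

context updown_choice
begin

abbreviation module :: "(('v \<times> nat) set \<Rightarrow> 'k::field) \<Rightarrow> 'a \<Rightarrow> 'k mat" where
  "module l \<equiv> updown_module Q c \<beta> r \<epsilon> \<Theta> l"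

lemma module_apply: "a \<in> arcs Q \<Longrightarrow> module l a = edge_mat a (\<lambda>k. head_weight \<Theta> l ((head Q a, Suc k), hs a))"
  by (simp add: updown_module_eq)

lemma module_carrier: "a \<in> arcs Q \<Longrightarrow> module l a \<in> carrier_mat (hdim a) (tdim a)"
  by (simp add: module_apply)

lemma module_rep_space: "module l \<in> rep_space Q \<beta>"
  unfolding rep_space_def updown_module_eq by auto

definition endo_block :: "('v \<times> nat \<Rightarrow> 'v \<times> nat \<Rightarrow> bool \<Rightarrow> 'k::field) \<Rightarrow> 'v \<Rightarrow> bool \<Rightarrow> 'k mat" where
  "endo_block z x \<sigma> = mat (\<beta> x) (\<beta> x) (\<lambda>(i, j). z (x, Suc i) (x, Suc j) \<sigma>)"

text \<open>Concentrated on side \<open>True\<close> at the chosen targets, so that it rescales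
  exactly the rows carrying a parameter.\<close>

definition torus_block :: "('v \<times> nat \<Rightarrow> 'k::field) \<Rightarrow> 'v \<Rightarrow> bool \<Rightarrow> 'k mat" where
  "torus_block \<tau> x \<sigma> = diag_fun_mat (\<beta> x) (\<lambda>i. if \<sigma> \<and> (x, Suc i) \<in> \<Theta> ` bands \<Gamma> then \<tau> (x, Suc i) else 0)"

lemma block_carriers [simp]: "endo_block z x \<sigma> \<in> carrier_mat (\<beta> x) (\<beta> x)" "torus_block \<tau> x \<sigma> \<in> carrier_mat (\<beta> x) (\<beta> x)"
  by (simp_all add: endo_block_def torus_block_def)

lemma endo_block_module:
  assumes z: "endo l z" and a: "a \<in> arcs Q"
  shows "endo_block z (head Q a) (hs a) * module l a = module l a * endo_block z (tail Q a) (ts a)"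
  unfolding module_apply[OF a]
proof (rule edge_mat_intertwine)
  have endo1: "z (head \<Gamma> e') (head \<Gamma> e) (hs (fst e)) * edge_weight \<Theta> l e
      = edge_weight \<Theta> l e' * z (tail \<Gamma> e') (tail \<Gamma> e) (ts (fst e))"
    if "e \<in> arcs \<Gamma>" "e' \<in> arcs \<Gamma>" "fst e = fst e'" for e e'
    using z that unfolding endo_def by blast
  have endo2: "z v (head \<Gamma> e) (hs (fst e)) = 0" if "e \<in> arcs \<Gamma>" "(v, hs (fst e)) \<notin> hdart ` arcs \<Gamma>" for e v
    using z that unfolding endo_def by blast
  have endo3: "z (tail \<Gamma> e) w (ts (fst e)) = 0" if "e \<in> arcs \<Gamma>" "(w, ts (fst e)) \<notin> tdart ` arcs \<Gamma>" for e w
    using z that unfolding endo_def by blast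
  fix i j k j' k'
  assume e: "edge_at a i j k"
  note b = edge_at_bounds[OF e]
  {
    fix i' assume e': "edge_at a i' j' k'"
    show "endo_block z (head Q a) (hs a) $$ (k', k) * head_weight \<Theta> l ((head Q a, Suc k), hs a)
        = head_weight \<Theta> l ((head Q a, Suc k'), hs a) * endo_block z (tail Q a) (ts a) $$ (j', j)"
      using endo1[of "(a, i)" "(a, i')"] e e' b edge_at_bounds[OF e']
      by (simp add: endo_block_def edge_weight_def hdart_def edge_at_def)
  next
    assume k': "k' < hdim a" and no: "\<nexists>i' j'. edge_at a i' j' k'"
    have "((head Q a, Suc k'), hs a) \<notin> hdart ` arcs \<Gamma>"
    proof
      assume "((head Q a, Suc k'), hs a) \<in> hdart ` arcs \<Gamma>"
      then obtain a' i' where a': "(a', i') \<in> arcs \<Gamma>" "((head Q a, Suc k'), hs a) = hdart (a', i')" by auto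
      then have "a' = a" using in_unique[of a' a] a by (auto simp: hdart_graph arcs_graph)
      then show False using no a' edge_at_pos[OF a'(1)] by (auto simp: hdart_def edge_at_def)
    qed
    then show "endo_block z (head Q a) (hs a) $$ (k', k) = 0"
      using endo2[of "(a, i)"] e b k' by (simp add: endo_block_def edge_at_def)
  next
    assume j': "j' < tdim a" and no: "\<nexists>i' k. edge_at a i' j' k"
    have "((tail Q a, Suc j'), ts a) \<notin> tdart ` arcs \<Gamma>"
    proof
      assume "((tail Q a, Suc j'), ts a) \<in> tdart ` arcs \<Gamma>"
      then obtain a' i' where a': "(a', i') \<in> arcs \<Gamma>" "((tail Q a, Suc j'), ts a) = tdart (a', i')" by auto
      then have "a' = a" using out_unique[of a' a] a by (auto simp: tdart_graph arcs_graph)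
      then show False using no a' edge_at_pos[OF a'(1)] by (auto simp: tdart_def edge_at_def)
    qed
    then show "endo_block z (tail Q a) (ts a) $$ (j, j') = 0"
      using endo3[of "(a, i)"] e b j' by (simp add: endo_block_def edge_at_def)
  }
qed simp_all

definition move_parameter :: "(('v \<times> nat) set \<Rightarrow> 'k::field) \<Rightarrow> ('v \<times> nat \<Rightarrow> 'k) \<Rightarrow> 'k \<Rightarrow> ('v \<times> nat) set \<Rightarrow> 'k" where
  "move_parameter l \<tau> s = (\<lambda>b\<in>bands \<Gamma>. l b * (1 + s * \<tau> (\<Theta> b)))"

lemma one_plus_torus_block: "1\<^sub>m (\<beta> x) + s \<cdot>\<^sub>m torus_block \<tau> x \<sigma> =
    diag_fun_mat (\<beta> x) (\<lambda>i. if \<sigma> \<and> (x, Suc i) \<in> \<Theta> ` bands \<Gamma> then 1 + s * \<tau> (x, Suc i) else 1)"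
  by (rule eq_matI) (auto simp: torus_block_def diag_fun_mat_def)

text \<open>A chosen target is never a tail, so the factor at the tail end is 1 on every column with
  an edge, while the factor at the head end multiplies the parameter.\<close>

lemma torus_block_module:
  assumes a: "a \<in> arcs Q"
  shows "(1\<^sub>m (hdim a) + s \<cdot>\<^sub>m torus_block \<tau> (head Q a) (hs a)) * module l a
    = module (move_parameter l \<tau> s) a * (1\<^sub>m (tdim a) + s \<cdot>\<^sub>m torus_block \<tau> (tail Q a) (ts a))"
  unfolding module_apply[OF a] one_plus_torus_block
proof (rule edge_mat_intertwine_diag)
  fix i j k
  assume e: "edge_at a i j k"
  have nt: "(tail Q a, Suc j) \<notin> \<Theta> ` bands \<Gamma>"
    using choice_not_tail e unfolding edge_at_def by (metis imageE)
  let ?v = "(head Q a, Suc k)"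
  have "(if hs a \<and> ?v \<in> \<Theta> ` bands \<Gamma> then 1 + s * \<tau> ?v else 1) * head_weight \<Theta> l (?v, hs a)
      = head_weight \<Theta> (move_parameter l \<tau> s) (?v, hs a)"
  proof (cases "hs a \<and> ?v \<in> \<Theta> ` bands \<Gamma>")
    case True
    then obtain b where b: "b \<in> bands \<Gamma>" "?v = \<Theta> b" "hs a" by auto
    then show ?thesis by (simp add: head_weight_choice move_parameter_def)
  next
    case False
    then have "head_weight \<Theta> l' (?v, hs a) = 1" for l' :: "_ \<Rightarrow> 'b"
      by (intro head_weight_other) auto
    then show ?thesis unfolding if_not_P[OF False] by simp
  qed
  then show "(if hs a \<and> ?v \<in> \<Theta> ` bands \<Gamma> then 1 + s * \<tau> ?v else 1) * head_weight \<Theta> l (?v, hs a)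
      = head_weight \<Theta> (move_parameter l \<tau> s) (?v, hs a)
        * (if ts a \<and> (tail Q a, Suc j) \<in> \<Theta> ` bands \<Gamma> then 1 + s * \<tau> (tail Q a, Suc j) else 1)"
    using nt by simp
qed

text \<open>The factor with \<open>X\<close> is the same on both sides and hence a genuine base
  change; by \<open>conj_factor\<close> the other two only move the parameters. These stay nonzero
  because \<open>1 + s * \<tau> (\<Theta> b)\<close> is a diagonal entry of an invertible diagonal
  block.\<close>

lemma curve_in_orbit:
  fixes l :: "('v \<times> nat) set \<Rightarrow> 'k::field" and s :: 'k
  assumes l: "\<And>b. b \<in> bands \<Gamma> \<Longrightarrow> l b \<noteq> 0" and z: "endo l z"
    and X: "\<And>x. X x \<in> carrier_mat (\<beta> x) (\<beta> x)"
    and G: "\<And>x \<sigma>. G x \<sigma> = (1\<^sub>m (\<beta> x) + s \<cdot>\<^sub>m X x) * (1\<^sub>m (\<beta> x) + s \<cdot>\<^sub>m torus_block \<tau> x \<sigma>) * (1\<^sub>m (\<beta> x) + s \<cdot>\<^sub>m endo_block z x \<sigma>)"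
    and det: "\<And>x \<sigma>. x \<in> verts Q \<Longrightarrow> det (G x \<sigma>) \<noteq> 0"
  shows "conj_rep G (module l) \<in> gl_orbit Q \<beta> (module (move_parameter l \<tau> s))"
    and "move_parameter l \<tau> s \<in> (\<Pi>\<^sub>E b\<in>bands \<Gamma>. UNIV - {0})"
proof -
  let ?A = "\<lambda>x. 1\<^sub>m (\<beta> x) + s \<cdot>\<^sub>m X x" and ?T = "\<lambda>x \<sigma>. 1\<^sub>m (\<beta> x) + s \<cdot>\<^sub>m torus_block \<tau> x \<sigma>"
    and ?Z = "\<lambda>x \<sigma>. 1\<^sub>m (\<beta> x) + s \<cdot>\<^sub>m endo_block z x \<sigma>"
  have c: "?A x \<in> carrier_mat (\<beta> x) (\<beta> x)" "?T x \<sigma> \<in> carrier_mat (\<beta> x) (\<beta> x)" "?Z x \<sigma> \<in> carrier_mat (\<beta> x) (\<beta> x)" for x \<sigma>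
    using X by auto
  have "det (G x \<sigma>) = det (?A x) * det (?T x \<sigma>) * det (?Z x \<sigma>)" for x \<sigma>
    unfolding G using det_mult[OF mult_carrier_mat[OF c(1)[of x] c(2)[of x \<sigma>]] c(3)[of x \<sigma>]] det_mult[OF c(1)[of x] c(2)[of x \<sigma>]]
    by (simp only:)
  then have d: "det (?A x) \<noteq> 0" "det (?T x \<sigma>) \<noteq> 0" if "x \<in> verts Q" for x \<sigma>
    using det[OF that, of \<sigma>] by auto
  define g where "g = (\<lambda>x\<in>verts Q. ?A x)"
  have g: "g \<in> (\<Pi>\<^sub>E x\<in>verts Q. GL (\<beta> x))"
    unfolding g_def using Units_ring_mat(1)[OF c(1) d(1)] by auto
  have "conj_rep G (module l) = gl_act Q \<beta> g (module (move_parameter l \<tau> s))"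
    unfolding conj_rep_def gl_act_def
  proof (rule restrict_ext)
    fix a assume a: "a \<in> arcs Q"
    let ?h = "head Q a" and ?t = "tail Q a"
    note w = wf[OF a]
    have "G ?h (hs a) * module l a * inv_mat (G ?t (ts a)) = ?A ?h * module (move_parameter l \<tau> s) a * inv_mat (?A ?t)"
      unfolding G
    proof (rule conj_factor[where p = "\<beta> ?h" and q = "\<beta> ?t"])
      show "?Z ?h (hs a) * module l a = module l a * ?Z ?t (ts a)"
        by (rule commute_one_plus[OF _ _ module_carrier[OF a] endo_block_module[OF z a]]) auto
      show "?T ?h (hs a) * module l a = module (move_parameter l \<tau> s) a * ?T ?t (ts a)"
        by (rule torus_block_module[OF a])
      show "det (?A ?t * ?T ?t (ts a) * ?Z ?t (ts a)) \<noteq> 0" using det[OF w(1)] unfolding G .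
    qed (use c module_carrier[OF a] in auto)
    then show "G ?h (hs a) * module l a * inv_mat (G ?t (ts a))
       = g ?h * module (move_parameter l \<tau> s) a * inv\<^bsub>ring_mat TYPE('k) (\<beta> ?t) ()\<^esub> g ?t"
      using Units_ring_mat(2)[OF c(1) d(1)[OF w(1)]] w by (simp add: g_def)
  qed
  then show "conj_rep G (module l) \<in> gl_orbit Q \<beta> (module (move_parameter l \<tau> s))"
    unfolding gl_orbit_def using g by blast
  have "l b * (1 + s * \<tau> (\<Theta> b)) \<noteq> 0" if b: "b \<in> bands \<Gamma>" for b
  proof -
    obtain x j where xj: "\<Theta> b = (x, Suc j)" "x \<in> verts Q" "j < \<beta> x"
      using choice_in_verts[OF b] by (cases "\<Theta> b"; cases "snd (\<Theta> b)") (auto simp: verts_graph)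
    have "det (diag_fun_mat (\<beta> x) (\<lambda>i. if True \<and> (x, Suc i) \<in> \<Theta> ` bands \<Gamma> then 1 + s * \<tau> (x, Suc i) else 1)) \<noteq> 0"
      using d(2)[OF xj(2), of True] unfolding one_plus_torus_block .
    from diag_fun_mat_nonzero[OF this xj(3)] have "1 + s * \<tau> (\<Theta> b) \<noteq> 0"
      using b xj(1) by (metis (mono_tags) imageI)
    then show ?thesis using l[OF b] by simp
  qed
  then show "move_parameter l \<tau> s \<in> (\<Pi>\<^sub>E b\<in>bands \<Gamma>. UNIV - {0})"
    by (auto simp: move_parameter_def)
qed

text \<open>A given tangent direction \<open>w\<close> splits as \<open>X + torus_block \<tau> + endo_block z\<close>, and the
  products of \<open>1 + s X\<close>, \<open>1 + s torus_block \<tau>\<close> and \<open>1 + s endo_block z\<close> form a curve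
  with this tangent that moves the module inside the union of the orbits.\<close>

lemma vanishing_generic:
  fixes P :: "('a \<Rightarrow> 'k::field mat) \<Rightarrow> 'k"
  assumes inf: "infinite (UNIV :: 'k set)"
    and P: "P \<in> polynomial_functions (rep_coordinates Q \<beta>)"
    and vanish: "\<And>l V. l \<in> (\<Pi>\<^sub>E b\<in>bands \<Gamma>. UNIV - {0}) \<Longrightarrow> V \<in> gl_orbit Q \<beta> (module l) \<Longrightarrow> P V = 0"
  obtains l where "\<And>b. b \<in> bands \<Gamma> \<Longrightarrow> l b \<noteq> 0"
    "\<And>h. (\<And>x \<sigma>. h x \<sigma> \<in> carrier_mat (\<beta> x) (\<beta> x)) \<Longrightarrow> (\<And>x \<sigma>. x \<in> verts Q \<Longrightarrow> det (h x \<sigma>) \<noteq> 0) \<Longrightarrow>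
       P (conj_rep h (module l)) = 0"
proof -
  obtain l :: "('v \<times> nat) set \<Rightarrow> 'k" where l0: "\<forall>b\<in>bands \<Gamma>. l b \<noteq> 0"
    "\<forall>b\<in>bands \<Gamma>. \<forall>b'\<in>bands \<Gamma>. b \<noteq> b' \<longrightarrow> (\<forall>m\<in>{1..2 * card (verts \<Gamma>)}. \<forall>n\<in>{1..2 * card (verts \<Gamma>)}.
      l b ^ m \<noteq> l b' ^ n \<and> l b ^ m * l b' ^ n \<noteq> 1)"
    using generic_parameters_exist[OF inf finite_bands, of "2 * card (verts \<Gamma>)"] by (elim exE conjE)
  note l = l0(1)[rule_format] and gen = l0(2)[rule_format]
  obtain N F where F: "F \<in> polynomial_functions affine_coords"
    "\<And>z. det_prod z \<noteq> 0 \<Longrightarrow> F z = det_prod z ^ N * P (conj_rep (block z) (module l))"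
    using conj_rep_polynomial[OF module_rep_space P] by blast
  \<comment> \<open>The factor \<open>det_prod\<close> takes care of those \<open>s\<close> at which
    a curve leaves the larger group. The base point of the curves is the identity.\<close>
  have zero: "F y * det_prod y = 0" for y
  proof (rule polynomial_zero_if_zero_on_curves[OF inf, where z = "\<lambda>(x, \<sigma>, i, j). if i = j then 1 else 0" and F = "\<lambda>y. F y * det_prod y"])
    show "(\<lambda>y. F y * det_prod y) \<in> polynomial_functions affine_coords"
      by (rule polynomial_functions.mult[OF F(1) det_prod_polynomial])
    fix w :: "'v \<times> bool \<times> nat \<times> nat \<Rightarrow> 'k"
    \<comment> \<open>The direction \<open>w\<close> modulo base changes; the subtraction of 1
      passes from vertex indices to matrix indices.\<close>
    define y where "y = (\<lambda>(v, v'). w (fst v, True, snd v - 1, snd v' - 1) - w (fst (v :: 'v \<times> nat), False, snd v - 1, snd (v' :: 'v \<times> nat) - 1))"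
    have "\<exists>z \<tau>. endo l z \<and> (\<forall>v\<in>verts \<Gamma>. \<forall>v'\<in>verts \<Gamma>. fst v = fst v' \<longrightarrow> tangent z \<tau> (v, v') = y (v, v'))"
    proof (rule tangent_surjective)
      show "l b \<noteq> 0" if "b \<in> bands \<Gamma>" for b using l[OF that] .
      show "l b ^ m \<noteq> l b' ^ n \<and> l b ^ m * l b' ^ n \<noteq> 1" if "b \<in> bands \<Gamma>" "b' \<in> bands \<Gamma>" "b \<noteq> b'"
        "m \<in> {1..2 * card (verts \<Gamma>)}" "n \<in> {1..2 * card (verts \<Gamma>)}" for b b' m n
        using gen[OF that] .
    qed
    then obtain z \<tau> where z: "endo l z" and tan0: "\<forall>v\<in>verts \<Gamma>. \<forall>v'\<in>verts \<Gamma>. fst v = fst v' \<longrightarrow> tangent z \<tau> (v, v') = y (v, v')"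
      by (elim exE conjE)
    have tan: "tangent z \<tau> (v, v') = w (fst v, True, snd v - 1, snd v' - 1) - w (fst v, False, snd v - 1, snd v' - 1)"
      if "v \<in> verts \<Gamma>" "v' \<in> verts \<Gamma>" "fst v = fst v'" for v v'
      using tan0 that by (simp add: y_def)
    \<comment> \<open>The torus part is zero on side \<open>False\<close>, so the base change must
      supply what the endomorphism lacks there; \<open>tangent\<close> then makes the same
      \<open>X\<close> fit on side \<open>True\<close>.\<close>
    define X where "X x = mat (\<beta> x) (\<beta> x) (\<lambda>(i, j). w (x, False, i, j) - z (x, Suc i) (x, Suc j) False)" for x
    let ?T = "torus_block \<tau>" and ?Z = "endo_block z"
    have X: "X x \<in> carrier_mat (\<beta> x) (\<beta> x)" for x by (simp add: X_def)
    have wsum: "w (x, \<sigma>, i, j) = X x $$ (i, j) + ?T x \<sigma> $$ (i, j) + ?Z x \<sigma> $$ (i, j)"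
      if "x \<in> verts Q" "i < \<beta> x" "j < \<beta> x" for x \<sigma> i j
      using tan[of "(x, Suc i)" "(x, Suc j)"] that
      by (cases \<sigma>) (auto simp: X_def torus_block_def endo_block_def diag_fun_mat_def tangent_def verts_graph algebra_simps)
    \<comment> \<open>The higher-order coefficients from \<open>one_plus_products\<close>.\<close>
    define q where "q = (\<lambda>(x, \<sigma>, i, j). [:(X x * ?T x \<sigma> + X x * ?Z x \<sigma> + ?T x \<sigma> * ?Z x \<sigma>) $$ (i, j), (X x * ?T x \<sigma> * ?Z x \<sigma>) $$ (i, j):])"
    let ?\<gamma> = "\<lambda>s p. (case p of (x, \<sigma>, i, j) \<Rightarrow> if i = j then 1 else 0) + s * (w p + s * poly (q p) s)"
    have "F (?\<gamma> s) * det_prod (?\<gamma> s) = 0" for s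
    proof (cases "det_prod (?\<gamma> s) = 0")
      case False
      define G where "G x \<sigma> = (1\<^sub>m (\<beta> x) + s \<cdot>\<^sub>m X x) * (1\<^sub>m (\<beta> x) + s \<cdot>\<^sub>m ?T x \<sigma>) * (1\<^sub>m (\<beta> x) + s \<cdot>\<^sub>m ?Z x \<sigma>)" for x \<sigma>
      have Gc: "G x \<sigma> \<in> carrier_mat (\<beta> x) (\<beta> x)" for x \<sigma> unfolding G_def
        by (intro mult_carrier_mat[of _ _ "\<beta> x"] add_carrier_mat smult_carrier_mat X block_carriers)
      have B: "block (?\<gamma> s) x \<sigma> = G x \<sigma>" if x: "x \<in> verts Q" for x \<sigma>
      proof (rule eq_matI)
        fix i j assume "i < dim_row (G x \<sigma>)" "j < dim_col (G x \<sigma>)"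
        then have ij: "i < \<beta> x" "j < \<beta> x" using Gc[of x \<sigma>] by auto
        show "block (?\<gamma> s) x \<sigma> $$ (i, j) = G x \<sigma> $$ (i, j)"
          unfolding G_def one_plus_products[OF X block_carriers(2,1) ij]
          using ij wsum[OF x ij, of \<sigma>] by (simp add: block_def q_def)
      qed (use Gc[of x \<sigma>] in \<open>auto simp: block_def\<close>)
      have eq: "conj_rep (block (?\<gamma> s)) (module l) = conj_rep G (module l)"
        unfolding conj_rep_def by (rule restrict_ext) (simp add: B wf)
      have det: "det (G x \<sigma>) \<noteq> 0" if "x \<in> verts Q" for x \<sigma>
        using False that unfolding det_prod_nonzero B[OF that, symmetric] by blast
      have "P (conj_rep G (module l)) = 0"
      proof (rule vanish)
        show "conj_rep G (module l) \<in> gl_orbit Q \<beta> (module (move_parameter l \<tau> s))"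
          by (rule curve_in_orbit(1)[where X = X, OF _ z X G_def det]) (rule l)
        show "move_parameter l \<tau> s \<in> (\<Pi>\<^sub>E b\<in>bands \<Gamma>. UNIV - {0})"
          by (rule curve_in_orbit(2)[where X = X, OF _ z X G_def det]) (rule l)
      qed
      then have "P (conj_rep (block (?\<gamma> s)) (module l)) = 0" unfolding eq .
      then show ?thesis using F(2)[OF False] by simp
    qed simp
    then show "\<exists>q. \<forall>s. F (\<lambda>p. (case p of (x, \<sigma>, i, j) \<Rightarrow> if i = j then 1 else 0) + s * (w p + s * poly (q p) s))
       * det_prod (\<lambda>p. (case p of (x, \<sigma>, i, j) \<Rightarrow> if i = j then 1 else 0) + s * (w p + s * poly (q p) s)) = 0"
      by (intro exI[of _ q]) blast
  qed
  show ?thesis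
  proof (rule that[OF l])
    fix h :: "'v \<Rightarrow> bool \<Rightarrow> 'k mat"
    assume h: "\<And>x \<sigma>. h x \<sigma> \<in> carrier_mat (\<beta> x) (\<beta> x)" "\<And>x \<sigma>. x \<in> verts Q \<Longrightarrow> det (h x \<sigma>) \<noteq> 0"
    define z where "z = (\<lambda>(x, \<sigma>, i, j). h x \<sigma> $$ (i, j))"
    have B: "block z x \<sigma> = h x \<sigma>" for x \<sigma>
      by (rule eq_matI) (use h(1)[of x \<sigma>] in \<open>auto simp: block_def z_def\<close>)
    then have "block z = h" by blast
    moreover have "det_prod z \<noteq> 0" unfolding det_prod_nonzero B using h(2) by blast
    ultimately show "P (conj_rep h (module l)) = 0" using zero[of z] F(2)[of z] by simp
  qed
qed

section \<open>Every point of the variety as a limit of conjugates of the module\<close>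

text \<open>The vectors \<open>h t\<close> form a basis for one side of \<open>x\<close>, with
  inverse matrix \<open>q\<close>. Between such bases \<open>V a\<close> acts like the first
  \<open>k a\<close> edges of \<open>a\<close>, and all further edges are missing.\<close>

definition adapted :: "('a \<Rightarrow> 'k::field mat) \<Rightarrow> ('a \<Rightarrow> nat) \<Rightarrow> ('a \<Rightarrow> nat \<Rightarrow> nat \<Rightarrow> 'k) \<Rightarrow> 'v \<Rightarrow> bool
    \<Rightarrow> (nat \<Rightarrow> nat \<Rightarrow> 'k) \<Rightarrow> (nat \<Rightarrow> nat \<Rightarrow> 'k) \<Rightarrow> bool" where
  "adapted V k u x \<sigma> h q \<longleftrightarrow>
    (\<forall>i<\<beta> x. \<forall>j<\<beta> x. (\<Sum>t<\<beta> x. h t i * q t j) = (if i = j then 1 else 0)) \<and>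
    (\<forall>a\<in>arcs Q. head Q a = x \<and> hs a = \<sigma> \<longrightarrow>
       (\<forall>i<k a. h (hpos a (Suc i)) = apply_mat (V a) (u a i))) \<and>
    (\<forall>a\<in>arcs Q. tail Q a = x \<and> ts a = \<sigma> \<longrightarrow> (\<forall>i<k a. h (tpos a (Suc i)) = u a i) \<and>
       (\<forall>j<\<beta> x. j \<notin> (\<lambda>i. tpos a (Suc i)) ` {..<k a} \<longrightarrow> apply_mat (V a) (h j) = 0))"

text \<open>Arrows meeting on one side compose to zero, so the image of the incoming map lies in the
  kernel of the outgoing one; this is the hypothesis of \<open>adapted_basis\<close>. The positions
  of heads and tails are disjoint by the structure of the graph.\<close>

lemma adapted_sides:
  fixes V :: "'a \<Rightarrow> 'k::field mat"
  assumes V: "V \<in> rep_variety Q c \<beta> r"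
    and k: "\<And>a. a \<in> arcs Q \<Longrightarrow> k a \<le> r a"
    and u: "\<And>a i. a \<in> arcs Q \<Longrightarrow> i < k a \<Longrightarrow> u a i \<in> coord_space (tdim a)"
      "\<And>a. a \<in> arcs Q \<Longrightarrow> indep_family (k a) (\<lambda>i. apply_mat (V a) (u a i))"
      "\<And>a v. a \<in> arcs Q \<Longrightarrow> v \<in> coord_space (tdim a) \<Longrightarrow>
         \<exists>d. apply_mat (V a) v = (\<Sum>i<k a. fscale (d i) (apply_mat (V a) (u a i)))"
    and x: "x \<in> verts Q"
  shows "\<exists>h q. adapted V k u x \<sigma> h q"
proof -
  let ?f = "\<lambda>a i. tpos a (Suc i)" and ?g = "\<lambda>a i. hpos a (Suc i)"
  have e: "edge_at a (Suc i) (?f a i) (?g a i)" if "a \<in> arcs Q" "i < k a" for a i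
    using k[OF that(1)] that by (intro edge_at_pos) (simp add: arcs_graph)
  have inj: "inj_on (?f a) {..<k a}" "inj_on (?g a) {..<k a}" if a: "a \<in> arcs Q" for a
    using edge_at_unique[OF e[OF a] e[OF a]] by (auto intro!: inj_onI)
  have Vc: "V a \<in> carrier_mat (hdim a) (tdim a)" if "a \<in> arcs Q" for a
    using V that by (auto simp: rep_variety_def rep_space_def)
  have rel: "apply_mat (V b) (apply_mat (V a) v) = 0"
    if ab: "a \<in> arcs Q" "b \<in> arcs Q" "head Q a = tail Q b" "hs a = ts b" for a b v
  proof
    fix i
    have VV: "V b * V a = 0\<^sub>m (\<beta> (head Q b)) (tdim a)"
      using V ab composable by (auto simp: rep_variety_def)
    have dims: "dim_row (V a) = hdim a" "dim_col (V a) = tdim a"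
      "dim_row (V b) = \<beta> (head Q b)" "dim_col (V b) = hdim a" using Vc[OF ab(1)] Vc[OF ab(2)] ab(3) by auto
    show "apply_mat (V b) (apply_mat (V a) v) i = 0 i"
    proof (cases "i < \<beta> (head Q b)")
      case True
      have "apply_mat (V b) (apply_mat (V a) v) i
          = (\<Sum>j<hdim a. \<Sum>m<tdim a. V b $$ (i, j) * V a $$ (j, m) * v m)"
        using True by (simp add: apply_mat_def dims sum_distrib_left mult.assoc)
      also have "\<dots> = (\<Sum>m<tdim a. (\<Sum>j<hdim a. V b $$ (i, j) * V a $$ (j, m)) * v m)"
        by (subst sum.swap) (simp add: sum_distrib_right)
      also have "\<dots> = (\<Sum>m<tdim a. (V b * V a) $$ (i, m) * v m)"
      proof (rule sum.cong)
        fix m assume "m \<in> {..<tdim a}"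
        moreover have "V b \<in> carrier_mat (\<beta> (head Q b)) (hdim a)" using Vc[OF ab(2)] ab(3) by simp
        ultimately show "(\<Sum>j<hdim a. V b $$ (i, j) * V a $$ (j, m)) * v m = (V b * V a) $$ (i, m) * v m"
          using mat_mult_index[OF _ Vc[OF ab(1)] True, of "V b" m] by simp
      qed simp
      also have "\<dots> = 0" unfolding VV using True by simp
      finally show ?thesis by simp
    qed (simp add: apply_mat_def dims)
  qed
  \<comment> \<open>A uniform description of the outgoing side: if no arrow leaves \<open>x\<close>
    there, a map to dimension 0 and an empty family take its place. The incoming side is treated
    likewise below.\<close>
  obtain A m u' f' where O:
    "\<And>i. i < m \<Longrightarrow> u' i \<in> coord_space (\<beta> x)" "indep_family m (\<lambda>i. apply_mat A (u' i))"
    "\<And>v. v \<in> coord_space (\<beta> x) \<Longrightarrow> \<exists>d. apply_mat A v = (\<Sum>i<m. fscale (d i) (apply_mat A (u' i)))"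
    "inj_on f' {..<m}" "f' ` {..<m} \<subseteq> {..<\<beta> x}"
    and O2: "\<And>b. b \<in> arcs Q \<Longrightarrow> tail Q b = x \<Longrightarrow> ts b = \<sigma> \<Longrightarrow> A = V b \<and> m = k b \<and> u' = u b \<and> f' = ?f b"
    and O3: "\<And>i. i < m \<Longrightarrow> ((x, Suc (f' i)), \<sigma>) \<in> tdart ` arcs \<Gamma>"
    and O4: "\<And>a v. a \<in> arcs Q \<Longrightarrow> head Q a = x \<Longrightarrow> hs a = \<sigma> \<Longrightarrow> apply_mat A (apply_mat (V a) v) = 0"
  proof (cases "\<exists>b\<in>arcs Q. tail Q b = x \<and> ts b = \<sigma>")
    case True
    then obtain b where b: "b \<in> arcs Q" "tail Q b = x" "ts b = \<sigma>" by blast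
    show ?thesis
    proof (rule that[of "k b" "u b" "V b" "?f b"])
      show "V b = V b' \<and> k b = k b' \<and> u b = u b' \<and> ?f b = ?f b'"
        if "b' \<in> arcs Q" "tail Q b' = x" "ts b' = \<sigma>" for b'
        using out_unique[of b b'] b that by auto
      show "((x, Suc (?f b i)), \<sigma>) \<in> tdart ` arcs \<Gamma>" if "i < k b" for i
        using e[OF b(1) that] b by (auto simp: tdart_def edge_at_def image_iff intro!: bexI[of _ "(b, Suc i)"])
      show "?f b ` {..<k b} \<subseteq> {..<\<beta> x}" using edge_at_bounds(1)[OF e[OF b(1)]] b(2) by auto
    qed (use u[OF b(1)] inj(1)[OF b(1)] rel b in auto)
  next
    case False
    have A: "apply_mat (0\<^sub>m 0 (\<beta> x)) v = 0" for v :: "nat \<Rightarrow> 'k" by (auto simp: apply_mat_def)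
    show ?thesis
      by (rule that[of 0 "\<lambda>_. 0" "0\<^sub>m 0 (\<beta> x)" "\<lambda>i. i"]) (use False in \<open>auto simp: A indep_family_def\<close>)
  qed
  obtain l w g' where I:
    "\<And>i. i < l \<Longrightarrow> w i \<in> coord_space (\<beta> x)" "\<And>i. i < l \<Longrightarrow> apply_mat A (w i) = 0" "indep_family l w"
    "inj_on g' {..<l}" "g' ` {..<l} \<subseteq> {..<\<beta> x}"
    and I2: "\<And>a. a \<in> arcs Q \<Longrightarrow> head Q a = x \<Longrightarrow> hs a = \<sigma> \<Longrightarrow> l = k a \<and> w = (\<lambda>i. apply_mat (V a) (u a i)) \<and> g' = ?g a"
    and I3: "\<And>i. i < l \<Longrightarrow> ((x, Suc (g' i)), \<sigma>) \<in> hdart ` arcs \<Gamma>"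
  proof (cases "\<exists>a\<in>arcs Q. head Q a = x \<and> hs a = \<sigma>")
    case True
    then obtain a where a: "a \<in> arcs Q" "head Q a = x" "hs a = \<sigma>" by blast
    show ?thesis
    proof (rule that[of "k a" "\<lambda>i. apply_mat (V a) (u a i)" "?g a"])
      show "k a = k a' \<and> (\<lambda>i. apply_mat (V a) (u a i)) = (\<lambda>i. apply_mat (V a') (u a' i)) \<and> ?g a = ?g a'"
        if "a' \<in> arcs Q" "head Q a' = x" "hs a' = \<sigma>" for a'
        using in_unique[of a a'] a that by auto
      show "((x, Suc (?g a i)), \<sigma>) \<in> hdart ` arcs \<Gamma>" if "i < k a" for i
        using e[OF a(1) that] a by (auto simp: hdart_def edge_at_def image_iff intro!: bexI[of _ "(a, Suc i)"])
      show "?g a ` {..<k a} \<subseteq> {..<\<beta> x}" using edge_at_bounds(2)[OF e[OF a(1)]] a(2) by auto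
      show "apply_mat (V a) (u a i) \<in> coord_space (\<beta> x)" for i
        using Vc[OF a(1)] a(2) by (auto simp: coord_space_def apply_mat_def)
    qed (use u(2)[OF a(1)] inj(2)[OF a(1)] O4[OF a] in auto)
  next
    case False
    show ?thesis
      by (rule that[of 0 "\<lambda>_. 0" "\<lambda>i. i"]) (use False in \<open>auto simp: indep_family_def\<close>)
  qed
  have disj: "f' ` {..<m} \<inter> g' ` {..<l} = {}"
  proof (rule ccontr)
    assume "f' ` {..<m} \<inter> g' ` {..<l} \<noteq> {}"
    then obtain i i' where i: "i < m" "i' < l" "f' i = g' i'" by auto
    obtain e where e: "e \<in> arcs \<Gamma>" "((x, Suc (f' i)), \<sigma>) = tdart e" using O3[OF i(1)] by blast
    obtain e' where e': "e' \<in> arcs \<Gamma>" "((x, Suc (g' i')), \<sigma>) = hdart e'" using I3[OF i(2)] by blast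
    show False using tdart_neq_hdart[OF e(1) e'(1)] e(2) e'(2) i(3) by simp
  qed
  show ?thesis
  proof (rule adapted_basis[OF I(1-3) O(1-5) I(4,5) disj])
    fix h q
    assume h: "\<And>i. i < m \<Longrightarrow> h (f' i) = u' i" "\<And>i. i < l \<Longrightarrow> h (g' i) = w i"
    "\<And>j. j < \<beta> x \<Longrightarrow> h j \<in> coord_space (\<beta> x)" "\<And>j. j < \<beta> x \<Longrightarrow> j \<notin> f' ` {..<m} \<Longrightarrow> apply_mat A (h j) = 0"
    "\<And>i j. i < \<beta> x \<Longrightarrow> j < \<beta> x \<Longrightarrow> (\<Sum>t<\<beta> x. h t i * q t j) = (if i = j then 1 else 0)"
    show ?thesis
      unfolding adapted_def
    proof (rule exI[of _ h], rule exI[of _ q], intro conjI ballI impI allI)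
      fix a i assume "a \<in> arcs Q" "head Q a = x \<and> hs a = \<sigma>" "i < k a"
      then show "h (?g a i) = apply_mat (V a) (u a i)" using h(2)[of i] I2[of a] by auto
    next
      fix a i assume "a \<in> arcs Q" "tail Q a = x \<and> ts a = \<sigma>" "i < k a"
      then show "h (?f a i) = u a i" using h(1)[of i] O2[of a] by auto
    next
      fix a j assume "a \<in> arcs Q" "tail Q a = x \<and> ts a = \<sigma>" "j < \<beta> x" "j \<notin> ?f a ` {..<k a}"
      then show "apply_mat (V a) (h j) = 0" using h(4)[of j] O2[of a] by auto
    qed (use h(5) in auto)
  qed
qed

text \<open>Adapted bases write \<open>V\<close> as a conjugate of a partial module, in which some of the edges have
  weight \<open>0\<close>. Replacing these weights by \<open>t\<close> gives a curve through \<open>V\<close> which for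
  \<open>t \<noteq> 0\<close> consists of conjugates of the full module.\<close>

lemma vanishing_rep_variety:
  fixes P :: "('a \<Rightarrow> 'k::field mat) \<Rightarrow> 'k"
  assumes inf: "infinite (UNIV :: 'k set)"
    and P: "P \<in> polynomial_functions (rep_coordinates Q \<beta>)"
    and l: "\<And>b. b \<in> bands \<Gamma> \<Longrightarrow> l b \<noteq> 0"
    and vanish: "\<And>h. (\<And>x \<sigma>. h x \<sigma> \<in> carrier_mat (\<beta> x) (\<beta> x)) \<Longrightarrow> (\<And>x \<sigma>. x \<in> verts Q \<Longrightarrow> det (h x \<sigma>) \<noteq> 0) \<Longrightarrow>
       P (conj_rep h (module l)) = 0"
    and V: "V \<in> rep_variety Q c \<beta> r"
  shows "P V = 0"
proof -
  have Vc: "V a \<in> carrier_mat (hdim a) (tdim a)" if "a \<in> arcs Q" for a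
    using V that by (auto simp: rep_variety_def rep_space_def)
  have rk: "vec_space.rank (hdim a) (V a) \<le> r a" if "a \<in> arcs Q" for a
    using V that by (auto simp: rep_variety_def)
  have "\<forall>a. \<exists>p. a \<in> arcs Q \<longrightarrow> fst p \<le> r a \<and> (\<forall>i<fst p. snd p i \<in> coord_space (tdim a)) \<and>
    indep_family (fst p) (\<lambda>i. apply_mat (V a) (snd p i)) \<and>
    (\<forall>v\<in>coord_space (tdim a). \<exists>d. apply_mat (V a) v = (\<Sum>i<fst p. fscale (d i) (apply_mat (V a) (snd p i))))"
  proof
    fix a
    show "\<exists>p. a \<in> arcs Q \<longrightarrow> fst p \<le> r a \<and> (\<forall>i<fst p. snd p i \<in> coord_space (tdim a)) \<and>
      indep_family (fst p) (\<lambda>i. apply_mat (V a) (snd p i)) \<and>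
      (\<forall>v\<in>coord_space (tdim a). \<exists>d. apply_mat (V a) v = (\<Sum>i<fst p. fscale (d i) (apply_mat (V a) (snd p i))))"
    proof (cases "a \<in> arcs Q")
      case True
      show ?thesis
      proof (rule rank_image_basis[OF Vc[OF True]])
        fix k u assume "k \<le> vec_space.rank (hdim a) (V a)" "\<And>i. i < k \<Longrightarrow> u i \<in> coord_space (tdim a)"
          "indep_family k (\<lambda>i. apply_mat (V a) (u i))"
          "\<And>v. v \<in> coord_space (tdim a) \<Longrightarrow> \<exists>d. apply_mat (V a) v = (\<Sum>i<k. fscale (d i) (apply_mat (V a) (u i)))"
        then show ?thesis using rk[OF True] by (intro exI[of _ "(k, u)"]) auto
      qed
    qed auto
  qed
  then obtain p where p: "\<forall>a. a \<in> arcs Q \<longrightarrow> fst (p a) \<le> r a \<and> (\<forall>i<fst (p a). snd (p a) i \<in> coord_space (tdim a)) \<and>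
    indep_family (fst (p a)) (\<lambda>i. apply_mat (V a) (snd (p a) i)) \<and>
    (\<forall>v\<in>coord_space (tdim a). \<exists>d. apply_mat (V a) v = (\<Sum>i<fst (p a). fscale (d i) (apply_mat (V a) (snd (p a) i))))"
    by (rule Hilbert_Choice.choice[THEN exE])
  define k where "k a = fst (p a)" for a
  define u where "u a = snd (p a)" for a
  have k: "k a \<le> r a" and u: "i < k a \<Longrightarrow> u a i \<in> coord_space (tdim a)"
    "indep_family (k a) (\<lambda>i. apply_mat (V a) (u a i))"
    "v \<in> coord_space (tdim a) \<Longrightarrow> \<exists>d. apply_mat (V a) v = (\<Sum>i<k a. fscale (d i) (apply_mat (V a) (u a i)))"
    if "a \<in> arcs Q" for a i v
    using p that unfolding k_def u_def by auto
  have "\<forall>y. \<exists>hq. fst y \<in> verts Q \<longrightarrow> adapted V k u (fst y) (snd y) (fst hq) (snd hq)"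
  proof
    fix y :: "'v \<times> bool"
    show "\<exists>hq. fst y \<in> verts Q \<longrightarrow> adapted V k u (fst y) (snd y) (fst hq) (snd hq)"
    proof (cases "fst y \<in> verts Q")
      case True
      have "\<exists>h q. adapted V k u (fst y) (snd y) h q"
        by (rule adapted_sides[OF V _ _ _ _ True]) (assumption | rule k u)+
      then obtain h q where "adapted V k u (fst y) (snd y) h q" by blast
      then show ?thesis by (intro exI[of _ "(h, q)"]) simp
    qed auto
  qed
  then obtain hq where hq: "\<forall>y. fst y \<in> verts Q \<longrightarrow> adapted V k u (fst y) (snd y) (fst (hq y)) (snd (hq y))"
    by (rule Hilbert_Choice.choice[THEN exE])
  define H where "H x \<sigma> = mat (\<beta> x) (\<beta> x) (\<lambda>(i, j). fst (hq (x, \<sigma>)) j i)" for x \<sigma>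
  define K where "K x \<sigma> = mat (\<beta> x) (\<beta> x) (\<lambda>(i, j). snd (hq (x, \<sigma>)) i j)" for x \<sigma>
  have HKc: "H x \<sigma> \<in> carrier_mat (\<beta> x) (\<beta> x)" "K x \<sigma> \<in> carrier_mat (\<beta> x) (\<beta> x)" for x \<sigma>
    by (simp_all add: H_def K_def)
  have HK: "H x \<sigma> * K x \<sigma> = 1\<^sub>m (\<beta> x)" if "x \<in> verts Q" for x \<sigma>
  proof (rule eq_matI)
    fix i j assume "i < dim_row (1\<^sub>m (\<beta> x) :: 'k mat)" "j < dim_col (1\<^sub>m (\<beta> x) :: 'k mat)"
    then have ij: "i < \<beta> x" "j < \<beta> x" by auto
    have "adapted V k u x \<sigma> (fst (hq (x, \<sigma>))) (snd (hq (x, \<sigma>)))" using hq that by (metis fst_conv snd_conv)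
    then have "(\<Sum>t<\<beta> x. fst (hq (x, \<sigma>)) t i * snd (hq (x, \<sigma>)) t j) = (if i = j then 1 else 0)"
      using ij unfolding adapted_def by blast
    then show "(H x \<sigma> * K x \<sigma>) $$ (i, j) = 1\<^sub>m (\<beta> x) $$ (i, j)"
      unfolding mat_mult_index[OF HKc ij] using ij by (simp add: H_def K_def)
  qed (use HKc[of x \<sigma>] in auto)
  \<comment> \<open>Weight 1 on the edges realised by \<open>V\<close> and \<open>t\<close> on the
    missing ones.\<close>
  define n where "n t a m = (if \<exists>i<k a. m = hpos a (Suc i) then 1 else t)" for t :: 'k and a m
  \<comment> \<open>The fixed inverse \<open>K\<close> is used at the tail, so no inverse depends on
    \<open>t\<close> and the curve is polynomial.\<close>
  define W where "W t = (\<lambda>a\<in>arcs Q. H (head Q a) (hs a) * edge_mat a (n t a) * K (tail Q a) (ts a))" for t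
  have col: "V a * H (tail Q a) (ts a) = H (head Q a) (hs a) * edge_mat a (n 0 a)" if a: "a \<in> arcs Q" for a
  proof (rule eq_matI)
    note w = wf[OF a]
    have gt: "adapted V k u (tail Q a) (ts a) (fst (hq (tail Q a, ts a))) (snd (hq (tail Q a, ts a)))"
      and gh: "adapted V k u (head Q a) (hs a) (fst (hq (head Q a, hs a))) (snd (hq (head Q a, hs a)))"
      using hq[rule_format, of "(tail Q a, ts a)"] hq[rule_format, of "(head Q a, hs a)"] w by simp_all
    let ?ht = "fst (hq (tail Q a, ts a))" and ?hh = "fst (hq (head Q a, hs a))"
    have t1: "?ht (tpos a (Suc i)) = u a i" if "i < k a" for i using gt a that unfolding adapted_def by blast
    have t2: "apply_mat (V a) (?ht j) = 0" if "j < tdim a" "j \<notin> (\<lambda>i. tpos a (Suc i)) ` {..<k a}" for j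
      using gt a that unfolding adapted_def by blast
    have h1: "?hh (hpos a (Suc i)) = apply_mat (V a) (u a i)" if "i < k a" for i using gh a that unfolding adapted_def by blast
    have e: "edge_at a (Suc i) (tpos a (Suc i)) (hpos a (Suc i))" if "i < k a" for i
      using k[OF a] that a by (intro edge_at_pos) (simp add: arcs_graph)
    fix i' j assume "i' < dim_row (H (head Q a) (hs a) * edge_mat a (n 0 a))" "j < dim_col (H (head Q a) (hs a) * edge_mat a (n 0 a))"
    then have ij: "i' < hdim a" "j < tdim a" by (simp_all add: H_def edge_mat_def)
    have L: "(V a * H (tail Q a) (ts a)) $$ (i', j) = apply_mat (V a) (?ht j) i'"
      unfolding mat_mult_index[OF Vc[OF a] HKc(1) ij] using Vc[OF a] ij by (auto simp: apply_mat_def H_def)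
    show "(V a * H (tail Q a) (ts a)) $$ (i', j) = (H (head Q a) (hs a) * edge_mat a (n 0 a)) $$ (i', j)"
    proof (cases "j \<in> (\<lambda>i. tpos a (Suc i)) ` {..<k a}")
      case True
      then obtain i where i: "i < k a" "j = tpos a (Suc i)" by auto
      note ei = e[OF i(1), folded i(2)]
      have "n 0 a (hpos a (Suc i)) = 1" using i(1) by (auto simp: n_def)
      then show ?thesis
        unfolding L mult_edge_mat[OF HKc(1) ei ij(1)] using t1[OF i(1)] h1[OF i(1)] i(2) ij(1) edge_at_bounds(2)[OF ei]
        by (simp add: H_def)
    next
      case nk: False
      then have 0: "apply_mat (V a) (?ht j) = 0" by (rule t2[OF ij(2)])
      show ?thesis
      proof (cases "\<exists>i k'. edge_at a i j k'")
        case True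
        then obtain i k' where ei: "edge_at a i j k'" by blast
        have "k' \<noteq> hpos a (Suc m)" if "m < k a" for m
        proof
          assume "k' = hpos a (Suc m)"
          then have "j = tpos a (Suc m)" using edge_at_unique[OF ei e[OF that]] by simp
          then show False using nk that by blast
        qed
        then have "n 0 a k' = 0" by (auto simp: n_def)
        then show ?thesis unfolding L 0 mult_edge_mat[OF HKc(1) ei ij(1)] by simp
      next
        case False
        show ?thesis unfolding L 0 mult_edge_mat_0[OF HKc(1) False ij] by simp
      qed
    qed
  qed (use Vc[OF a] in \<open>simp_all add: H_def edge_mat_def\<close>)
  have W0: "W 0 = V"
  proof
    fix a
    show "W 0 a = V a"
    proof (cases "a \<in> arcs Q")
      case True
      have "W 0 a = V a * H (tail Q a) (ts a) * K (tail Q a) (ts a)" using True by (simp add: W_def col)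
      also have "\<dots> = V a * (H (tail Q a) (ts a) * K (tail Q a) (ts a))"
        by (rule assoc_mult_mat[OF Vc[OF True] HKc])
      finally show ?thesis using HK[OF wf(1)[OF True]] Vc[OF True] by simp
    next
      case False
      then show ?thesis using V by (auto simp: W_def rep_variety_def rep_space_def PiE_def extensional_def)
    qed
  qed
  have Wt: "P (W t) = 0" if t: "t \<noteq> 0" for t
  proof -
    \<comment> \<open>Rescaling the heads turns every weight of the module into \<open>n t\<close>.
      The tails keep factor 1, which is consistent because no dart is both a head and a tail; the
      arrow is recovered from the head dart.\<close>
    define \<delta> where "\<delta> v \<sigma> = (if (v, \<sigma>) \<in> hdart ` arcs \<Gamma>
      then n t (fst (the_inv_into (arcs \<Gamma>) hdart (v, \<sigma>))) (snd v - 1) / head_weight \<Theta> l (v, \<sigma>) else 1)" for v \<sigma>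
    have nz: "\<delta> v \<sigma> \<noteq> 0" for v \<sigma>
      using t by (simp add: \<delta>_def n_def head_weight_nonzero l)
    define D where "D x \<sigma> = diag_fun_mat (\<beta> x) (\<lambda>j. \<delta> (x, Suc j) \<sigma>)" for x \<sigma>
    have Dc: "D x \<sigma> \<in> carrier_mat (\<beta> x) (\<beta> x)" for x \<sigma> by (simp add: D_def)
    have dD: "det (D x \<sigma>) \<noteq> 0" for x \<sigma>
      unfolding D_def by (rule det_nonzero_if_inverse[OF _ _ diag_fun_mat_inverse]) (simp_all add: nz)
    have dH: "det (H x \<sigma>) \<noteq> 0" if "x \<in> verts Q" for x \<sigma>
      by (rule det_nonzero_if_inverse[OF HKc HK[OF that]])
    have dHD: "det (H x \<sigma> * D x \<sigma>) \<noteq> 0" if "x \<in> verts Q" for x \<sigma>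
      using det_mult[OF HKc(1) Dc] dH[OF that] dD by simp
    have DM: "D (head Q a) (hs a) * module l a = edge_mat a (n t a) * D (tail Q a) (ts a)" if a: "a \<in> arcs Q" for a
      unfolding module_apply[OF a] D_def
    proof (rule edge_mat_intertwine_diag)
      fix i j k
      assume e: "edge_at a i j k"
      note arc = edge_at_arc[OF e]
      have "((tail Q a, Suc j), ts a) = tdart (a, i)" using e by (simp add: tdart_def edge_at_def)
      then have "((tail Q a, Suc j), ts a) \<notin> hdart ` arcs \<Gamma>" using tdart_neq_hdart[OF arc] by auto
      then have \<delta>t: "\<delta> (tail Q a, Suc j) (ts a) = 1" by (simp add: \<delta>_def)
      have hd: "((head Q a, Suc k), hs a) = hdart (a, i)" using e by (simp add: hdart_def edge_at_def)
      then have "the_inv_into (arcs \<Gamma>) hdart ((head Q a, Suc k), hs a) = (a, i)"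
        by (simp add: the_inv_into_f_f[OF inj_hdart arc])
      moreover have "((head Q a, Suc k), hs a) \<in> hdart ` arcs \<Gamma>" using hd arc by simp
      ultimately have "\<delta> (head Q a, Suc k) (hs a) = n t a k / head_weight \<Theta> l ((head Q a, Suc k), hs a)"
        by (simp add: \<delta>_def)
      moreover have "head_weight \<Theta> l ((head Q a, Suc k), hs a) \<noteq> 0" by (rule head_weight_nonzero[OF l])
      ultimately show "\<delta> (head Q a, Suc k) (hs a) * head_weight \<Theta> l ((head Q a, Suc k), hs a)
          = n t a k * \<delta> (tail Q a, Suc j) (ts a)"
        using \<delta>t by simp
    qed
    have "W t = conj_rep (\<lambda>x \<sigma>. H x \<sigma> * D x \<sigma>) (module l)"
      unfolding W_def conj_rep_def
    proof (rule restrict_ext)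
      fix a assume a: "a \<in> arcs Q"
      let ?h = "head Q a" and ?t = "tail Q a"
      let ?Hh = "H ?h (hs a)" and ?Dh = "D ?h (hs a)" and ?Ht = "H ?t (ts a)" and ?Dt = "D ?t (ts a)" and ?E = "edge_mat a (n t a)"
      have HDc: "?Ht * ?Dt \<in> carrier_mat (\<beta> ?t) (\<beta> ?t)" by (rule mult_carrier_mat[OF HKc(1) Dc])
      note i = inv_mat[OF HDc dHD[OF wf(1)[OF a]]]
      have "?Ht * (?Dt * inv_mat (?Ht * ?Dt)) = 1\<^sub>m (\<beta> ?t)"
        using assoc_mult_mat[OF HKc(1) Dc i(1)] i(2) by simp
      then have K: "?Dt * inv_mat (?Ht * ?Dt) = K ?t (ts a)"
        by (intro inverse_mat_unique[OF HKc(1) _ HKc(2) _ HK[OF wf(1)[OF a]]] mult_carrier_mat[OF Dc i(1)])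
      have "?Hh * ?Dh * module l a = ?Hh * (?Dh * module l a)"
        by (rule assoc_mult_mat[OF HKc(1) Dc module_carrier[OF a]])
      also have "\<dots> = ?Hh * ?E * ?Dt"
        unfolding DM[OF a] by (rule assoc_mult_mat[symmetric, OF HKc(1) edge_mat_carrier Dc])
      finally have "?Hh * ?Dh * module l a * inv_mat (?Ht * ?Dt) = ?Hh * ?E * ?Dt * inv_mat (?Ht * ?Dt)" by simp
      also have "\<dots> = ?Hh * ?E * K ?t (ts a)"
        unfolding K[symmetric] by (rule assoc_mult_mat[OF mult_carrier_mat[OF HKc(1) edge_mat_carrier] Dc i(1)])
      finally show "?Hh * ?E * K ?t (ts a) = ?Hh * ?Dh * module l a * inv_mat (?Ht * ?Dt)" by simp
    qed
    then show ?thesis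
      using vanish[of "\<lambda>x \<sigma>. H x \<sigma> * D x \<sigma>"] mult_carrier_mat[OF HKc(1) Dc] dHD by simp
  qed
  have "\<exists>q. \<forall>t. P (W t) = poly q t"
  proof (rule polynomial_functions_on_curve[OF P])
    fix f :: "('a \<Rightarrow> 'k mat) \<Rightarrow> 'k" assume "f \<in> rep_coordinates Q \<beta>"
    then obtain a i j where f: "f = (\<lambda>V. V a $$ (i, j))" and a: "a \<in> arcs Q" and ij: "i < hdim a" "j < tdim a"
      by (auto simp: rep_coordinates_def)
    let ?X = "{\<lambda>t. t} :: ('k \<Rightarrow> 'k) set"
    have id: "(\<lambda>t. t) \<in> polynomial_functions ?X" by (rule polynomial_functions.coord) simp
    have "(\<lambda>t. if A then if B then 1 else t else 0) \<in> polynomial_functions ?X" for A B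
      by (cases A; cases B; simp add: polynomial_functions.const id)
    then have E: "(\<lambda>t. edge_mat a (n t a) $$ (i, j)) \<in> polynomial_functions ?X" if "i < hdim a" "j < tdim a" for i j
      unfolding edge_mat_def n_def using that by simp
    have "(\<lambda>t. (H (head Q a) (hs a) * edge_mat a (n t a) * K (tail Q a) (ts a)) $$ (i, j)) \<in> polynomial_functions ?X"
      by (rule mat_mult_polynomial[OF mult_carrier_mat[OF HKc(1) edge_mat_carrier] HKc(2) _ polynomial_functions.const ij])
        (rule mat_mult_polynomial[OF HKc(1) edge_mat_carrier polynomial_functions.const E])
    then have "\<exists>q. \<forall>t. (H (head Q a) (hs a) * edge_mat a (n t a) * K (tail Q a) (ts a)) $$ (i, j) = poly q t"
      by (rule polynomial_functions_on_curve[where \<gamma> = "\<lambda>t. t"]) (auto intro: exI[of _ "[:0, 1:]"])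
    then show "\<exists>q. \<forall>t. f (W t) = poly q t" using a by (simp add: f W_def)
  qed
  then obtain q where q: "\<And>t. P (W t) = poly q t" by blast
  have "q = 0"
    by (rule poly_eq_0_if_infinite_zeros[of "UNIV - {0}"]) (use inf Wt q in auto)
  then show ?thesis using q[of 0] W0 by simp
qed

end

section \<open>Colorings and sides\<close>

text \<open>At most one of two distinct elements can be the last entry.\<close>

lemma two_in_list_followed:
  assumes "a \<in> set p" "a' \<in> set p" "a \<noteq> a'"
  obtains x b xs ys where "x \<in> {a, a'}" "p = xs @ x # b # ys"
proof -
  obtain xs ys where p: "p = xs @ a # ys" using assms(1) by (auto dest: split_list)
  show ?thesis
  proof (cases ys)
    case (Cons b zs)
    then show ?thesis using that[of a xs b zs] p by simp
  next
    case Nil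
    then have "a' \<in> set xs" using p assms by auto
    then obtain us vs where "xs = us @ a' # vs" by (auto dest: split_list)
    then have "p = us @ a' # (vs @ [a])" using p Nil by simp
    then show ?thesis using that[of a' us] by (cases "vs @ [a]") auto
  qed
qed

lemma two_in_list_preceded:
  assumes "a \<in> set p" "a' \<in> set p" "a \<noteq> a'"
  obtains x b xs ys where "x \<in> {a, a'}" "p = xs @ b # x # ys"
proof -
  obtain x b xs ys where x: "x \<in> {a, a'}" "rev p = xs @ x # b # ys"
    by (rule two_in_list_followed[of a "rev p" a']) (use assms in auto)
  then have "p = rev (xs @ x # b # ys)" by (metis rev_rev_ident)
  then have "p = rev ys @ b # x # rev xs" by simp
  then show ?thesis using that x(1) by blast
qed

lemma cas_consecutive:
  assumes "pre_digraph.cas Q u (xs @ a # b # ys) v" shows "head Q a = tail Q b"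
  using assms by (auto simp: cas_append pre_digraph.cas.simps)

lemma color_path_in_ideal:
  assumes "a \<in> arcs Q" "b \<in> arcs Q" "head Q a = tail Q b" "c a = c b"
  shows "path_elem Q [a, b] \<in> color_ideal Q c"
  using assms unfolding color_ideal_def genideal_def by blast

lemma color_class_path:
  assumes "coloring Q S c" "a \<in> arcs Q"
  obtains u p v where "pre_digraph.cas Q u p v" "set p = {b \<in> arcs Q. c b = c a}"
proof -
  have "c a \<in> S" using assms by (auto simp: coloring_def)
  then obtain u p v where "pre_digraph.trail Q u p v" "set p = {b \<in> arcs Q. c b = c a}"
    using assms(1) unfolding coloring_def by blast
  then show ?thesis using that by (auto simp: pre_digraph.trail_def pre_digraph.awalk_def)
qed

lemma gentle_uniq:
  assumes "gentle_string_algebra Q I" "b \<in> arcs Q"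
  shows "\<exists>\<^sub>\<le>\<^sub>1 a. a \<in> arcs Q \<and> tail Q a = head Q b \<and> path_elem Q [b, a] \<in> I"
    and "\<exists>\<^sub>\<le>\<^sub>1 d. d \<in> arcs Q \<and> head Q d = tail Q b \<and> path_elem Q [d, b] \<in> I"
  using assms unfolding gentle_string_algebra_def by blast+

text \<open>Of two arrows of one color, one is followed by some \<open>b\<close> on the path of this
  color. If their heads agree, both compose with \<open>b\<close> to a relation, which the gentle
  condition forbids.\<close>

lemma color_head_unique:
  assumes col: "coloring Q S c" 
    and gentle: "gentle_string_algebra Q (color_ideal Q c :: (('v, 'a) path \<Rightarrow>\<^sub>0 'k::field) set)"
    and a: "a \<in> arcs Q" "a' \<in> arcs Q" "head Q a = head Q a'" "c a = c a'"
  shows "a = a'"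
proof (rule ccontr)
  assume ne: "a \<noteq> a'"
  obtain u p v where p: "pre_digraph.cas Q u p v" "set p = {b \<in> arcs Q. c b = c a}"
    by (rule color_class_path[OF col a(1)])
  have "a \<in> set p" "a' \<in> set p" using a p(2) by auto
  then obtain x b xs ys where x: "x \<in> {a, a'}" "p = xs @ x # b # ys"
    using ne by (rule two_in_list_followed)
  have "head Q x = tail Q b" using p(1) unfolding x(2) by (rule cas_consecutive)
  moreover have b: "b \<in> arcs Q" "c b = c a" using p(2) x(2) by auto
  ultimately have "head Q a = tail Q b" "head Q a' = tail Q b" using x(1) a by auto
  moreover note color_path_in_ideal[of a Q b c] color_path_in_ideal[of a' Q b c]
  ultimately show False
    using gentle_uniq(2)[OF gentle b(1)] a b ne unfolding Uniq_def by metis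
qed

text \<open>Dual to \<open>color_head_unique\<close>, with an arrow that precedes one of the
  two.\<close>

lemma color_tail_unique:
  assumes col: "coloring Q S c" 
    and gentle: "gentle_string_algebra Q (color_ideal Q c :: (('v, 'a) path \<Rightarrow>\<^sub>0 'k::field) set)"
    and a: "a \<in> arcs Q" "a' \<in> arcs Q" "tail Q a = tail Q a'" "c a = c a'"
  shows "a = a'"
proof (rule ccontr)
  assume ne: "a \<noteq> a'"
  obtain u p v where p: "pre_digraph.cas Q u p v" "set p = {b \<in> arcs Q. c b = c a}"
    by (rule color_class_path[OF col a(1)])
  have "a \<in> set p" "a' \<in> set p" using a p(2) by auto
  then obtain x b xs ys where x: "x \<in> {a, a'}" "p = xs @ b # x # ys"
    using ne by (rule two_in_list_preceded)
  have "head Q b = tail Q x" using p(1) unfolding x(2) by (rule cas_consecutive)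
  moreover have b: "b \<in> arcs Q" "c b = c a" using p(2) x(2) by auto
  ultimately have "head Q b = tail Q a" "head Q b = tail Q a'" using x(1) a by auto
  moreover note color_path_in_ideal[of b Q a c] color_path_in_ideal[of b Q a' c]
  ultimately show False
    using gentle_uniq(1)[OF gentle b(1)] a b ne unfolding Uniq_def by metis
qed

lemma sign_eq_iff_color_eq:
  assumes "sign_function Q S c \<epsilon>" "(x, s) \<in> color_incidences Q S c" "(x, s') \<in> color_incidences Q S c"
  shows "(\<epsilon> (x, s) = 1 \<longleftrightarrow> \<epsilon> (x, s') = 1) \<longleftrightarrow> s = s'"
proof (cases "s = s'")
  case False
  then have "\<epsilon> (x, s) = - \<epsilon> (x, s')" using assms unfolding sign_function_def by blast
  moreover have "\<epsilon> (x, s) \<in> {1, - 1}" using assms unfolding sign_function_def by blast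
  ultimately show ?thesis using False by auto
qed simp

text \<open>At a vertex the sign separates the colors, so sharing a side means sharing a color, and
  the color determines the incoming and the outgoing arrow.\<close>

lemma updownI:
  assumes fin: "fin_digraph Q" and col: "coloring Q S c"
    and gentle: "gentle_string_algebra Q (color_ideal Q c :: (('v, 'a) path \<Rightarrow>\<^sub>0 'k::field) set)"
    and rank: "rank_map Q c \<beta> r" and sign: "sign_function Q S c \<epsilon>"
  shows "updown Q c \<beta> r \<epsilon>"
proof -
  interpret fin_digraph Q by (rule fin)
  have inc: "(tail Q a, c a) \<in> color_incidences Q S c" "(head Q a, c a) \<in> color_incidences Q S c" if "a \<in> arcs Q" for a
    using that col by (auto simp: color_incidences_def coloring_def)
  show ?thesis
  proof
    fix a b assume ab: "a \<in> arcs Q" "b \<in> arcs Q"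
    show "a = b" if "head Q a = head Q b" "head_side Q c \<epsilon> a = head_side Q c \<epsilon> b"
    proof (rule color_head_unique[OF col gentle ab that(1)])
      show "c a = c b"
        using sign_eq_iff_color_eq[OF sign inc(2)[OF ab(1)], of "c b"] inc(2)[OF ab(2)] that by (simp add: head_side_def)
    qed
    show "a = b" if "tail Q a = tail Q b" "tail_side Q c \<epsilon> a = tail_side Q c \<epsilon> b"
    proof (rule color_tail_unique[OF col gentle ab that(1)])
      show "c a = c b"
        using sign_eq_iff_color_eq[OF sign inc(1)[OF ab(1)], of "c b"] inc(1)[OF ab(2)] that by (simp add: tail_side_def)
    qed
    show "head_side Q c \<epsilon> a = tail_side Q c \<epsilon> b \<longleftrightarrow> c a = c b" if "head Q a = tail Q b"
      using sign_eq_iff_color_eq[OF sign inc(2)[OF ab(1)], of "c b"] inc(1)[OF ab(2)] that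
      by (simp add: head_side_def tail_side_def)
  qed (use fin rank in auto)
qed

section \<open>Orbits inside the variety, and density\<close>

context updown_choice
begin

lemma orbit_in_rep_variety:
  fixes l :: "('v \<times> nat) set \<Rightarrow> 'k::field"
  shows "gl_orbit Q \<beta> (module l) \<subseteq> rep_variety Q c \<beta> r"
proof
  fix V assume "V \<in> gl_orbit Q \<beta> (module l)"
  then obtain g where g: "g \<in> (\<Pi>\<^sub>E x\<in>verts Q. GL (\<beta> x))" "V = gl_act Q \<beta> g (module l)"
    by (auto simp: gl_orbit_def)
  have gx: "g x \<in> carrier_mat (\<beta> x) (\<beta> x)" "det (g x) \<noteq> 0" if "x \<in> verts Q" for x
    using GL_inverse[of "g x" "\<beta> x"] g(1) that by auto
  note gi = inv_mat[OF gx]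
  have Va: "V a = g (head Q a) * module l a * inv_mat (g (tail Q a))" if a: "a \<in> arcs Q" for a
    using a Units_ring_mat(2)[OF gx[OF wf(1)[OF a]]] by (simp add: g(2) gl_act_def)
  have gM: "g (head Q a) * module l a \<in> carrier_mat (\<beta> (head Q a)) (\<beta> (tail Q a))" if a: "a \<in> arcs Q" for a
    by (rule mult_carrier_mat[OF gx(1)[OF wf(2)[OF a]] module_carrier[OF a]])
  have Vc: "V a \<in> carrier_mat (\<beta> (head Q a)) (\<beta> (tail Q a))" if a: "a \<in> arcs Q" for a
    unfolding Va[OF a] by (rule mult_carrier_mat[OF gM[OF a] gi(1)[OF wf(1)[OF a] wf(1)[OF a]]])
  have "V \<in> rep_space Q \<beta>"
    unfolding rep_space_def using Vc by (auto simp: g(2) gl_act_def)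
  moreover have "V b * V a = 0\<^sub>m (\<beta> (head Q b)) (\<beta> (tail Q a))"
    if ab: "a \<in> arcs Q" "b \<in> arcs Q" "head Q a = tail Q b" "c a = c b" for a b
  proof -
    let ?y = "head Q a"
    have y: "?y \<in> verts Q" using wf(2)[OF ab(1)] .
    have Mb: "module l b \<in> carrier_mat (\<beta> (head Q b)) (\<beta> ?y)" using module_carrier[OF ab(2)] ab(3) by simp
    have gMb: "g (head Q b) * module l b \<in> carrier_mat (\<beta> (head Q b)) (\<beta> ?y)" using gM[OF ab(2)] ab(3) by simp
    note ga = gx(1)[OF wf(2)[OF ab(1)]] and Ma = module_carrier[OF ab(1), of l]
      and iy = gi[OF y y] and it = gi[OF wf(1)[OF ab(1)] wf(1)[OF ab(1)]]
    have "inv_mat (g ?y) * (g ?y * module l a) = module l a"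
      using assoc_mult_mat[OF iy(1) ga Ma] iy(3) Ma by simp
    moreover have "inv_mat (g ?y) * (g ?y * module l a * inv_mat (g (tail Q a)))
        = inv_mat (g ?y) * (g ?y * module l a) * inv_mat (g (tail Q a))"
      by (rule assoc_mult_mat[symmetric, OF iy(1) gM[OF ab(1)] it(1)])
    ultimately have 1: "inv_mat (g ?y) * V a = module l a * inv_mat (g (tail Q a))"
      unfolding Va[OF ab(1)] by simp
    have "V b * V a = g (head Q b) * module l b * (inv_mat (g ?y) * V a)"
      unfolding Va[OF ab(2)] ab(3)[symmetric] by (rule assoc_mult_mat[OF gMb iy(1) Vc[OF ab(1)]])
    also have "\<dots> = g (head Q b) * (module l b * (module l a * inv_mat (g (tail Q a))))"
      unfolding 1 by (rule assoc_mult_mat[OF gx(1)[OF wf(2)[OF ab(2)]] Mb mult_carrier_mat[OF Ma it(1)]])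
    also have "module l b * (module l a * inv_mat (g (tail Q a))) = module l b * module l a * inv_mat (g (tail Q a))"
      by (rule assoc_mult_mat[symmetric, OF Mb Ma it(1)])
    also have "module l b * module l a = 0\<^sub>m (\<beta> (head Q b)) (\<beta> (tail Q a))"
      unfolding module_apply[OF ab(1)] module_apply[OF ab(2)] by (rule edge_mat_comp_zero[OF ab])
    also have "g (head Q b) * (0\<^sub>m (\<beta> (head Q b)) (\<beta> (tail Q a)) * inv_mat (g (tail Q a))) = 0\<^sub>m (\<beta> (head Q b)) (\<beta> (tail Q a))"
      using it(1) gx(1)[OF wf(2)[OF ab(2)]] by simp
    finally show ?thesis .
  qed
  moreover have "vec_space.rank (\<beta> (head Q a)) (V a) \<le> r a" if a: "a \<in> arcs Q" for a
  proof -
    obtain B C where BC: "B \<in> carrier_mat (\<beta> (head Q a)) (r a)" "C \<in> carrier_mat (r a) (\<beta> (tail Q a))" "module l a = B * C"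
      unfolding module_apply[OF a] by (rule edge_mat_factor[OF a])
    note ga = gx(1)[OF wf(2)[OF a]] and it = gi(1)[OF wf(1)[OF a] wf(1)[OF a]]
    have "g (head Q a) * (B * C) = g (head Q a) * B * C"
      by (rule assoc_mult_mat[symmetric, OF ga BC(1,2)])
    then have "V a = g (head Q a) * B * C * inv_mat (g (tail Q a))" unfolding Va[OF a] BC(3) by simp
    also have "\<dots> = g (head Q a) * B * (C * inv_mat (g (tail Q a)))"
      by (rule assoc_mult_mat[OF mult_carrier_mat[OF ga BC(1)] BC(2) it])
    finally show ?thesis
      using rank_factor_le[OF mult_carrier_mat[OF ga BC(1)] mult_carrier_mat[OF BC(2) it]] by simp
  qed
  ultimately show "V \<in> rep_variety Q c \<beta> r" by (simp add: rep_variety_def)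
qed

end

text \<open>Every open neighbourhood of \<open>V\<close> contains the part of the variety where a
  single polynomial, nonzero at \<open>V\<close>, does not vanish.\<close>

lemma dense_in_rep_varietyI:
  fixes U :: "('a \<Rightarrow> 'k::field mat) set"
  assumes "U \<subseteq> rep_variety Q c \<beta> r"
    and vanish: "\<And>P V. P \<in> polynomial_functions (rep_coordinates Q \<beta>) \<Longrightarrow> (\<And>W. W \<in> U \<Longrightarrow> P W = 0) \<Longrightarrow>
      V \<in> rep_variety Q c \<beta> r \<Longrightarrow> P V = 0"
  shows "dense_in (rep_variety_topology Q c \<beta> r) U"
  unfolding dense_in_def topspace_rep_variety_topology
proof (intro conjI equalityI subsetI)
  let ?T = "rep_variety_topology Q c \<beta> r :: ('a \<Rightarrow> 'k mat) topology"
  show "V \<in> rep_variety Q c \<beta> r" if "V \<in> ?T closure_of U" for V :: "'a \<Rightarrow> 'k mat"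
    using that closure_of_subset_topspace[of ?T U] by (auto simp: topspace_rep_variety_topology)
  fix V :: "'a \<Rightarrow> 'k mat" assume V: "V \<in> rep_variety Q c \<beta> r"
  show "V \<in> ?T closure_of U"
    unfolding in_closure_of topspace_rep_variety_topology
  proof (intro conjI allI impI V)
    fix N assume N: "V \<in> N \<and> openin ?T N"
    then obtain F where F: "F \<subseteq> polynomial_functions (rep_coordinates Q \<beta>)"
      "N = (rep_space Q \<beta> - {p \<in> rep_space Q \<beta>. \<forall>f\<in>F. f p = 0}) \<inter> rep_variety Q c \<beta> r"
      unfolding rep_variety_topology_def openin_subtopology openin_zariski by blast
    then obtain f where f: "f \<in> F" "f V \<noteq> 0" using N by blast
    then obtain W where "W \<in> U" "f W \<noteq> 0" using vanish[of f V] F(1) V by blast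
    moreover have "W \<in> rep_space Q \<beta>" "W \<in> rep_variety Q c \<beta> r"
      using \<open>W \<in> U\<close> assms(1) by (auto simp: rep_variety_def)
    ultimately show "\<exists>W. W \<in> U \<and> W \<in> N" using F(2) f(1) by blast
  qed
qed (use assms(1) in auto)

theorem corollary3p8:
  fixes Q :: "('v, 'a) pre_digraph" and S :: "'s set" and c :: "'a \<Rightarrow> 's"
    and \<beta> :: "'v \<Rightarrow> nat" and r :: "'a \<Rightarrow> nat" and \<epsilon> :: "'v \<times> 's \<Rightarrow> int"
    and \<Theta> :: "('v \<times> nat) set \<Rightarrow> 'v \<times> nat"
  assumes "fin_digraph Q"
    and "coloring Q S c"
    and "gentle_string_algebra Q (color_ideal Q c :: (('v, 'a) path \<Rightarrow>\<^sub>0 'k::alg_closed_field) set)"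
    and "maximal_rank_map Q c \<beta> r"
    and "sign_function Q S c \<epsilon>"
    and "choice_function (updown_graph Q c \<beta> r \<epsilon>) \<Theta>"
  shows "dense_in (rep_variety_topology Q c \<beta> r)
    (\<Union>l \<in> (\<Pi>\<^sub>E b\<in>bands (updown_graph Q c \<beta> r \<epsilon>). UNIV - {0 :: 'k}).
       gl_orbit Q \<beta> (updown_module Q c \<beta> r \<epsilon> \<Theta> l))"
proof -
  interpret updown_choice Q c \<beta> r \<epsilon> \<Theta>
    using updownI[OF assms(1-3) _ assms(5)] assms(4,6)
    by (simp add: updown_choice_def updown_choice_axioms_def maximal_rank_map_def)
  show ?thesis
  proof (rule dense_in_rep_varietyI)
    show "(\<Union>l \<in> (\<Pi>\<^sub>E b\<in>bands \<Gamma>. UNIV - {0 :: 'k}). gl_orbit Q \<beta> (module l)) \<subseteq> rep_variety Q c \<beta> r"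
      using orbit_in_rep_variety by blast
    fix P :: "('a \<Rightarrow> 'k mat) \<Rightarrow> 'k" and V :: "'a \<Rightarrow> 'k mat"
    assume P: "P \<in> polynomial_functions (rep_coordinates Q \<beta>)"
      and zero: "\<And>W. W \<in> (\<Union>l \<in> (\<Pi>\<^sub>E b\<in>bands \<Gamma>. UNIV - {0 :: 'k}). gl_orbit Q \<beta> (module l)) \<Longrightarrow> P W = 0"
      and V: "V \<in> rep_variety Q c \<beta> r"
    show "P V = 0"
    proof (rule vanishing_generic[OF infinite_alg_closed P])
      show "P W = 0" if "l \<in> (\<Pi>\<^sub>E b\<in>bands \<Gamma>. UNIV - {0})" "W \<in> gl_orbit Q \<beta> (module l)" for l W
        using zero that by blast
      fix l :: "('v \<times> nat) set \<Rightarrow> 'k"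
      assume l: "\<And>b. b \<in> bands \<Gamma> \<Longrightarrow> l b \<noteq> 0"
        "\<And>h. (\<And>x \<sigma>. h x \<sigma> \<in> carrier_mat (\<beta> x) (\<beta> x)) \<Longrightarrow> (\<And>x \<sigma>. x \<in> verts Q \<Longrightarrow> det (h x \<sigma>) \<noteq> 0) \<Longrightarrow>
          P (conj_rep h (module l)) = 0"
      show "P V = 0" by (rule vanishing_rep_variety[OF infinite_alg_closed P l V])
    qed
  qed
qed

end
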